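(* Assume $k(c):=\lambda+\theta+\lambda\Phi'(c)<0$ for all $c\in[0,1]$. Let $c\in[0,1)$, let $$x^0_1(c):=\frac{P_0}{\Phi(c)},\qquad x^0_2(c):=\frac{\theta\mu(1-c)+\lambda P_0}{(\lambda+\theta)(1-c)},\qquad V(x,c):=\inf_\tau\mathsf E\big[e^{-\lambda\tau}\big(U(X^x_\tau,c)-P_0\big)\big],$$ and for a set $\mathscr B\subseteq\mathbb R$ consider the problem of finding $x\in\mathscr B$ such that $$\big(U(x,c)-P_0\big)\frac{\phi_\lambda'(x)}{\phi_\lambda(x)}=U_x(x,c).\qquad(\ast)$$ For $\ell\in\mathbb R$ put $V^\ell(x,c):=(U(\ell,c)-P_0)\frac{\phi_\lambda(x)}{\phi_\lambda(\ell)}$ for $x>\ell$ and $V^\ell(x,c):=U(x,c)-P_0$ for $x\le\ell$. i) If $\gamma_*(c)\ge x^0_2(c)$, let $\ell_*(c)\in(-\infty,x^0_1(c))$ be the number such that $\{x\in\mathbb R:V(x,c)=U(x,c)-P_0\}=(-\infty,\ell_*(c)]$. Then $V(x,c)=V^{\ell_*(c)}(x,c)$ for all $x\in\mathbb R$, and $\ell_*(c)$ is the unique solution to $(\ast)$ in $\mathscr B=(-\infty,x^0_1(c))$. ii) If $\gamma_*(c)\le x^0_1(c)$, let $\ell_*(c)\in(-\infty,x^0_2(c))$ be the number such that $\{x\in\mathbb R:V(x,c)=U(x,c)-P_0\}=(-\infty,\ell_*(c)]$. Then $V(x,c)=V^{\ell_*(c)}(x,c)$ for all $x\in\mathbb R$,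 and $\ell_*(c)$ is the unique solution to $(\ast)$ in $\mathscr B=(-\infty,x^0_2(c))$.
   Context: Let $(\Omega,\mathcal A,\mathsf P)$ be a complete probability space carrying a one-dimensional standard Brownian motion $B$, with $(\mathcal F_t)_{t\ge0}$ the filtration generated by $B$ augmented by $\mathsf P$-null sets. Infima over $\tau$ are over all $(\mathcal F_t)$-stopping times valued in $[0,\infty]$, and $e^{-\lambda\tau}(U(X^x_\tau,c)-P_0):=0$ on $\{\tau=\infty\}$. Let $\theta,\mu,\sigma,\lambda,P_0>0$ be constants. For $x\in\mathbb R$, $X^x$ is the unique strong solution of $dX^x_t=\theta(\mu-X^x_t)dt+\sigma dB_t$, $X^x_0=x$, and $\mathbb L_Xf(x):=\tfrac12\sigma^2f''(x)+\theta(\mu-x)f'(x)$. The functions $\phi_\lambda,\psi_\lambda:\mathbb R\to(0,\infty)$ are the (unique up to positive factors) strictly decreasing, respectively strictly increasing, fundamental solutions of $\mathbb L_Xf=\lambda f$ on $\mathbb R$; explicitly, up to positive constants, $\phi_\lambda(x)=\int_0^\infty t^{\lambda/\theta-1}\exp\big(-\tfrac{t^2}{2}-\tfrac{(x-\mu)\sqrt{2\theta}}{\sigma}t\big)dt$ and $\psi_\lambda(x)=\phi_\lambda(2\mu-x)$. $\Phi:\mathbb R\to\mathbb R$ is $C^2$, and on $[0,1]$ it is decreasing and strictly convex, with $\Phi(1)=0$. For $c\in[0,1]$, $\mathcal S^c_0$ is the set of processes $\nu:\Omega\times[0,\infty)\to[0,\infty)$ that are nondecreasing, left-continuous, $(\mathcal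 F_t)$-adapted, with $c+\nu_t\le1$ for all $t\ge0$ and $\nu_0=0$, $\mathsf P$-a.s., and $$U(x,c):=\inf_{\nu\in\mathcal S^c_0}\mathsf E\Big[\int_{[0,\infty)}e^{-\lambda t}X^x_t\,d\nu_t+\int_0^\infty e^{-\lambda t}\lambda X^x_t\Phi(c+\nu_t)\,dt\Big].$$ Known background when $k<0$ on $[0,1]$ (defining $\gamma_*$): there is a decreasing function $\gamma_*\in C^1([0,1])$ such that $\{(x,c)\in\mathbb R\times[0,1]:U_c(x,c)>-x\}=\{(x,c)\in\mathbb R\times[0,1]:x<\gamma_*(c)\}$; it is bounded from below by $\tilde x(c)\vee\overline x_0(c)$ with $\tilde x(c):=\theta\mu(1-c)/\zeta(c)$, $\overline x_0(c):=\theta\mu\Phi(c)/\zeta(c)$, $\zeta(c):=(\lambda+\theta)(1-c)-\lambda\Phi(c)$; $U(\cdot,c)\in W^{2,\infty}_{loc}(\mathbb R)$ (so $U(\cdot,c)\in C^1$); and $$U(x,c)=\begin{cases}\dfrac{\psi_\lambda(x)}{\psi_\lambda(\gamma_*(c))}\Big[\gamma_*(c)(1-c)-\lambda\Phi(c)\Big(\dfrac{\gamma_*(c)-\mu}{\lambda+\theta}+\dfrac{\mu}{\lambda}\Big)\Big]+\lambda\Phi(c)\Big[\dfrac{x-\mu}{\lambda+\theta}+\dfrac\mu\lambda\Big], & x<\gamma_*(c),\\[6pt] x(1-c), & x\ge\gamma_*(c).\end{cases}$$ The existence of the number $\ell_*(c)$ in each of the two cases i), ii), and the optimality of $\inf\{t\ge0:X^x_t\le\ell_*(c)\}$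 for $V(x,c)$, are known from a preceding result. *)

theory Defs
  imports "HOL-Probability.Probability"
begin

definition C2 :: "(real \<Rightarrow> real) \<Rightarrow> bool" where
  "C2 f \<longleftrightarrow> (\<forall>x. f differentiable (at x)) \<and> (\<forall>x. deriv f differentiable (at x))
     \<and> continuous_on UNIV (deriv (deriv f))"

text \<open>On a closed interval the derivatives at the endpoints are one-sided.\<close>

definition C1_on_interval :: "real \<Rightarrow> real \<Rightarrow> (real \<Rightarrow> real) \<Rightarrow> bool" where
  "C1_on_interval a b f \<longleftrightarrow>
     (\<exists>f'. (\<forall>x\<in>{a..b}. (f has_real_derivative f' x) (at x within {a..b})) \<and> continuous_on {a..b} f')"

definition strictly_convex_on :: "real set \<Rightarrow> (real \<Rightarrow> real) \<Rightarrow> bool" where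
  "strictly_convex_on S f \<longleftrightarrow> convex S \<and>
     (\<forall>x\<in>S. \<forall>y\<in>S. \<forall>t. x \<noteq> y \<longrightarrow> 0 < t \<longrightarrow> t < 1 \<longrightarrow>
        f ((1 - t) * x + t * y) < (1 - t) * f x + t * f y)"

subsection \<open>Brownian motion, its augmented filtration, and the Ornstein-Uhlenbeck equation\<close>

text \<open>Processes are functions of a real time parameter of which only the values at times
  \<open>t \<ge> 0\<close> are ever used.\<close>

definition standard_brownian_motion :: "'a measure \<Rightarrow> (real \<Rightarrow> 'a \<Rightarrow> real) \<Rightarrow> bool" where
  "standard_brownian_motion P B \<longleftrightarrow>
     (\<forall>t\<ge>0. B t \<in> borel_measurable P) \<and>
     (AE \<omega> in P. B 0 \<omega> = 0) \<and>
     (AE \<omega> in P. continuous_on {0..} (\<lambda>t. B t \<omega>)) \<and>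
     (\<forall>s t. 0 \<le> s \<longrightarrow> s < t \<longrightarrow>
        distributed P lborel (\<lambda>\<omega>. B t \<omega> - B s \<omega>) (normal_density 0 (sqrt (t - s)))) \<and>
     (\<forall>(n::nat) ts. 0 \<le> ts 0 \<longrightarrow> (\<forall>i<n. ts i \<le> ts (Suc i)) \<longrightarrow>
        prob_space.indep_vars P (\<lambda>_. borel) (\<lambda>i \<omega>. B (ts (Suc i)) \<omega> - B (ts i) \<omega>) {..<n})"

text \<open>The time index is \<open>[0,\<infinity>]\<close>, so that \<open>stopping_time\<close> of the library applies to
  stopping times that may take the value \<open>\<infinity>\<close>; the condition it imposes at \<open>t = \<infinity>\<close> is void.\<close>

definition brownian_filtration ::
    "'a measure \<Rightarrow> (real \<Rightarrow> 'a \<Rightarrow> real) \<Rightarrow> ennreal \<Rightarrow> 'a measure" where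
  "brownian_filtration P B t =
     sigma (space P)
       ({B s -` A \<inter> space P | s A. 0 \<le> s \<and> ennreal s \<le> t \<and> A \<in> sets borel} \<union> null_sets P)"

definition adapted :: "'a measure \<Rightarrow> (real \<Rightarrow> 'a \<Rightarrow> real) \<Rightarrow> (real \<Rightarrow> 'a \<Rightarrow> real) \<Rightarrow> bool" where
  "adapted P B Y \<longleftrightarrow>
     (\<forall>t\<ge>0. Y t \<in> borel_measurable (brownian_filtration P B (ennreal t)))"

text \<open>\<open>dY = \<theta> (\<mu> - Y) dt + \<sigma> dB\<close>, \<open>Y 0 = x\<close>, in integrated form. The dispersion coefficient is
  constant and \<open>B 0 = 0\<close>, so the stochastic integral of \<open>\<sigma>\<close> over \<open>[0,t]\<close> is \<open>\<sigma> B t\<close>.\<close>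

definition ou_strong_solution ::
    "'a measure \<Rightarrow> (real \<Rightarrow> 'a \<Rightarrow> real) \<Rightarrow> real \<Rightarrow> real \<Rightarrow> real \<Rightarrow> real \<Rightarrow> (real \<Rightarrow> 'a \<Rightarrow> real) \<Rightarrow> bool"
  where
  "ou_strong_solution P B \<theta> \<mu> \<sigma> x Y \<longleftrightarrow>
     adapted P B Y \<and>
     (AE \<omega> in P. continuous_on {0..} (\<lambda>t. Y t \<omega>)) \<and>
     (AE \<omega> in P. \<forall>t\<ge>0. Y t \<omega> = x + (LINT s:{0..t}|lborel. \<theta> * (\<mu> - Y s \<omega>)) + \<sigma> * B t \<omega>)"

text \<open>Below, \<open>\<rho>\<close> is the discount rate.\<close>

definition ou_generator ::
    "real \<Rightarrow> real \<Rightarrow> real \<Rightarrow> (real \<Rightarrow> real) \<Rightarrow> real \<Rightarrow> real" where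
  "ou_generator \<theta> \<mu> \<sigma> f x = 1/2 * \<sigma>^2 * deriv (deriv f) x + \<theta> * (\<mu> - x) * deriv f x"

text \<open>A function is a decreasing (increasing) fundamental solution iff it satisfies the following;
  these properties determine it up to a positive factor.\<close>

definition decreasing_fundamental_solution ::
    "real \<Rightarrow> real \<Rightarrow> real \<Rightarrow> real \<Rightarrow> (real \<Rightarrow> real) \<Rightarrow> bool" where
  "decreasing_fundamental_solution \<theta> \<mu> \<sigma> \<rho> f \<longleftrightarrow>
     C2 f \<and> (\<forall>x. f x > 0) \<and> (\<forall>x. ou_generator \<theta> \<mu> \<sigma> f x = \<rho> * f x) \<and> strict_antimono_on UNIV f"

definition increasing_fundamental_solution ::
    "real \<Rightarrow> real \<Rightarrow> real \<Rightarrow> real \<Rightarrow> (real \<Rightarrow> real) \<Rightarrow> bool" where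
  "increasing_fundamental_solution \<theta> \<mu> \<sigma> \<rho> f \<longleftrightarrow>
     C2 f \<and> (\<forall>x. f x > 0) \<and> (\<forall>x. ou_generator \<theta> \<mu> \<sigma> f x = \<rho> * f x) \<and> strict_mono f"

subsection \<open>The singular control problem\<close>

text \<open>For nondecreasing left-continuous \<open>v\<close> on \<open>[0,\<infinity>)\<close> this is the measure \<open>dv\<close> with
  \<open>dv [a,b) = v b - v a\<close>; in particular the atom at \<open>0\<close> is \<open>v(0+) - v 0\<close>. Since
  \<open>interval_measure\<close> expects a right-continuous function, it is given the
  right limits \<open>v(t+)\<close>, extended by \<open>v 0\<close> to negative times.\<close>

definition left_stieltjes_measure :: "(real \<Rightarrow> real) \<Rightarrow> real measure" where
  "left_stieltjes_measure v = interval_measure (\<lambda>t. if t < 0 then v 0 else Lim (at_right t) v)"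

definition admissible_controls ::
    "'a measure \<Rightarrow> (real \<Rightarrow> 'a \<Rightarrow> real) \<Rightarrow> real \<Rightarrow> (real \<Rightarrow> 'a \<Rightarrow> real) set" where
  "admissible_controls P B c =
     {\<nu>. adapted P B \<nu> \<and> (\<forall>t\<ge>0. \<forall>\<omega>\<in>space P. 0 \<le> \<nu> t \<omega>) \<and>
        (AE \<omega> in P. mono_on {0..} (\<lambda>t. \<nu> t \<omega>) \<and>
            (\<forall>t>0. continuous (at_left t) (\<lambda>s. \<nu> s \<omega>)) \<and>
            (\<forall>t\<ge>0. c + \<nu> t \<omega> \<le> 1) \<and> \<nu> 0 \<omega> = 0)}"

text \<open>\<open>Y\<close> is the uncontrolled price process, \<open>c\<close> the initial inventory level.\<close>

definition control_cost ::
    "'a measure \<Rightarrow> real \<Rightarrow> (real \<Rightarrow> real) \<Rightarrow> (real \<Rightarrow> 'a \<Rightarrow> real) \<Rightarrow> real \<Rightarrow> (real \<Rightarrow> 'a \<Rightarrow> real) \<Rightarrow> real"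
  where
  "control_cost P \<rho> \<Phi> Y c \<nu> =
     (LINT \<omega>|P. (LINT t:{0..}|left_stieltjes_measure (\<lambda>t. \<nu> t \<omega>). exp (- \<rho> * t) * Y t \<omega>)
             + (LINT t:{0..}|lborel. exp (- \<rho> * t) * \<rho> * Y t \<omega> * \<Phi> (c + \<nu> t \<omega>)))"

definition control_value ::
    "'a measure \<Rightarrow> (real \<Rightarrow> 'a \<Rightarrow> real) \<Rightarrow> real \<Rightarrow> (real \<Rightarrow> real) \<Rightarrow> (real \<Rightarrow> real \<Rightarrow> 'a \<Rightarrow> real)
      \<Rightarrow> real \<Rightarrow> real \<Rightarrow> real" where
  "control_value P B \<rho> \<Phi> X x c = (INF \<nu>\<in>admissible_controls P B c. control_cost P \<rho> \<Phi> (X x) c \<nu>)"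

subsection \<open>The optimal stopping problem\<close>

text \<open>\<open>E[exp (- \<rho> \<tau>) G(Y\<^sub>\<tau>)]\<close>, the integrand being \<open>0\<close> where \<open>\<tau> = \<infinity>\<close>.\<close>

definition stopping_cost ::
    "'a measure \<Rightarrow> real \<Rightarrow> (real \<Rightarrow> 'a \<Rightarrow> real) \<Rightarrow> (real \<Rightarrow> real) \<Rightarrow> ('a \<Rightarrow> ennreal) \<Rightarrow> real" where
  "stopping_cost P \<rho> Y G \<tau> =
     (LINT \<omega>|P. (if \<tau> \<omega> = \<infinity> then 0
        else exp (- \<rho> * enn2real (\<tau> \<omega>)) * G (Y (enn2real (\<tau> \<omega>)) \<omega>)))"

definition stopping_value ::
    "'a measure \<Rightarrow> (real \<Rightarrow> 'a \<Rightarrow> real) \<Rightarrow> real \<Rightarrow> (real \<Rightarrow> 'a \<Rightarrow> real) \<Rightarrow> (real \<Rightarrow> real) \<Rightarrow> real" where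
  "stopping_value P B \<rho> Y G =
     (INF \<tau>\<in>{\<tau>. stopping_time (brownian_filtration P B) \<tau>}. stopping_cost P \<rho> Y G \<tau>)"

definition first_time_below :: "(real \<Rightarrow> 'a \<Rightarrow> real) \<Rightarrow> real \<Rightarrow> 'a \<Rightarrow> ennreal" where
  "first_time_below Y l \<omega> = Inf {ennreal t | t. 0 \<le> t \<and> Y t \<omega> \<le> l}"

end

theory Submission
  imports Defs "HOL-Real_Asymp.Real_Asymp"
begin

text \<open>Put \<open>Z t = exp (\<theta> t) (X t - \<mu>)\<close> and \<open>b = \<sigma>\<^sup>2 / (4 \<theta>)\<close>. Since \<open>dZ = \<sigma> exp (\<theta> t) dB\<close>, the
  processes \<open>exp (- u Z t - u\<^sup>2 b exp (2 \<theta> t))\<close>, \<open>u > 0\<close>, are martingales, and integrating them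
  against \<open>u powr (\<rho> / \<theta> - 1) du\<close> gives \<open>exp (- \<rho> t) \<phi> (X t)\<close>. Optional stopping for each \<open>u\<close>, followed by
  Fubini, makes Ito's formula unnecessary: stopping at the first time below \<open>l\<close> from \<open>x > l\<close> costs
  \<open>G l \<phi> x / \<phi> l\<close> with \<open>G = U - P\<^sub>0\<close>, and all stopping costs are bounded below.

  If the threshold \<open>l\<close> is optimal, comparison with the other thresholds shows that \<open>l\<close> minimizes
  \<open>G / \<phi>\<close>, which is equation \<open>(\<ast>)\<close>. Multiplied by the integrating factor
  \<open>exp (- \<theta> (y - \<mu>)\<^sup>2 / \<sigma>\<^sup>2)\<close>, the Wronskian \<open>G' \<phi> - G \<phi>'\<close> has a derivative with the sign of
  \<open>(L - \<rho>) G\<close>, which is that of \<open>x\<^sub>1 - y\<close> for \<open>y < \<gamma> c\<close> and that of \<open>x\<^sub>2 - y\<close> for \<open>y > \<gamma> c\<close>. As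
  \<open>x\<^sub>1 < x\<^sub>2\<close>, it is strictly increasing on the half-lines in question and has at most one zero there.\<close>

subsection \<open>The decreasing fundamental solution as a Gaussian moment\<close>

text \<open>The constants are forced. The quadratic variation of \<open>Z\<close> over
  \<open>[s,t]\<close> is \<open>\<sigma>\<^sup>2 (exp (2 \<theta> t) - exp (2 \<theta> s)) / (2
  \<theta>)\<close>, and \<open>u\<^sup>2 / 2\<close> times it is
  \<open>u\<^sup>2 b (exp (2 \<theta> t) - exp (2 \<theta> s))\<close>. Substituting
  \<open>v = u exp (\<theta> t)\<close> in the mixture leaves a function of \<open>X t\<close> times
  a power of \<open>exp (\<theta> t)\<close>, which the exponent of the weight turns into
  \<open>exp (- \<rho> t)\<close>. With \<open>u > 0\<close> the mixture decreases in the state, and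
  each martingale is bounded while \<open>X\<close> stays above a level; so optional stopping is an
  equality for downward hitting times. For arbitrary stopping times Fatou yields an inequality,
  whose purpose is to bound the costs below: a real infimum can be compared with its members only on
  a set bounded below. As \<open>exp (\<theta> t)\<close> is smooth and deterministic,
  \<open>Z\<close> is a pathwise limit of weighted sums of Brownian increments, so Gaussian moments
  and independence give the martingale property. The analytic obstacle is that \<open>U\<close> need
  not be twice differentiable at \<open>\<gamma> c\<close>; the Wronskian contains first derivatives
  only and stays continuous there.\<close>

definition gauss_moment :: "real \<Rightarrow> real \<Rightarrow> real \<Rightarrow> real" where
  "gauss_moment b p y = (LINT v:{0<..}|lborel. v powr p * exp (- y * v - b * v^2))"

text \<open>Completing the square bounds \<open>exp ((1 - y) * v - b * v^2)\<close> by
  \<open>K\<close>, so the integrand is at most \<open>K\<close> times the Gamma integrand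
  \<open>v powr p / exp v\<close>. The condition on \<open>p\<close> is integrability at 0.\<close>

lemma gauss_moment_integrable:
  fixes b p y :: real
  assumes b: "b > 0" and p: "p > -1"
  shows "set_integrable lborel {0<..} (\<lambda>v. v powr p * exp (- y * v - b * v^2))"
proof -
  define K where "K = exp ((1 - y)^2 / (4 * b))"
  have "(\<integral>\<^sup>+t. ennreal (indicator {0..} t * t powr (p + 1 - 1) / exp t) \<partial>lborel) = ennreal (Gamma (p + 1))"
    using Gamma_conv_nn_integral_real[of "p+1"] p by simp
  hence "integrable lborel (\<lambda>t::real. indicator {0..} t * t powr p / exp t)"
    by (intro integrableI_nonneg) (auto simp: top.not_eq_extremum)
  hence "integrable lborel (\<lambda>t::real. K * (indicator {0..} t * t powr p / exp t))"
    by (rule integrable_mult_right)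
  thus ?thesis unfolding set_integrable_def
  proof (rule Bochner_Integration.integrable_bound)
    show "AE v in lborel. norm (indicat_real {0<..} v *\<^sub>R (v powr p * exp (- y * v - b * v\<^sup>2)))
         \<le> norm (K * (indicator {0..} v * v powr p / exp v))"
    proof (intro AE_I2)
      fix v :: real
      have "(1 - y)^2 / (4 * b) - ((1 - y) * v - b * v^2) = b * (v - (1 - y) / (2 * b))^2"
        using b by (simp add: field_simps power2_eq_square)
      hence "(1 - y) * v - b * v^2 \<le> (1 - y)^2 / (4 * b)"
        using b by (smt (verit) mult_nonneg_nonneg zero_le_power2)
      hence "exp (- y * v - b * v\<^sup>2) * exp v \<le> K"
        unfolding K_def exp_add[symmetric] by (simp add: algebra_simps)
      hence "v powr p * exp (- y * v - b * v\<^sup>2) \<le> K * (v powr p / exp v)"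
        by (simp add: field_simps) (metis mult.commute mult.left_commute mult_left_mono powr_ge_zero)
      thus "norm (indicat_real {0<..} v *\<^sub>R (v powr p * exp (- y * v - b * v\<^sup>2)))
         \<le> norm (K * (indicator {0..} v * v powr p / exp v))"
        by (auto simp: indicator_def K_def)
    qed
  qed auto
qed

lemma gauss_moment_pos:
  assumes "b > 0" "p > -1"
  shows "gauss_moment b p y > 0"
proof -
  let ?f = "\<lambda>v. indicator {0<..} v *\<^sub>R (v powr p * exp (- y * v - b * v^2)) :: real"
  have int: "integrable lborel ?f"
    using gauss_moment_integrable[OF assms] by (simp add: set_integrable_def)
  have "integral\<^sup>L lborel ?f \<noteq> 0"
  proof
    assume "integral\<^sup>L lborel ?f = 0"
    hence "AE v in lborel. ?f v = 0"
      using int by (subst (asm) integral_nonneg_eq_0_iff_AE) auto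
    hence "AE v in lborel. v \<notin> {0<..<1::real}"
      by eventually_elim (auto simp: indicator_def split: if_splits)
    hence "emeasure lborel {0<..<1::real} = 0"
      by (subst (asm) AE_iff_measurable[of "{0<..<1}"]) auto
    thus False by simp
  qed
  moreover have "integral\<^sup>L lborel ?f \<ge> 0"
    by (intro integral_nonneg_AE) auto
  ultimately have "integral\<^sup>L lborel ?f > 0" by linarith
  thus ?thesis unfolding gauss_moment_def set_lebesgue_integral_def .
qed

text \<open>Controls difference quotients of the exponential uniformly in the increment, for
  differentiation under the integral.\<close>

lemma abs_exp_minus_one_le: "\<bar>exp x - 1\<bar> \<le> \<bar>x\<bar> * exp \<bar>x\<bar>" for x :: real
proof (cases "x \<ge> 0")
  case True
  have "1 - x \<le> exp (-x)" using exp_ge_add_one_self[of "-x"] by simp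
  hence "exp x * (1 - x) \<le> exp x * exp (-x)" by (intro mult_left_mono) auto
  thus ?thesis using True by (simp add: exp_minus_inverse algebra_simps)
next
  case False
  have "1 + x \<le> exp x" by simp
  moreover have "- x \<le> - x * exp (- x)"
    using mult_left_mono[of 1 "exp (- x)" "- x"] False by simp
  ultimately have "1 - exp x \<le> - (x * exp (- x))" by linarith
  moreover have "exp x < 1" using False by simp
  ultimately show ?thesis using False by (simp add: abs_if)
qed

text \<open>Differentiation under the integral: each derivative in \<open>y\<close> brings down a
  factor \<open>- v\<close>, which raises the exponent by one.\<close>

lemma gauss_moment_has_derivative:
  assumes b: "b > 0" and p: "p > -1"
  shows "(gauss_moment b p has_real_derivative - gauss_moment b (p + 1) y) (at y)"
  unfolding DERIV_def LIMSEQ_SEQ_conv[symmetric]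
proof (intro allI impI)
  fix S :: "nat \<Rightarrow> real" assume S: "(\<forall>n. S n \<noteq> 0) \<and> S \<longlonglongrightarrow> 0"
  \<comment> \<open>A null sequence is bounded, so the single kernel at \<open>y - R\<close>
    dominates all its difference quotients.\<close>
  then obtain R where R: "\<And>n. \<bar>S n\<bar> \<le> R"
    by (metis convergentI convergent_imp_Bseq Bseq_def real_norm_def)
  let ?k = "\<lambda>q z v. indicator {0<..} v *\<^sub>R (v powr q * exp (- z * v - b * v^2)) :: real"
  have int: "integrable lborel (?k q z)" if "q > -1" for q z
    using gauss_moment_integrable[OF b that] by (simp add: set_integrable_def)
  let ?s = "\<lambda>n v. (?k p (y + S n) v - ?k p y v) / S n"
  have eq: "(gauss_moment b p (y + S n) - gauss_moment b p y) / S n = integral\<^sup>L lborel (?s n)" for n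
    using Bochner_Integration.integral_diff[OF int[OF p, of "y + S n"] int[OF p, of y]]
    by (simp add: gauss_moment_def set_lebesgue_integral_def)
  have "(\<lambda>n. integral\<^sup>L lborel (?s n)) \<longlonglongrightarrow> integral\<^sup>L lborel (\<lambda>v. - ?k (p + 1) y v)"
  proof (rule integral_dominated_convergence)
    show "integrable lborel (?k (p + 1) (y - R))" using p by (intro int) auto
    show "AE v in lborel. (\<lambda>n. ?s n v) \<longlonglongrightarrow> - ?k (p + 1) y v"
    proof (intro AE_I2)
      fix v :: real
      show "(\<lambda>n. ?s n v) \<longlonglongrightarrow> - ?k (p + 1) y v"
      proof (cases "v > 0")
        case True
        have "((\<lambda>z. v powr p * exp (- z * v - b * v\<^sup>2)) has_real_derivative
                 - (v powr (p + 1) * exp (- y * v - b * v\<^sup>2))) (at y)"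
          using True by (auto intro!: derivative_eq_intros simp: powr_add)
        hence "(\<lambda>n. (v powr p * exp (- (y + S n) * v - b * v\<^sup>2) - v powr p * exp (- y * v - b * v\<^sup>2)) / S n)
                 \<longlonglongrightarrow> - (v powr (p + 1) * exp (- y * v - b * v\<^sup>2))"
          unfolding DERIV_def LIMSEQ_SEQ_conv[symmetric] using S by (auto simp: o_def)
        thus ?thesis using True by simp
      qed auto
    qed
    fix n
    show "AE v in lborel. norm (?s n v) \<le> ?k (p + 1) (y - R) v"
    proof (intro AE_I2)
      fix v :: real
      show "norm (?s n v) \<le> ?k (p + 1) (y - R) v"
      proof (cases "v > 0")
        case True
        have "\<bar>exp (- S n * v) - 1\<bar> \<le> \<bar>S n\<bar> * v * exp (\<bar>S n\<bar> * v)"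
          using abs_exp_minus_one_le[of "- S n * v"] True by (simp add: abs_mult)
        also have "\<dots> \<le> \<bar>S n\<bar> * v * exp (R * v)"
          using True R[of n] by (intro mult_left_mono) (auto intro: mult_right_mono)
        finally have 1: "\<bar>exp (- S n * v) - 1\<bar> / \<bar>S n\<bar> \<le> v * exp (R * v)"
          using S by (simp add: field_simps)
        have "?s n v = v powr p * exp (- y * v - b * v^2) * ((exp (- S n * v) - 1) / S n)"
          using True by (simp add: field_simps exp_add[symmetric])
        hence "norm (?s n v) = v powr p * exp (- y * v - b * v^2) * (\<bar>exp (- S n * v) - 1\<bar> / \<bar>S n\<bar>)"
          by (simp only: real_norm_def abs_mult abs_divide abs_exp_cancel abs_of_nonneg[OF powr_ge_zero])
        also have "\<dots> \<le> v powr p * exp (- y * v - b * v^2) * (v * exp (R * v))"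
          by (intro mult_left_mono 1) auto
        also have "\<dots> = ?k (p + 1) (y - R) v"
          using True by (simp add: powr_add exp_add[symmetric] algebra_simps)
        finally show ?thesis .
      qed auto
    qed
  qed auto
  moreover have "integral\<^sup>L lborel (\<lambda>v. - ?k (p + 1) y v) = - gauss_moment b (p + 1) y"
    unfolding gauss_moment_def set_lebesgue_integral_def by (rule Bochner_Integration.integral_minus)
  ultimately show "(\<lambda>n. (gauss_moment b p (y + S n) - gauss_moment b p y) / S n) \<longlonglongrightarrow> - gauss_moment b (p + 1) y"
    unfolding eq by simp
qed

text \<open>The left-hand side integrates the derivative of
  \<open>v powr a * exp (- y * v - b * v^2)\<close>, which vanishes at both ends of the half-line.
  Since differentiation shifts the exponent, this is the differential equation of the moment in
  disguise.\<close>

lemma gauss_moment_recurrence: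
  assumes b: "b > 0" and a: "a > 0"
  shows "a * gauss_moment b (a - 1) y - y * gauss_moment b a y - 2 * b * gauss_moment b (a + 1) y = 0"
proof -
  define f where "f v = a * (v powr (a - 1) * exp (- y * v - b * v^2))
      - y * (v powr a * exp (- y * v - b * v^2)) - 2 * b * (v powr (a + 1) * exp (- y * v - b * v^2))"
    for v :: real
  have e: "einterval 0 \<infinity> = {0<..}" by (auto simp: einterval_def)
  have int: "set_integrable lborel {0<..} (\<lambda>v. v powr q * exp (- y * v - b * v^2))" if "q > -1" for q
    by (rule gauss_moment_integrable[OF b that])
  have "(LBINT v=0..\<infinity>. f v) = 0 - 0"
  proof (rule interval_integral_FTC_integrable[where F = "\<lambda>v. v powr a * exp (- y * v - b * v^2)"])
    show "((\<lambda>v. v powr a * exp (- y * v - b * v^2)) has_vector_derivative f x) (at x)"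
      if "0 < ereal x" for x
    proof -
      have "x > 0" using that by simp
      thus ?thesis unfolding f_def has_real_derivative_iff_has_vector_derivative[symmetric]
        by (auto intro!: derivative_eq_intros simp: powr_diff powr_add power2_eq_square field_simps)
    qed
    show "isCont f x" if "0 < ereal x" for x
      unfolding f_def using that by (intro continuous_intros) auto
    show "set_integrable lborel (einterval 0 \<infinity>) f" unfolding e f_def
      using a by (intro set_integral_diff set_integrable_mult_right int) auto
    have "((\<lambda>v. v powr a * exp (- y * v - b * v^2)) \<longlongrightarrow> 0) (at_right 0)"
      using a b by real_asymp
    thus "(((\<lambda>v. v powr a * exp (- y * v - b * v\<^sup>2)) \<circ> real_of_ereal) \<longlongrightarrow> 0) (at_right 0)"
      by (simp add: ereal_tendsto_simps zero_ereal_def)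
    have "((\<lambda>v. v powr a * exp (- y * v - b * v^2)) \<longlongrightarrow> 0) at_top"
      using a b by real_asymp
    thus "(((\<lambda>v. v powr a * exp (- y * v - b * v\<^sup>2)) \<circ> real_of_ereal) \<longlongrightarrow> 0) (at_left \<infinity>)"
      by (simp add: ereal_tendsto_simps)
  qed auto
  hence "(LINT v:{0<..}|lborel. f v) = 0"
    by (simp add: interval_lebesgue_integral_def e)
  moreover have "(LINT v:{0<..}|lborel. f v) =
     a * gauss_moment b (a - 1) y - y * gauss_moment b a y - 2 * b * gauss_moment b (a + 1) y"
    unfolding f_def gauss_moment_def using a
    by (subst set_integral_diff | intro set_integrable_mult_right set_integral_diff int | simp)+
  ultimately show ?thesis by simp
qed

text \<open>The substitution \<open>v = t sqrt (2 \<theta>) / \<sigma>\<close> turns this into the usual integral representation of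
  the decreasing fundamental solution, up to a constant factor.\<close>

definition ou_phi :: "real \<Rightarrow> real \<Rightarrow> real \<Rightarrow> real \<Rightarrow> real \<Rightarrow> real" where
  "ou_phi \<theta> \<mu> \<sigma> \<rho> x = gauss_moment (\<sigma>^2 / (4 * \<theta>)) (\<rho> / \<theta> - 1) (x - \<mu>)"

text \<open>The first two derivatives are the moments with exponents raised by one and two, with
  alternating signs. With \<open>a = \<rho> / \<theta>\<close> and
  \<open>4 * \<theta> * b = \<sigma>^2\<close>, the recurrence times \<theta> is the eigenvalue
  equation of the generator.\<close>

lemma ou_phi_fundamental:
  assumes "\<theta> > 0" "\<sigma> > 0" "\<rho> > 0"
  shows "decreasing_fundamental_solution \<theta> \<mu> \<sigma> \<rho> (ou_phi \<theta> \<mu> \<sigma> \<rho>)"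
proof -
  define b where "b = \<sigma>^2 / (4 * \<theta>)"
  define a where "a = \<rho> / \<theta>"
  have b: "b > 0" and a: "a > 0" using assms by (auto simp: b_def a_def)
  have D: "((\<lambda>x. gauss_moment b p (x - \<mu>)) has_real_derivative - gauss_moment b (p + 1) (x - \<mu>)) (at x)"
    if "p > -1" for p x
    using DERIV_shift[of "gauss_moment b p" "- gauss_moment b (p + 1) (x - \<mu>)" x "- \<mu>"]
      gauss_moment_has_derivative[OF b that, of "x - \<mu>"] by simp
  let ?F = "ou_phi \<theta> \<mu> \<sigma> \<rho>"
  have F: "?F = (\<lambda>x. gauss_moment b (a - 1) (x - \<mu>))"
    by (auto simp: ou_phi_def a_def b_def)
  have D1: "(?F has_real_derivative - gauss_moment b a (x - \<mu>)) (at x)" for x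
    using D[of "a - 1" x] a by (simp add: F)
  hence d1: "deriv ?F = (\<lambda>x. - gauss_moment b a (x - \<mu>))" by (auto intro: DERIV_imp_deriv)
  have D2: "(deriv ?F has_real_derivative gauss_moment b (a + 1) (x - \<mu>)) (at x)" for x
    unfolding d1 using DERIV_minus[OF D[of a x]] a by simp
  hence d2: "deriv (deriv ?F) = (\<lambda>x. gauss_moment b (a + 1) (x - \<mu>))" by (auto intro: DERIV_imp_deriv)
  have "continuous_on UNIV (deriv (deriv ?F))" unfolding d2
    using D[of "a + 1"] a by (intro DERIV_continuous_on) (auto simp: has_field_derivative_at_within)
  hence "C2 ?F" using D1 D2 unfolding C2_def
    by (auto simp: real_differentiable_def)
  moreover have "ou_generator \<theta> \<mu> \<sigma> ?F x = \<rho> * ?F x" for x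
  proof -
    have "\<theta> * (a * gauss_moment b (a - 1) (x - \<mu>) - (x - \<mu>) * gauss_moment b a (x - \<mu>)
       - 2 * b * gauss_moment b (a + 1) (x - \<mu>)) = 0"
      using gauss_moment_recurrence[OF b a, of "x - \<mu>"] by simp
    hence "1/2 * (4 * \<theta> * b) * gauss_moment b (a + 1) (x - \<mu>) + \<theta> * (\<mu> - x) * (- gauss_moment b a (x - \<mu>))
       = \<theta> * a * gauss_moment b (a - 1) (x - \<mu>)" by (simp add: algebra_simps)
    moreover have "\<theta> * a = \<rho>" "4 * \<theta> * b = \<sigma>^2" using assms by (auto simp: a_def b_def)
    ultimately show ?thesis
      unfolding ou_generator_def d2 unfolding d1 unfolding F by simp
  qed
  moreover have "strict_antimono_on UNIV ?F"
  proof (rule monotone_onI)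
    fix x y :: real assume "x < y"
    thus "?F x > ?F y"
      by (rule DERIV_neg_imp_decreasing) (use D1 gauss_moment_pos[OF b, of a] a in force)
  qed
  moreover have "?F x > 0" for x unfolding F using gauss_moment_pos[OF b] a by auto
  ultimately show ?thesis unfolding decreasing_fundamental_solution_def by auto
qed

section \<open>Uniqueness of the decreasing fundamental solution up to a factor\<close>

lemma C2_deriv:
  assumes "C2 f"
  shows "(f has_real_derivative deriv f x) (at x)" "(deriv f has_real_derivative deriv (deriv f) x) (at x)"
  using assms by (auto simp: C2_def DERIV_deriv_iff_real_differentiable)

lemma decreasing_fundamental_solution_deriv_nonpos:
  assumes "decreasing_fundamental_solution \<theta> \<mu> \<sigma> \<rho> f"
  shows "deriv f x \<le> 0"
proof (rule ccontr)
  assume "\<not> deriv f x \<le> 0"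
  then obtain d where "d > 0" "\<And>h. h > 0 \<Longrightarrow> h < d \<Longrightarrow> f x < f (x + h)"
    using DERIV_pos_inc_right[of f "deriv f x" x] C2_deriv(1)[of f x] assms
    unfolding decreasing_fundamental_solution_def by auto
  hence "f x < f (x + d/2)" by auto
  moreover have "f (x + d/2) < f x"
    using assms \<open>d > 0\<close> unfolding decreasing_fundamental_solution_def by (auto dest!: monotone_onD[where x=x and y="x+d/2"])
  ultimately show False by simp
qed

text \<open>By Abel's identity the weighted Wronskian \<open>w\<close> is constant. If it were
  positive, then to the right of \<mu>, where \<open>deriv f * g\<close> is nonpositive and
  \<open>f\<close> is at most \<open>f \<mu>\<close>, the function \<open>g\<close> would decrease
  at a rate bounded away from zero and become negative. Exchanging \<open>f\<close> and
  \<open>g\<close> gives the reverse inequality.\<close>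

lemma wronskian_nonpos:
  assumes f: "decreasing_fundamental_solution \<theta> \<mu> \<sigma> \<rho> f"
    and g: "decreasing_fundamental_solution \<theta> \<mu> \<sigma> \<rho> g"
    and "\<theta> > 0" "\<sigma> > 0"
  shows "deriv f x * g x - f x * deriv g x \<le> 0"
proof (rule ccontr)
  assume neg: "\<not> ?thesis"
  define w where "w y = (deriv f y * g y - f y * deriv g y) * exp (- \<theta> * (y - \<mu>)^2 / \<sigma>^2)" for y
  have C: "C2 f" "C2 g" using f g by (auto simp: decreasing_fundamental_solution_def)
  have "(w has_real_derivative 0) (at y)" for y
  proof -
    have "1/2 * \<sigma>^2 * deriv (deriv f) y = \<rho> * f y - \<theta> * (\<mu> - y) * deriv f y"
         "1/2 * \<sigma>^2 * deriv (deriv g) y = \<rho> * g y - \<theta> * (\<mu> - y) * deriv g y"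
      using f g by (auto simp: decreasing_fundamental_solution_def ou_generator_def algebra_simps)
    hence "deriv (deriv f) y = (\<rho> * f y - \<theta> * (\<mu> - y) * deriv f y) * 2 / \<sigma>^2"
          "deriv (deriv g) y = (\<rho> * g y - \<theta> * (\<mu> - y) * deriv g y) * 2 / \<sigma>^2"
      using \<open>\<sigma> > 0\<close> by (auto simp: field_simps)
    note e = this
    have E: "((\<lambda>y. exp (- \<theta> * (y - \<mu>)^2 / \<sigma>^2)) has_real_derivative
        exp (- \<theta> * (y - \<mu>)^2 / \<sigma>^2) * (- \<theta> * (2 * (y - \<mu>)) / \<sigma>^2)) (at y)"
      using \<open>\<sigma> > 0\<close> by (auto intro!: derivative_eq_intros simp: power2_eq_square)
    have "(w has_real_derivative
       (deriv (deriv f) y * g y + deriv f y * deriv g y - (deriv f y * deriv g y + f y * deriv (deriv g) y))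
         * exp (- \<theta> * (y - \<mu>)^2 / \<sigma>^2)
       + (deriv f y * g y - f y * deriv g y) * (exp (- \<theta> * (y - \<mu>)^2 / \<sigma>^2) * (- \<theta> * (2 * (y - \<mu>)) / \<sigma>^2))) (at y)"
      unfolding w_def
      using DERIV_mult[OF DERIV_diff[OF DERIV_mult[OF C2_deriv(2)[OF C(1)] C2_deriv(1)[OF C(2)]]
          DERIV_mult[OF C2_deriv(1)[OF C(1)] C2_deriv(2)[OF C(2)]]] E] by (simp add: algebra_simps)
    also have "(deriv (deriv f) y * g y + deriv f y * deriv g y - (deriv f y * deriv g y + f y * deriv (deriv g) y))
         * exp (- \<theta> * (y - \<mu>)^2 / \<sigma>^2)
       + (deriv f y * g y - f y * deriv g y) * (exp (- \<theta> * (y - \<mu>)^2 / \<sigma>^2) * (- \<theta> * (2 * (y - \<mu>)) / \<sigma>^2)) = 0"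
      unfolding e using \<open>\<sigma> > 0\<close> by (simp add: field_simps)
    finally show ?thesis .
  qed
  hence "w y = w x" for y using DERIV_isconst_all by blast
  hence W: "w y = w x" for y .
  define k where "k = w x"
  have k: "k > 0" using neg by (simp add: k_def w_def)
  \<comment> \<open>The lower bound for the rate of decrease of \<open>g\<close> beyond \<mu>, where
    \<open>f\<close> is at most \<open>f \<mu>\<close> and the weight at most 1.\<close>
  define Q where "Q = k / f \<mu>"
  have fp: "f y > 0" "g y > 0" for y using f g by (auto simp: decreasing_fundamental_solution_def)
  have Q: "Q > 0" using k fp by (simp add: Q_def)
  have gd: "deriv g y \<le> - Q" if y: "y > \<mu>" for y
  proof -
    have "deriv f y * g y \<le> 0"
      using decreasing_fundamental_solution_deriv_nonpos[OF f] fp by (simp add: mult_le_0_iff less_imp_le)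
    hence "w y \<le> (- f y * deriv g y) * exp (- \<theta> * (y - \<mu>)^2 / \<sigma>^2)"
      unfolding w_def by (intro mult_right_mono) auto
    hence "k \<le> (- f y * deriv g y) * exp (- \<theta> * (y - \<mu>)^2 / \<sigma>^2)"
      using W[of y] by (simp add: k_def)
    also have "\<dots> \<le> (- f y * deriv g y) * 1"
      using assms(3,4) fp decreasing_fundamental_solution_deriv_nonpos[OF g, of y]
      by (intro mult_left_mono) (auto simp: mult_nonneg_nonpos less_imp_le)
    also have "\<dots> \<le> f \<mu> * (- deriv g y)"
    proof -
      have "f y \<le> f \<mu>" using f y unfolding decreasing_fundamental_solution_def
        by (auto dest!: monotone_onD[where x=\<mu> and y=y])
      thus ?thesis using decreasing_fundamental_solution_deriv_nonpos[OF g, of y]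
        by (auto simp: mult_le_cancel_right intro: mult_right_mono_neg)
    qed
    finally show ?thesis using fp[of \<mu>] by (simp add: Q_def field_simps)
  qed
  \<comment> \<open>A line of slope \<open>- Q\<close> through \<open>g \<mu>\<close> at \<mu> has
    the value \<open>- Q\<close> here.\<close>
  define z where "z = \<mu> + g \<mu> / Q + 1"
  have z: "z > \<mu>" using fp Q by (simp add: z_def add_pos_pos)
  obtain \<xi> where "\<mu> < \<xi>" "\<xi> < z" "g z - g \<mu> = (z - \<mu>) * deriv g \<xi>"
    using MVT2[OF z, of g "deriv g"] C2_deriv(1)[OF C(2)] by blast
  hence "g z \<le> g \<mu> + (z - \<mu>) * (- Q)"
    using gd[of \<xi>] z by (smt (verit) mult_left_mono)
  also have "\<dots> < 0" using Q by (simp add: z_def algebra_simps)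
  finally show False using fp(2)[of z] by simp
qed

text \<open>The Wronskian vanishes by the preceding inequality applied both ways, so
  \<open>f / g\<close> is constant. Costs contain \<phi> only through such ratios, which allows a
  change from an arbitrary normalization to \<open>ou_phi\<close>.\<close>

lemma decreasing_fundamental_solution_unique:
  assumes f: "decreasing_fundamental_solution \<theta> \<mu> \<sigma> \<rho> f"
    and g: "decreasing_fundamental_solution \<theta> \<mu> \<sigma> \<rho> g"
    and "\<theta> > 0" "\<sigma> > 0"
  shows "f x / f y = g x / g y"
proof -
  have C: "C2 f" "C2 g" using f g by (auto simp: decreasing_fundamental_solution_def)
  have fp: "f y > 0" "g y > 0" for y using f g by (auto simp: decreasing_fundamental_solution_def)
  have "deriv f x * g x - f x * deriv g x = 0" for x
    using wronskian_nonpos[OF f g assms(3,4), of x] wronskian_nonpos[OF g f assms(3,4), of x]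
    by (simp add: algebra_simps)
  moreover have "((\<lambda>x. f x / g x) has_real_derivative (deriv f x * g x - f x * deriv g x) / (g x * g x)) (at x)" for x
    using fp(2)[of x] by (auto intro!: derivative_eq_intros C2_deriv C)
  ultimately have "((\<lambda>x. f x / g x) has_real_derivative 0) (at x)" for x by (metis div_0)
  hence "f x / g x = f y / g y" using DERIV_isconst_all by blast
  thus ?thesis using fp(1)[of y] fp(2)[of x] fp(2)[of y] by (simp add: field_simps)
qed

text \<open>Integrating \<open>exp (- z) \<ge> 1 - z\<close> puts the function above its tangent at
  \<mu>, so it grows at least linearly at minus infinity and controls the negative part of payoffs
  of linear growth.\<close>

lemma ou_phi_linear_lower_bound:
  assumes "\<theta> > 0" "\<sigma> > 0" "\<rho> > 0"
  obtains K where "K > 0" "\<And>y. - y \<le> K * (1 + ou_phi \<theta> \<mu> \<sigma> \<rho> y)"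
proof -
  let ?F = "ou_phi \<theta> \<mu> \<sigma> \<rho>"
  define b where "b = \<sigma>^2 / (4 * \<theta>)"
  define a where "a = \<rho> / \<theta>"
  have b: "b > 0" and a: "a > 0" using assms by (auto simp: b_def a_def)
  let ?m = "\<lambda>p. gauss_moment b p 0"
  have m: "?m (a - 1) > 0" "?m a > 0" using gauss_moment_pos[OF b] a by auto
  have F: "?F y \<ge> ?m (a - 1) - (y - \<mu>) * ?m a" for y
  proof -
    have "(LINT v:{0<..}|lborel. v powr (a - 1) * exp (- 0 * v - b * v^2) - (y - \<mu>) * (v powr a * exp (- 0 * v - b * v^2)))
       \<le> (LINT v:{0<..}|lborel. v powr (a - 1) * exp (- (y - \<mu>) * v - b * v^2))"
    proof (intro set_integral_mono set_integral_diff set_integrable_mult_right gauss_moment_integrable b)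
      fix v :: real assume "v \<in> {0<..}"
      hence v: "v > 0" by simp
      have "(v powr (a - 1) * exp (- b * v^2)) * (1 - (y - \<mu>) * v) \<le> (v powr (a - 1) * exp (- b * v^2)) * exp (- (y - \<mu>) * v)"
        using exp_ge_add_one_self[of "- (y - \<mu>) * v"]
        by (intro mult_left_mono) (auto simp: algebra_simps)
      moreover have "v powr a = v powr (a - 1) * v" using v by (simp add: powr_diff)
      ultimately show "v powr (a - 1) * exp (- 0 * v - b * v^2) - (y - \<mu>) * (v powr a * exp (- 0 * v - b * v^2))
          \<le> v powr (a - 1) * exp (- (y - \<mu>) * v - b * v^2)"
        by (simp add: exp_add[symmetric] exp_diff exp_minus field_simps)
    qed (use a in auto)
    also have "(LINT v:{0<..}|lborel. v powr (a - 1) * exp (- 0 * v - b * v^2) - (y - \<mu>) * (v powr a * exp (- 0 * v - b * v^2)))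
        = ?m (a - 1) - (y - \<mu>) * ?m a"
      unfolding gauss_moment_def using a
      by (subst set_integral_diff) (auto intro!: gauss_moment_integrable[of b _ 0, simplified] b set_integrable_mult_right)
    finally show ?thesis by (simp add: ou_phi_def gauss_moment_def a_def b_def)
  qed
  \<comment> \<open>The first term is the reciprocal of the absolute slope of the tangent; the
    second absorbs the shift by \<mu>.\<close>
  define K where "K = 1 / ?m a + \<bar>\<mu>\<bar>"
  have "- y \<le> K * (1 + ?F y)" for y
  proof -
    have Fp: "?F y > 0" using ou_phi_fundamental[OF assms] by (simp add: decreasing_fundamental_solution_def)
    have "- y * ?m a \<le> ?F y + \<bar>\<mu>\<bar> * ?m a" using F[of y] m 
      by (smt (verit) mult_right_mono mult_minus_left left_diff_distrib)
    hence "- y \<le> ?F y / ?m a + \<bar>\<mu>\<bar>" using m by (simp add: field_simps)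
    also have "\<dots> \<le> K * (1 + ?F y)" using m Fp by (simp add: K_def field_simps)
    finally show ?thesis .
  qed
  moreover have "K > 0" using m by (simp add: K_def add_pos_nonneg)
  ultimately show ?thesis using that by blast
qed

subsection \<open>Independence of Brownian increments from the augmented filtration\<close>

locale brownian_motion = prob_space P for P :: "'a measure" +
  fixes B :: "real \<Rightarrow> 'a \<Rightarrow> real"
  assumes complete: "complete_measure P"
    and brownian: "standard_brownian_motion P B"
begin

lemma B_measurable [measurable]: "t \<ge> 0 \<Longrightarrow> B t \<in> borel_measurable P"
  using brownian by (simp add: standard_brownian_motion_def)

text \<open>Completeness makes every subset of the exceptional null set measurable. Paths are
  continuous only almost surely, so pathwise limits and hitting times depend on this.\<close>

lemma measurable_AE:
  assumes "f \<in> measurable P N" "AE \<omega> in P. f \<omega> = g \<omega>" "\<And>\<omega>. \<omega> \<in> space P \<Longrightarrow> g \<omega> \<in> space N"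
  shows "g \<in> measurable P N"
proof (rule measurableI)
  fix A assume A: "A \<in> sets N"
  obtain N' where N': "N' \<in> null_sets P" "{\<omega>\<in>space P. f \<omega> \<noteq> g \<omega>} \<subseteq> N'"
    using assms(2) unfolding eventually_ae_filter by auto
  have "{\<omega>\<in>space P. f \<omega> \<noteq> g \<omega>} \<inter> g -` A \<in> sets P" "{\<omega>\<in>space P. f \<omega> \<noteq> g \<omega>} \<in> sets P"
    using complete_measure.complete[OF complete] N' by (meson inf.coboundedI1)+
  moreover have "f -` A \<inter> space P \<in> sets P" using assms(1) A by (rule measurable_sets)
  moreover have "g -` A \<inter> space P = (f -` A \<inter> space P - {\<omega>\<in>space P. f \<omega> \<noteq> g \<omega>})
      \<union> ({\<omega>\<in>space P. f \<omega> \<noteq> g \<omega>} \<inter> g -` A)" by auto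
  ultimately show "g -` A \<inter> space P \<in> sets P" by auto
qed (use assms(3) in auto)

lemma null_subset:
  assumes "AE \<omega> in P. \<omega> \<notin> A" "A \<subseteq> space P"
  shows "A \<in> null_sets P"
proof -
  obtain N' where N': "N' \<in> null_sets P" "{\<omega>\<in>space P. \<not> \<omega> \<notin> A} \<subseteq> N'"
    using assms(1) unfolding eventually_ae_filter by auto
  hence "A \<subseteq> N'" using assms(2) by auto
  thus ?thesis using complete_measure.complete2[OF complete] N' by blast
qed

text \<open>Completing the square: tilting the centred normal density by \<open>exp (w * x)\<close>
  gives a constant times the normal density with mean \<open>w * d^2\<close>. The case
  \<open>s = t\<close> is separate because the density is prescribed for \<open>s < t\<close>
  only.\<close>

lemma increment_exp_moment:
  assumes "0 \<le> s" "s \<le> t"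
  shows "(\<integral>\<^sup>+\<omega>. ennreal (exp (w * (B t \<omega> - B s \<omega>))) \<partial>P) = ennreal (exp (w^2 * (t - s) / 2))"
proof (cases "s = t")
  case True
  thus ?thesis by (simp add: emeasure_space_1)
next
  case False
  hence st: "s < t" using assms by simp
  define d where "d = sqrt (t - s)"
  have d: "d > 0" "d^2 = t - s" using st by (auto simp: d_def)
  have D: "distributed P lborel (\<lambda>\<omega>. B t \<omega> - B s \<omega>) (normal_density 0 d)"
    using brownian st assms unfolding standard_brownian_motion_def d_def by blast
  have eq: "normal_density 0 d x * exp (w * x) = exp (w^2 * (t - s) / 2) * normal_density (w * d^2) d x" for x
  proof -
    have "- (x - 0)\<^sup>2 / (2 * d\<^sup>2) + w * x = w^2 * d^2 / 2 + - (x - w * d^2)\<^sup>2 / (2 * d\<^sup>2)"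
      using d(1) by (simp add: field_simps power2_eq_square)
    hence "exp (- (x - 0)\<^sup>2 / (2 * d\<^sup>2)) * exp (w * x) = exp (w^2 * d^2 / 2) * exp (- (x - w * d^2)\<^sup>2 / (2 * d\<^sup>2))"
      by (simp only: exp_add[symmetric])
    thus ?thesis unfolding normal_density_def d(2)[symmetric] by (simp add: ac_simps)
  qed
  have "(\<integral>\<^sup>+\<omega>. ennreal (exp (w * (B t \<omega> - B s \<omega>))) \<partial>P)
      = (\<integral>\<^sup>+x. ennreal (normal_density 0 d x) * ennreal (exp (w * x)) \<partial>lborel)"
    by (rule distributed_nn_integral[OF D, symmetric]) auto
  also have "\<dots> = (\<integral>\<^sup>+x. ennreal (exp (w^2 * (t - s) / 2)) * ennreal (normal_density (w * d^2) d x) \<partial>lborel)"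
    using eq by (simp add: ennreal_mult'[symmetric])
  also have "\<dots> = ennreal (exp (w^2 * (t - s) / 2)) * (\<integral>\<^sup>+x. ennreal (normal_density (w * d^2) d x) \<partial>lborel)"
    by (rule nn_integral_cmult) auto
  also have "(\<integral>\<^sup>+x. ennreal (normal_density (w * d^2) d x) \<partial>lborel) = 1"
    using prob_space.emeasure_space_1[OF prob_space_normal_density[OF d(1), of "w * d^2"]]
    by (simp add: emeasure_density)
  finally show ?thesis by simp
qed

lemma increments_indep:
  assumes "0 \<le> ts 0" "\<And>i. i < n \<Longrightarrow> ts i \<le> ts (Suc i)"
  shows "indep_vars (\<lambda>_. borel) (\<lambda>i \<omega>. B (ts (Suc i)) \<omega> - B (ts i) \<omega>) {..<n::nat}"
  using brownian assms unfolding standard_brownian_motion_def by blast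

lemma weighted_increments_exp_moment:
  assumes "0 \<le> ts 0" "\<And>i. i < n \<Longrightarrow> ts i \<le> ts (Suc i)"
  shows "(\<integral>\<^sup>+\<omega>. ennreal (exp (\<Sum>i<n. w i * (B (ts (Suc i)) \<omega> - B (ts i) \<omega>))) \<partial>P)
         = ennreal (exp (\<Sum>i<n. (w i)^2 * (ts (Suc i) - ts i) / 2))"
proof -
  have nonneg: "0 \<le> ts i" if "i \<le> n" for i
    using that
  proof (induction i)
    case (Suc i) thus ?case using assms(2)[of i] by simp
  qed (use assms in simp)
  have ind: "indep_vars (\<lambda>_. borel) (\<lambda>i \<omega>. exp (w i * (B (ts (Suc i)) \<omega> - B (ts i) \<omega>))) {..<n}"
    by (rule indep_vars_compose2[OF increments_indep[of ts n], where Y="\<lambda>i x. exp (w i * x)"]) (use assms in auto)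
  have "(\<integral>\<^sup>+\<omega>. ennreal (exp (\<Sum>i<n. w i * (B (ts (Suc i)) \<omega> - B (ts i) \<omega>))) \<partial>P)
     = (\<integral>\<^sup>+\<omega>. (\<Prod>i<n. ennreal (exp (w i * (B (ts (Suc i)) \<omega> - B (ts i) \<omega>)))) \<partial>P)"
    by (simp add: exp_sum prod_ennreal)
  also have "\<dots> = (\<Prod>i<n. \<integral>\<^sup>+\<omega>. ennreal (exp (w i * (B (ts (Suc i)) \<omega> - B (ts i) \<omega>))) \<partial>P)"
    using indep_vars_nn_integral[OF _ indep_vars_compose2[OF ind, where Y="\<lambda>_. ennreal" and N="\<lambda>_. borel"]] by simp
  also have "\<dots> = (\<Prod>i<n. ennreal (exp ((w i)^2 * (ts (Suc i) - ts i) / 2)))"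
    by (intro prod.cong refl increment_exp_moment) (use nonneg assms in auto)
  finally show ?thesis by (simp add: exp_sum prod_ennreal)
qed

text \<open>Independence is available only for increments along one ordered grid. So the times in
  \<open>J\<close> are sorted and followed by the grid \<open>ts\<close>; each \<open>B j\<close>
  becomes a partial sum of increments from time 0, the event depends on the first \<open>n\<close>
  increments, and \<open>S\<close> depends on the remaining \<open>k\<close>.\<close>

lemma weighted_increments_indep_cylinder:
  fixes w ts :: "nat \<Rightarrow> real"
  assumes s: "0 \<le> s" "ts 0 = s" "\<And>i. i < k \<Longrightarrow> ts i \<le> ts (Suc i)"
    and J: "finite J" "J \<subseteq> {0..s}" and C: "C \<in> sets (PiM J (\<lambda>_. borel))"
    and A: "A \<in> sets P" "AE \<omega> in P. \<omega> \<in> A \<longleftrightarrow> (\<lambda>j\<in>J. B j \<omega>) \<in> C"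
  defines "S \<equiv> \<lambda>\<omega>. \<Sum>i<k. w i * (B (ts (Suc i)) \<omega> - B (ts i) \<omega>)"
  shows "(\<integral>\<^sup>+\<omega>. ennreal (exp (S \<omega>)) * indicator A \<omega> \<partial>P) = (\<integral>\<^sup>+\<omega>. ennreal (exp (S \<omega>)) \<partial>P) * emeasure P A"
proof -
  \<comment> \<open>\<open>0\<close> is inserted because the partial sums must start where
    \<open>B\<close> vanishes, and \<open>s\<close> so that the past grid ends where
    \<open>ts\<close> begins.\<close>
  define xs where "xs = sorted_list_of_set (insert 0 (insert s J))"
  define n where "n = length xs - 1"
  have set_xs: "set xs = insert 0 (insert s J)" and srt: "sorted xs" and dist: "distinct xs"
    unfolding xs_def using J by (simp_all del: sorted_list_of_set_insert_remove)
  have ne: "xs \<noteq> []" using set_xs by auto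
  hence len: "length xs = Suc n" by (simp add: n_def)
  have xs0: "xs ! 0 = 0"
  proof -
    have "0 \<in> set xs" unfolding set_xs by simp
    then obtain i where "i < length xs" "xs ! i = 0" unfolding in_set_conv_nth by blast
    moreover have "xs ! 0 \<in> insert 0 (insert s J)" using nth_mem[of 0 xs] ne unfolding set_xs by simp
    hence "xs ! 0 \<ge> 0" using J(2) s(1) by auto
    moreover have "xs ! 0 \<le> xs ! i" using \<open>i < length xs\<close> by (intro sorted_nth_mono[OF srt]) auto
    ultimately show ?thesis by simp
  qed
  have xsn: "xs ! n = s"
  proof -
    have "s \<in> set xs" unfolding set_xs by simp
    then obtain i where i: "i < length xs" "xs ! i = s" unfolding in_set_conv_nth by blast
    moreover have "xs ! n \<in> insert 0 (insert s J)" using nth_mem[of n xs] len unfolding set_xs by simp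
    hence "xs ! n \<le> s" using J(2) s(1) by auto
    moreover have "xs ! i \<le> xs ! n" using i len by (intro sorted_nth_mono[OF srt]) auto
    ultimately show ?thesis by simp
  qed
  \<comment> \<open>At index \<open>n\<close> both grids have the value \<open>s\<close>, so the
    increments of \<open>xs\<close> are followed directly by those of \<open>ts\<close>.\<close>
  define u where "u i = (if i < n then xs ! i else ts (i - n))" for i
  have un: "u i = xs ! i" if "i \<le> n" for i using that xsn s(2) by (cases "i = n") (auto simp: u_def)
  have u0: "u 0 = 0" using un[of 0] xs0 by simp
  have umono: "u i \<le> u (Suc i)" if "i < n + k" for i
  proof (cases "i < n")
    case True
    thus ?thesis using un[of i] un[of "Suc i"] sorted_nth_mono[OF srt, of i "Suc i"] len by simp
  next
    case False
    thus ?thesis using s(3)[of "i - n"] that by (simp add: u_def Suc_diff_le)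
  qed
  define D where "D i \<omega> = B (u (Suc i)) \<omega> - B (u i) \<omega>" for i \<omega>
  have ind: "indep_vars (\<lambda>_. borel) D {..<n + k}"
    unfolding D_def by (rule increments_indep) (use u0 umono in auto)
  have "\<forall>j\<in>J. \<exists>m\<le>n. u m = j"
  proof
    fix j assume "j \<in> J"
    hence "j \<in> set xs" using set_xs by simp
    then obtain m where "m < length xs" "xs ! m = j" by (metis in_set_conv_nth)
    thus "\<exists>m\<le>n. u m = j" using un len by (intro exI[of _ m]) auto
  qed
  then obtain m where m: "\<And>j. j \<in> J \<Longrightarrow> m j \<le> n \<and> u (m j) = j" by metis
  \<comment> \<open>\<open>g\<close> rebuilds the values at the times in \<open>J\<close> from the
    past increments, and \<open>h\<close> is the weighted sum of the future ones. Since
    \<open>B 0 = 0\<close> holds only almost surely, so does the agreement of \<open>g\<close> with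
    the path.\<close>
  define g where "g = (\<lambda>v. \<lambda>j\<in>J. \<Sum>i<m j. (v i :: real))"
  define h where "h = (\<lambda>v. \<Sum>i<k. w i * v (n + i) :: real)"
  have g_meas: "g \<in> measurable (PiM {..<n} (\<lambda>_. borel)) (PiM J (\<lambda>_. borel))"
    unfolding g_def
  proof (rule measurable_restrict)
    fix j assume "j \<in> J"
    thus "(\<lambda>v. \<Sum>i<m j. v i :: real) \<in> borel_measurable (PiM {..<n} (\<lambda>_. borel))"
      using m by (intro borel_measurable_sum measurable_component_singleton) force
  qed
  have h_meas: "h \<in> borel_measurable (PiM {n..<n+k} (\<lambda>_. borel))"
    unfolding h_def by (intro borel_measurable_sum borel_measurable_times measurable_component_singleton) auto
  let ?X = "\<lambda>\<omega>. restrict (\<lambda>i. D i \<omega>) {..<n}" and ?Y = "\<lambda>\<omega>. restrict (\<lambda>i. D i \<omega>) {n..<n+k}"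
  have "indep_var borel ((\<lambda>v. indicator C (g v) :: ennreal) \<circ> ?X) borel ((\<lambda>v. ennreal (exp (h v))) \<circ> ?Y)"
  proof (rule indep_var_compose[OF indep_var_restrict[OF ind]])
    show "(\<lambda>v. indicator C (g v)) \<in> borel_measurable (PiM {..<n} (\<lambda>_. borel))"
      using measurable_compose[OF g_meas borel_measurable_indicator[OF C]] .
    show "(\<lambda>v. ennreal (exp (h v))) \<in> borel_measurable (PiM {n..<n+k} (\<lambda>_. borel))"
      using h_meas by measurable
  qed auto
  hence ind2: "indep_var borel (\<lambda>\<omega>. indicator C (g (?X \<omega>)) :: ennreal) borel (\<lambda>\<omega>. ennreal (exp (h (?Y \<omega>))))"
    by (simp add: o_def)
  have prodeq: "(\<integral>\<^sup>+\<omega>. indicator C (g (?X \<omega>)) * ennreal (exp (h (?Y \<omega>))) \<partial>P)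
      = (\<integral>\<^sup>+\<omega>. indicator C (g (?X \<omega>)) \<partial>P) * (\<integral>\<^sup>+\<omega>. ennreal (exp (h (?Y \<omega>))) \<partial>P)"
  proof -
    have "indep_vars (\<lambda>_. borel) (case_bool (\<lambda>\<omega>. indicator C (g (?X \<omega>)) :: ennreal) (\<lambda>\<omega>. ennreal (exp (h (?Y \<omega>))))) UNIV"
      using ind2 unfolding indep_var_def by (rule indep_vars_cong[THEN iffD1, rotated -1]) (auto split: bool.split)
    from indep_vars_nn_integral[OF _ this] show ?thesis by (simp add: UNIV_bool mult.commute)
  qed
  have hS: "h (?Y \<omega>) = S \<omega>" for \<omega>
    unfolding h_def S_def D_def by (intro sum.cong) (auto simp: u_def Suc_diff_le s(2))
  have gB: "AE \<omega> in P. g (?X \<omega>) = (\<lambda>j\<in>J. B j \<omega>)"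
  proof -
    have "AE \<omega> in P. B 0 \<omega> = 0" using brownian by (simp add: standard_brownian_motion_def)
    thus ?thesis
    proof eventually_elim
      case (elim \<omega>)
      have "(\<Sum>i<m j. ?X \<omega> i) = B j \<omega>" if "j \<in> J" for j
      proof -
        have "(\<Sum>i<m j. ?X \<omega> i) = (\<Sum>i<m j. B (u (Suc i)) \<omega> - B (u i) \<omega>)"
          using m[OF that] by (intro sum.cong) (auto simp: D_def)
        also have "\<dots> = B (u (m j)) \<omega> - B (u 0) \<omega>"
          by (rule sum_lessThan_telescope)
        finally show ?thesis using m[OF that] u0 elim by simp
      qed
      thus ?case unfolding g_def by (intro restrict_ext) auto
    qed
  qed
  hence AE: "AE \<omega> in P. indicator C (g (?X \<omega>)) = (indicator A \<omega> :: ennreal)"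
    using A(2) by eventually_elim (auto simp: indicator_def)
  have "(\<integral>\<^sup>+\<omega>. ennreal (exp (S \<omega>)) * indicator A \<omega> \<partial>P) = (\<integral>\<^sup>+\<omega>. indicator C (g (?X \<omega>)) * ennreal (exp (h (?Y \<omega>))) \<partial>P)"
    unfolding hS by (intro nn_integral_cong_AE) (use AE in \<open>eventually_elim, auto simp: mult.commute\<close>)
  also have "\<dots> = (\<integral>\<^sup>+\<omega>. indicator C (g (?X \<omega>)) \<partial>P) * (\<integral>\<^sup>+\<omega>. ennreal (exp (S \<omega>)) \<partial>P)"
    using prodeq unfolding hS .
  also have "(\<integral>\<^sup>+\<omega>. indicator C (g (?X \<omega>)) \<partial>P) = (\<integral>\<^sup>+\<omega>. indicator A \<omega> \<partial>P)"
    by (rule nn_integral_cong_AE[OF AE])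
  finally show ?thesis using A(1) by (simp add: mult.commute)
qed

text \<open>Allowing almost sure equality with a cylinder set makes this a \<open>\<pi>\<close>-system that contains the
  null sets and hence generates the augmented filtration.\<close>

definition past_cylinders :: "real \<Rightarrow> 'a set set" where
  "past_cylinders s = {A \<in> sets P. \<exists>J C. finite J \<and> J \<subseteq> {0..s} \<and> C \<in> sets (PiM J (\<lambda>_. borel)) \<and>
     (AE \<omega> in P. \<omega> \<in> A \<longleftrightarrow> (\<lambda>j\<in>J. B j \<omega>) \<in> C)}"

lemma Int_stable_past_cylinders: "Int_stable (past_cylinders s)"
proof (rule Int_stableI)
  fix a b assume "a \<in> past_cylinders s" "b \<in> past_cylinders s"
  then obtain J C J' C' where a: "a \<in> sets P" "finite J" "J \<subseteq> {0..s}" "C \<in> sets (PiM J (\<lambda>_. borel))"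
      "AE \<omega> in P. \<omega> \<in> a \<longleftrightarrow> (\<lambda>j\<in>J. B j \<omega>) \<in> C"
    and b: "b \<in> sets P" "finite J'" "J' \<subseteq> {0..s}" "C' \<in> sets (PiM J' (\<lambda>_. borel))"
      "AE \<omega> in P. \<omega> \<in> b \<longleftrightarrow> (\<lambda>j\<in>J'. B j \<omega>) \<in> C'"
    unfolding past_cylinders_def by blast
  let ?M = "PiM (J \<union> J') (\<lambda>_. borel :: real measure)"
  define D where "D = ((\<lambda>v. restrict v J) -` C \<inter> space ?M) \<inter> ((\<lambda>v. restrict v J') -` C' \<inter> space ?M)"
  have "D \<in> sets ?M" unfolding D_def
    by (intro sets.Int measurable_sets[OF measurable_restrict_subset a(4)] measurable_sets[OF measurable_restrict_subset b(4)]) auto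
  moreover have "AE \<omega> in P. \<omega> \<in> a \<inter> b \<longleftrightarrow> (\<lambda>j\<in>J \<union> J'. B j \<omega>) \<in> D"
    using a(5) b(5)
  proof eventually_elim
    case (elim \<omega>)
    have "restrict (\<lambda>j\<in>J \<union> J'. B j \<omega>) J = (\<lambda>j\<in>J. B j \<omega>)" "restrict (\<lambda>j\<in>J \<union> J'. B j \<omega>) J' = (\<lambda>j\<in>J'. B j \<omega>)"
      by (auto simp: restrict_def fun_eq_iff)
    thus ?case using elim by (simp add: D_def space_PiM)
  qed
  ultimately show "a \<inter> b \<in> past_cylinders s" unfolding past_cylinders_def
    using a(1-3) b(1-3) by (intro CollectI conjI exI[of _ "J \<union> J'"] exI[of _ D]) auto
qed

lemma past_cylinders_subset: "past_cylinders s \<subseteq> Pow (space P)"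
  unfolding past_cylinders_def using sets.sets_into_space by blast

section \<open>The augmented filtration and its independence from the future increments\<close>

lemma sets_brownian_filtration:
  "sets (brownian_filtration P B t) = sigma_sets (space P)
     ({B s -` A \<inter> space P | s A. 0 \<le> s \<and> ennreal s \<le> t \<and> A \<in> sets borel} \<union> null_sets P)"
  unfolding brownian_filtration_def by (rule sets_measure_of) (auto simp: null_sets_def dest: sets.sets_into_space)

lemma space_brownian_filtration [simp]: "space (brownian_filtration P B t) = space P"
  unfolding brownian_filtration_def by (rule space_measure_of) (auto simp: null_sets_def dest: sets.sets_into_space)

lemma null_sets_filtration: "A \<in> null_sets P \<Longrightarrow> A \<in> sets (brownian_filtration P B t)"
  unfolding sets_brownian_filtration by auto

lemma subalgebra_filtration: "subalgebra P (brownian_filtration P B t)"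
  unfolding subalgebra_def sets_brownian_filtration
proof (intro conjI sets.sigma_sets_subset subsetI)
  fix A assume "A \<in> {B s -` A \<inter> space P |s A. 0 \<le> s \<and> ennreal s \<le> t \<and> A \<in> sets borel} \<union> null_sets P"
  thus "A \<in> sets P" by (auto intro: measurable_sets[OF B_measurable])
qed simp

lemma filtration_mono: "s \<le> t \<Longrightarrow> sets (brownian_filtration P B s) \<subseteq> sets (brownian_filtration P B t)"
  unfolding sets_brownian_filtration by (intro sigma_sets_mono') (auto intro: order_trans)

lemma filtration_measurable_mono:
  "f \<in> measurable (brownian_filtration P B s) N \<Longrightarrow> s \<le> t \<Longrightarrow> f \<in> measurable (brownian_filtration P B t) N"
  using filtration_mono[of s t] by (auto simp: measurable_def)

text \<open>A null set agrees almost surely with the empty cylinder over no times at all; the other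
  generators are one-dimensional cylinders.\<close>

lemma filtration_subset_past_cylinders:
  assumes "s \<ge> 0"
  shows "sets (brownian_filtration P B (ennreal s)) \<subseteq> sigma_sets (space P) (past_cylinders s)"
  unfolding sets_brownian_filtration
proof (rule sigma_sets_mono', rule subsetI)
  fix A assume "A \<in> {B r -` A \<inter> space P |r A. 0 \<le> r \<and> ennreal r \<le> ennreal s \<and> A \<in> sets borel} \<union> null_sets P"
  thus "A \<in> past_cylinders s"
  proof
    assume "A \<in> null_sets P"
    thus ?thesis unfolding past_cylinders_def
      by (intro CollectI conjI exI[of _ "{}"]) (auto dest: AE_not_in)
  next
    assume "A \<in> {B r -` A \<inter> space P |r A. 0 \<le> r \<and> ennreal r \<le> ennreal s \<and> A \<in> sets borel}"
    then obtain r A' where A: "A = B r -` A' \<inter> space P" "0 \<le> r" "r \<le> s" "A' \<in> sets borel"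
      using assms by (auto simp: ennreal_le_iff)
    let ?M = "PiM {r} (\<lambda>_. borel :: real measure)"
    have "(\<lambda>v. v r) -` A' \<inter> space ?M \<in> sets ?M"
      by (rule measurable_sets[OF _ A(4)]) (auto intro: measurable_component_singleton)
    moreover have "A \<in> sets P" unfolding A(1) by (rule measurable_sets[OF B_measurable]) (use A in auto)
    ultimately show ?thesis unfolding past_cylinders_def using A
      by (intro CollectI conjI exI[of _ "{r}"] exI[of _ "(\<lambda>v. v r) -` A' \<inter> space ?M"])
         (auto simp: space_PiM)
  qed
qed

text \<open>Independence as an equality of measures: those with densities
  \<open>exp (S \<omega>)\<close> and \<open>c\<close> agree on the past cylinders, hence on the
  generated sigma-algebra, and \<open>f\<close> is measurable with respect to it.\<close>

lemma weighted_increments_indep: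
  fixes w ts :: "nat \<Rightarrow> real"
  assumes s: "0 \<le> s" "ts 0 = s" "\<And>i. i < k \<Longrightarrow> ts i \<le> ts (Suc i)"
    and f: "f \<in> borel_measurable (brownian_filtration P B (ennreal s))"
  defines "S \<equiv> \<lambda>\<omega>. \<Sum>i<k. w i * (B (ts (Suc i)) \<omega> - B (ts i) \<omega>)"
  shows "(\<integral>\<^sup>+\<omega>. ennreal (exp (S \<omega>)) * f \<omega> \<partial>P)
    = ennreal (exp (\<Sum>i<k. (w i)^2 * (ts (Suc i) - ts i) / 2)) * (\<integral>\<^sup>+\<omega>. f \<omega> \<partial>P)"
proof -
  define c where "c = exp (\<Sum>i<k. (w i)^2 * (ts (Suc i) - ts i) / 2)"
  have c: "(\<integral>\<^sup>+\<omega>. ennreal (exp (S \<omega>)) \<partial>P) = ennreal c"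
    unfolding S_def c_def by (rule weighted_increments_exp_moment) (use s in auto)
  have tsnn: "0 \<le> ts i" if "i \<le> k" for i
    using that
  proof (induction i)
    case (Suc i) thus ?case using s(3)[of i] by simp
  qed (use s in simp)
  have S_meas [measurable]: "S \<in> borel_measurable P"
    unfolding S_def by (intro borel_measurable_sum borel_measurable_times borel_measurable_diff B_measurable tsnn) auto
  define G where "G = sigma (space P) (past_cylinders s)"
  have setsG: "sets G = sigma_sets (space P) (past_cylinders s)" and spaceG: "space G = space P"
    unfolding G_def using past_cylinders_subset by (auto intro: sets_measure_of space_measure_of)
  have sub: "subalgebra P G" unfolding subalgebra_def setsG spaceG
    by (intro conjI sets.sigma_sets_subset) (auto simp: past_cylinders_def)
  let ?M1 = "density P (\<lambda>\<omega>. ennreal (exp (S \<omega>)))" and ?M2 = "density P (\<lambda>_. ennreal c)"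
  have sub12: "subalgebra ?M1 G" "subalgebra ?M2 G" using sub by (auto simp: subalgebra_def)
  have eq: "restr_to_subalg ?M1 G = restr_to_subalg ?M2 G"
  proof (rule measure_eqI_generator_eq[OF Int_stable_past_cylinders past_cylinders_subset])
    fix A assume A: "A \<in> past_cylinders s"
    hence AG: "A \<in> sets G" by (auto simp: setsG)
    have AP: "A \<in> sets P" using A by (simp add: past_cylinders_def)
    obtain J C where J: "finite J" "J \<subseteq> {0..s}" "C \<in> sets (PiM J (\<lambda>_. borel))"
      "AE \<omega> in P. \<omega> \<in> A \<longleftrightarrow> (\<lambda>j\<in>J. B j \<omega>) \<in> C" using A by (auto simp: past_cylinders_def)
    have "(\<integral>\<^sup>+\<omega>. ennreal (exp (S \<omega>)) * indicator A \<omega> \<partial>P) = ennreal c * emeasure P A"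
      unfolding c[symmetric] unfolding S_def
      by (rule weighted_increments_indep_cylinder[OF s J(1-3) AP J(4)])
    thus "emeasure (restr_to_subalg ?M1 G) A = emeasure (restr_to_subalg ?M2 G) A"
      unfolding emeasure_restr_to_subalg[OF sub12(1) AG] emeasure_restr_to_subalg[OF sub12(2) AG]
      using AP by (simp add: emeasure_density nn_integral_cmult_indicator)
  next
    show "sets (restr_to_subalg ?M1 G) = sigma_sets (space P) (past_cylinders s)"
         "sets (restr_to_subalg ?M2 G) = sigma_sets (space P) (past_cylinders s)"
      by (simp_all add: sets_restr_to_subalg[OF sub12(1)] sets_restr_to_subalg[OF sub12(2)] setsG)
    \<comment> \<open>Uniqueness of measures requires a cover by generators of finite mass; the
      whole space, as a cylinder over the empty set of times, is one.\<close>
    have "AE \<omega> in P. \<omega> \<in> space P \<longleftrightarrow> (\<lambda>j\<in>{}. B j \<omega>) \<in> space (PiM {} (\<lambda>_. borel :: real measure))"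
      by (intro AE_I2) (simp add: space_PiM restrict_def)
    hence sp: "space P \<in> past_cylinders s" unfolding past_cylinders_def
      by (intro CollectI conjI exI[of _ "{}"] exI[of _ "space (PiM {} (\<lambda>_. borel))"]) auto
    thus "range (\<lambda>_::nat. space P) \<subseteq> past_cylinders s" by auto
    show "(\<Union>i::nat. space P) = space P" by simp
    fix i :: nat
    have "space P \<in> sets G" using sp by (auto simp: setsG)
    thus "emeasure (restr_to_subalg ?M1 G) (space P) \<noteq> \<infinity>"
      using c by (subst emeasure_restr_to_subalg[OF sub12(1)])
        (auto simp: emeasure_density indicator_def cong: nn_integral_cong_simp)
  qed
  have fG: "f \<in> borel_measurable G"
    using f filtration_subset_past_cylinders[OF s(1)] by (auto simp: measurable_def setsG spaceG)
  have fP: "f \<in> borel_measurable P" using measurable_from_subalg[OF sub fG] .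
  have "(\<integral>\<^sup>+\<omega>. f \<omega> \<partial>?M1) = (\<integral>\<^sup>+\<omega>. f \<omega> \<partial>?M2)"
    using nn_integral_subalgebra2[OF sub12(1) fG] nn_integral_subalgebra2[OF sub12(2) fG] eq by simp
  thus ?thesis using fP by (simp add: nn_integral_density nn_integral_cmult c_def)
qed

end

subsection \<open>Exponential martingales of the Ornstein-Uhlenbeck process\<close>

text \<open>Pathwise integration by parts for \<open>dz = - \<theta> z dt + \<sigma> db\<close> with
  \<open>z = y - \<mu>\<close>. The weight \<open>exp (\<theta> t)\<close> is smooth, so
  left-endpoint sums converge along every path, even if the driver has unbounded variation.\<close>

lemma linear_sde_increment_sums:
  fixes y b :: "real \<Rightarrow> real"
  assumes cont: "continuous_on {0..} y"
    and eq: "\<And>t. t \<ge> 0 \<Longrightarrow> y t = x + (LINT s:{0..t}|lborel. \<theta> * (\<mu> - y s)) + \<sigma> * b t"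
    and st: "0 \<le> s" "s < t"
  defines "r \<equiv> \<lambda>n i. s + real i * ((t - s) / real (Suc n))"
  shows "(\<lambda>n. \<Sum>i<Suc n. \<sigma> * exp (\<theta> * r n i) * (b (r n (Suc i)) - b (r n i)))
     \<longlonglongrightarrow> exp (\<theta> * t) * (y t - \<mu>) - exp (\<theta> * s) * (y s - \<mu>)"
proof (rule LIMSEQ_I)
  define z where "z v = y v - \<mu>" for v
  define E where "E v = exp (\<theta> * v)" for v
  have z_cont: "continuous_on {0..} z" unfolding z_def by (intro continuous_intros cont)
  have z_cont': "continuous_on {a..c} z" if "0 \<le> a" for a c
    using that by (intro continuous_on_subset[OF z_cont]) auto
  have b_incr: "\<sigma> * (b c - b a) = z c - z a + \<theta> * integral {a..c} z" if "0 \<le> a" "a \<le> c" for a c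
  proof -
    have int: "(LINT s:{0..v}|lborel. \<theta> * (\<mu> - y s)) = - \<theta> * integral {0..v} z" for v
    proof -
      have "set_integrable lborel {0..v} z"
        by (rule borel_integrable_atLeastAtMost') (intro z_cont', simp)
      hence "(LINT s:{0..v}|lborel. - \<theta> * z s) = - \<theta> * integral {0..v} z"
        by (subst set_integral_mult_right) (simp add: set_borel_integral_eq_integral)
      thus ?thesis by (simp add: z_def algebra_simps)
    qed
    have "integral {0..a} z + integral {a..c} z = integral {0..c} z"
      using that by (intro Henstock_Kurzweil_Integration.integral_combine integrable_continuous_real z_cont') auto
    hence "\<theta> * integral {0..c} z - \<theta> * integral {0..a} z = \<theta> * integral {a..c} z"
      by (metis add_diff_cancel_left' distrib_left)
    thus ?thesis using eq[of a] eq[of c] that unfolding int by (simp add: z_def algebra_simps)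
  qed
  fix e :: real assume e: "e > 0"
  \<comment> \<open>The errors of the cells add up to
    \<open>\<bar>\<theta>\<bar> * \<epsilon> * (t - s)\<close>, which this choice puts below
    \<open>e\<close>. The \<open>+ 1\<close> keeps the denominator positive when \<theta> is
    zero.\<close>
  define \<epsilon> where "\<epsilon> = e / (2 * (\<bar>\<theta>\<bar> + 1) * (t - s))"
  have \<epsilon>: "\<epsilon> > 0" using e st by (auto simp: \<epsilon>_def)
  have "continuous_on ({s..t} \<times> {s..t}) (\<lambda>p. E (fst p) * z (snd p))"
    unfolding E_def using st
    by (intro continuous_intros continuous_on_compose2[OF z_cont'[of s t]]) auto
  hence "uniformly_continuous_on ({s..t} \<times> {s..t}) (\<lambda>p. E (fst p) * z (snd p))"
    by (intro compact_uniformly_continuous compact_Times) auto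
  then obtain d where d: "d > 0" "\<And>p p'. p \<in> {s..t} \<times> {s..t} \<Longrightarrow> p' \<in> {s..t} \<times> {s..t} \<Longrightarrow> dist p' p < d
      \<Longrightarrow> dist (E (fst p') * z (snd p')) (E (fst p) * z (snd p)) < \<epsilon>"
    using \<epsilon> unfolding uniformly_continuous_on_def by metis
  obtain N :: nat where N: "(t - s) / d < real N" using reals_Archimedean2 by blast
  show "\<exists>N. \<forall>n\<ge>N. norm ((\<Sum>i<Suc n. \<sigma> * exp (\<theta> * r n i) * (b (r n (Suc i)) - b (r n i)))
     - (exp (\<theta> * t) * (y t - \<mu>) - exp (\<theta> * s) * (y s - \<mu>))) < e"
  proof (intro exI[of _ N] allI impI)
    fix n assume n: "n \<ge> N"
    define \<delta> where "\<delta> = (t - s) / real (Suc n)"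
    have \<delta>: "\<delta> > 0" using st by (simp add: \<delta>_def)
    have "(t - s) / d < real (Suc n)" using N n by linarith
    hence \<delta>d: "\<delta> < d" using d(1) by (simp add: \<delta>_def field_simps)
    have r_Suc: "r n (Suc i) = r n i + \<delta>" for i
      unfolding r_def \<delta>_def[symmetric] by (simp add: distrib_right)
    have r_bounds: "s \<le> r n i" "r n i \<le> t" if "i \<le> Suc n" for i
    proof -
      have "real i * \<delta> \<le> real (Suc n) * \<delta>" using that \<delta> by (intro mult_right_mono) auto
      also have "\<dots> = t - s" by (simp add: \<delta>_def)
      finally show "r n i \<le> t" by (simp add: r_def \<delta>_def)
      show "s \<le> r n i" using st by (simp add: r_def)
    qed
    have r0: "r n 0 = s" and rn: "r n (Suc n) = t" by (simp_all add: r_def)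
    have cell: "\<bar>\<sigma> * exp (\<theta> * r n i) * (b (r n (Suc i)) - b (r n i))
        - (E (r n (Suc i)) * z (r n (Suc i)) - E (r n i) * z (r n i))\<bar> \<le> \<bar>\<theta>\<bar> * \<epsilon> * \<delta>" if i: "i < Suc n" for i
    proof -
      define a c where "a = r n i" and "c = r n (Suc i)"
      have ac: "s \<le> a" "a \<le> c" "c \<le> t" "c = a + \<delta>"
        using r_bounds[of i] r_bounds[of "Suc i"] i r_Suc[of i] \<delta> by (auto simp: a_def c_def)
      have a0: "0 \<le> a" using ac st by simp
      have "((\<lambda>q. \<theta> * E q) has_integral (E c - E a)) {a..c}" unfolding E_def
        by (rule fundamental_theorem_of_calculus)
           (use ac in \<open>auto intro!: derivative_eq_intros simp: has_real_derivative_iff_has_vector_derivative[symmetric]\<close>)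
      note I1 = has_integral_mult_left[OF this, of "z c"]
      have "(z has_integral (integral {a..c} z)) {a..c}"
        by (intro integrable_integral integrable_continuous_real z_cont' a0)
      note I2 = has_integral_mult_right[OF this, of "\<theta> * E a"]
      \<comment> \<open>The error of one cell as a single integral. Its integrand compares
        \<open>E * z\<close> at the points \<open>(a, q)\<close> and \<open>(q, c)\<close>, whose
        distance is at most \<open>(q - a) + (c - q) = \<delta>\<close>, so uniform continuity makes
        it small.\<close>
      have I: "((\<lambda>q. \<theta> * (E a * z q - E q * z c)) has_integral
          (\<theta> * E a * integral {a..c} z - (E c - E a) * z c)) {a..c}"
        using has_integral_diff[OF I2 I1] by (simp add: algebra_simps)
      have "norm (\<theta> * E a * integral {a..c} z - (E c - E a) * z c) \<le> \<bar>\<theta>\<bar> * \<epsilon> * (c - a)"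
        unfolding integral_unique[OF I, symmetric]
      proof (rule integral_bound)
        show "continuous_on {a..c} (\<lambda>q. \<theta> * (E a * z q - E q * z c))"
          unfolding E_def by (intro continuous_intros z_cont' a0)
        fix q assume q: "q \<in> {a..c}"
        have "dist (a, q) (q, c) \<le> \<bar>a - q\<bar> + \<bar>q - c\<bar>"
          by (simp add: dist_prod_def dist_real_def sqrt_sum_squares_le_sum_abs)
        also have "\<dots> < d" using q ac \<delta>d by auto
        finally have "\<bar>E a * z q - E q * z c\<bar> < \<epsilon>"
          using d(2)[of "(q, c)" "(a, q)"] q ac by (auto simp: dist_real_def)
        thus "norm (\<theta> * (E a * z q - E q * z c)) \<le> \<bar>\<theta>\<bar> * \<epsilon>"
          by (simp add: abs_mult mult_left_mono)
      qed (use ac in simp)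
      moreover have "\<sigma> * E a * (b c - b a) = E a * (z c - z a) + \<theta> * E a * integral {a..c} z"
        using b_incr[OF a0 ac(2)] by (metis (no_types, opaque_lifting) distrib_left mult.assoc mult.left_commute)
      ultimately show ?thesis using ac
        unfolding a_def[symmetric] c_def[symmetric] E_def[symmetric] by (simp add: algebra_simps)
    qed
    have "(\<Sum>i<Suc n. E (r n (Suc i)) * z (r n (Suc i)) - E (r n i) * z (r n i)) = E t * z t - E s * z s"
      unfolding sum_lessThan_telescope[of "\<lambda>i. E (r n i) * z (r n i)" "Suc n"] r0 rn ..
    hence "(\<Sum>i<Suc n. \<sigma> * exp (\<theta> * r n i) * (b (r n (Suc i)) - b (r n i)))
     - (exp (\<theta> * t) * (y t - \<mu>) - exp (\<theta> * s) * (y s - \<mu>)) =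
       (\<Sum>i<Suc n. \<sigma> * exp (\<theta> * r n i) * (b (r n (Suc i)) - b (r n i))
        - (E (r n (Suc i)) * z (r n (Suc i)) - E (r n i) * z (r n i)))"
      unfolding sum_subtractf by (simp add: E_def z_def)
    also have "norm \<dots> \<le> (\<Sum>i<Suc n. \<bar>\<theta>\<bar> * \<epsilon> * \<delta>)"
      by (rule sum_norm_le) (use cell in auto)
    also have "\<dots> = \<bar>\<theta>\<bar> * \<epsilon> * (t - s)" by (simp add: \<delta>_def)
    also have "\<dots> < e"
    proof -
      have "\<epsilon> * (t - s) = e / (2 * (\<bar>\<theta>\<bar> + 1))"
        using st unfolding \<epsilon>_def by (simp del: distrib_left_numeral)
      hence "\<bar>\<theta>\<bar> * \<epsilon> * (t - s) = e * (\<bar>\<theta>\<bar> / (2 * (\<bar>\<theta>\<bar> + 1)))"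
        by (simp only: mult.assoc) simp
      also have "\<dots> < e * 1" using e by (intro mult_strict_left_mono) (auto simp: field_simps)
      finally show ?thesis by simp
    qed
    finally show "norm ((\<Sum>i<Suc n. \<sigma> * exp (\<theta> * r n i) * (b (r n (Suc i)) - b (r n i)))
     - (exp (\<theta> * t) * (y t - \<mu>) - exp (\<theta> * s) * (y s - \<mu>))) < e" .
  qed
qed

text \<open>The constant path \<open>1/\<theta>\<close> solves the equation driven by \<open>b t = t\<close>.\<close>

lemma exp_Riemann_sums:
  fixes \<theta> s t :: real
  assumes st: "0 \<le> s" "s < t" and \<theta>: "\<theta> > 0"
  defines "r \<equiv> \<lambda>n i. s + real i * ((t - s) / real (Suc n))"
  shows "(\<lambda>n. \<Sum>i<Suc n. exp (\<theta> * r n i) * (r n (Suc i) - r n i)) \<longlonglongrightarrow> (exp (\<theta> * t) - exp (\<theta> * s)) / \<theta>"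
proof -
  have "(1::real) / \<theta> = 1 / \<theta> + (LINT s:{0..v}|lborel. \<theta> * (0 - 1 / \<theta>)) + 1 * v" if "v \<ge> 0" for v
    using \<theta> that by (simp add: set_lebesgue_integral_def)
  hence "(\<lambda>n. \<Sum>i<Suc n. 1 * exp (\<theta> * r n i) * (r n (Suc i) - r n i))
      \<longlonglongrightarrow> exp (\<theta> * t) * (1 / \<theta> - 0) - exp (\<theta> * s) * (1 / \<theta> - 0)"
    unfolding r_def by (intro linear_sde_increment_sums[where b = "\<lambda>v. v" and x = "1 / \<theta>" and y = "\<lambda>_. 1 / \<theta>"] st) auto
  thus ?thesis by (simp add: diff_divide_distrib)
qed

text \<open>A second-moment bound implies uniform integrability: as
  \<open>f \<le> min f K + f^2 / K\<close>, truncation at \<open>K\<close> costs at most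
  \<open>C / K\<close>, and the truncated integrals converge by domination. Fatou gives the other
  inequality.\<close>

lemma (in prob_space) nn_integral_limit_L2_bounded:
  fixes f :: "nat \<Rightarrow> 'a \<Rightarrow> real"
  assumes meas: "\<And>n. f n \<in> borel_measurable M" "g \<in> borel_measurable M"
    and nonneg: "\<And>n \<omega>. f n \<omega> \<ge> 0"
    and lim: "AE \<omega> in M. (\<lambda>n. f n \<omega>) \<longlonglongrightarrow> g \<omega>"
    and L2: "\<And>n. (\<integral>\<^sup>+\<omega>. ennreal ((f n \<omega>)^2) \<partial>M) \<le> ennreal C"
    and c: "(\<lambda>n. \<integral>\<^sup>+\<omega>. ennreal (f n \<omega>) \<partial>M) \<longlonglongrightarrow> c"
  shows "(\<integral>\<^sup>+\<omega>. ennreal (g \<omega>) \<partial>M) = c"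
proof (rule antisym)
  note [measurable] = meas
  have "(\<integral>\<^sup>+\<omega>. ennreal (g \<omega>) \<partial>M) = (\<integral>\<^sup>+\<omega>. liminf (\<lambda>n. ennreal (f n \<omega>)) \<partial>M)"
    using lim by (intro nn_integral_cong_AE, eventually_elim)
      (auto intro!: lim_imp_Liminf[symmetric] tendsto_ennrealI)
  also have "\<dots> \<le> liminf (\<lambda>n. \<integral>\<^sup>+\<omega>. ennreal (f n \<omega>) \<partial>M)"
    by (rule nn_integral_liminf) auto
  also have "\<dots> = c" using c by (intro lim_imp_Liminf) auto
  finally show "(\<integral>\<^sup>+\<omega>. ennreal (g \<omega>) \<partial>M) \<le> c" .
  show "c \<le> (\<integral>\<^sup>+\<omega>. ennreal (g \<omega>) \<partial>M)"
  proof (rule ennreal_le_epsilon)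
    fix e :: real assume e: "e > 0"
    \<comment> \<open>Large enough for the truncation error \<open>\<bar>C\<bar> / K\<close> to be
      at most \<open>e\<close>, and positive even if \<open>C\<close> is zero.\<close>
    define K where "K = \<bar>C\<bar> / e + 1"
    have K: "K > 0" using e by (simp add: K_def add_nonneg_pos)
    have CK: "\<bar>C\<bar> / K \<le> e"
    proof -
      have "\<bar>C\<bar> \<le> e * K" using e by (simp add: K_def field_simps)
      thus ?thesis using K by (simp add: field_simps)
    qed
    have "(\<integral>\<^sup>+\<omega>. ennreal (f n \<omega>) \<partial>M) \<le> (\<integral>\<^sup>+\<omega>. ennreal (min (f n \<omega>) K) \<partial>M) + ennreal e" for n
    proof -
      have "f n \<omega> \<le> min (f n \<omega>) K + (f n \<omega>)^2 / K" for \<omega>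
      proof (cases "f n \<omega> \<le> K")
        case False
        hence "f n \<omega> * K \<le> f n \<omega> * f n \<omega>" using nonneg[of n \<omega>] by (intro mult_left_mono) auto
        hence "f n \<omega> \<le> (f n \<omega>)^2 / K" using K by (simp add: field_simps power2_eq_square)
        thus ?thesis using False K by simp
      qed (use K in simp)
      hence "(\<integral>\<^sup>+\<omega>. ennreal (f n \<omega>) \<partial>M) \<le> (\<integral>\<^sup>+\<omega>. ennreal (min (f n \<omega>) K) + ennreal (1 / K) * ennreal ((f n \<omega>)^2) \<partial>M)"
        using K nonneg
        by (intro nn_integral_mono) (simp add: ennreal_mult'[symmetric] ennreal_plus[symmetric] ennreal_leI del: ennreal_plus)
      also have "\<dots> = (\<integral>\<^sup>+\<omega>. ennreal (min (f n \<omega>) K) \<partial>M) + ennreal (1 / K) * (\<integral>\<^sup>+\<omega>. ennreal ((f n \<omega>)^2) \<partial>M)"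
        by (subst nn_integral_add) (auto simp: nn_integral_cmult)
      also have "ennreal (1 / K) * (\<integral>\<^sup>+\<omega>. ennreal ((f n \<omega>)^2) \<partial>M) \<le> ennreal (1 / K) * ennreal C"
        by (intro mult_left_mono L2) auto
      also have "\<dots> \<le> ennreal e" using K CK
        by (simp add: ennreal_mult'[symmetric]) (intro ennreal_leI, smt (verit) divide_right_mono)
      finally show ?thesis by (simp add: add_left_mono)
    qed
    moreover have "(\<lambda>n. \<integral>\<^sup>+\<omega>. ennreal (min (f n \<omega>) K) \<partial>M) \<longlonglongrightarrow> (\<integral>\<^sup>+\<omega>. ennreal (min (g \<omega>) K) \<partial>M)"
    proof (rule nn_integral_dominated_convergence[where w="\<lambda>_. ennreal K"])
      show "AE \<omega> in M. (\<lambda>n. ennreal (min (f n \<omega>) K)) \<longlonglongrightarrow> ennreal (min (g \<omega>) K)"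
        using lim by eventually_elim (intro tendsto_ennrealI tendsto_min, auto)
    qed (auto intro!: AE_I2 ennreal_leI simp: emeasure_space_1)
    hence "(\<lambda>n. (\<integral>\<^sup>+\<omega>. ennreal (min (f n \<omega>) K) \<partial>M) + ennreal e) \<longlonglongrightarrow> (\<integral>\<^sup>+\<omega>. ennreal (min (g \<omega>) K) \<partial>M) + ennreal e"
      by (intro tendsto_add) auto
    ultimately have "c \<le> (\<integral>\<^sup>+\<omega>. ennreal (min (g \<omega>) K) \<partial>M) + ennreal e"
      by (intro LIMSEQ_le[OF c]) auto
    also have "\<dots> \<le> (\<integral>\<^sup>+\<omega>. ennreal (g \<omega>) \<partial>M) + ennreal e"
      by (intro add_right_mono nn_integral_mono ennreal_leI) auto
    finally show "c \<le> (\<integral>\<^sup>+\<omega>. ennreal (g \<omega>) \<partial>M) + ennreal e" .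
  qed
qed

locale ornstein_uhlenbeck = brownian_motion P B for P :: "'a measure" and B +
  fixes \<theta> \<mu> \<sigma> x :: real and Y :: "real \<Rightarrow> 'a \<Rightarrow> real"
  assumes \<theta>: "\<theta> > 0" and \<sigma>: "\<sigma> > 0"
    and ou: "ou_strong_solution P B \<theta> \<mu> \<sigma> x Y"
begin

abbreviation "F \<equiv> brownian_filtration P B"

lemma Y_adapted: "t \<ge> 0 \<Longrightarrow> Y t \<in> borel_measurable (F (ennreal t))"
  using ou by (simp add: ou_strong_solution_def adapted_def)

lemma Y_measurable [measurable]: "t \<ge> 0 \<Longrightarrow> Y t \<in> borel_measurable P"
  using measurable_from_subalg[OF subalgebra_filtration Y_adapted] .

lemma Y_continuous: "AE \<omega> in P. continuous_on {0..} (\<lambda>t. Y t \<omega>)"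
  using ou by (simp add: ou_strong_solution_def)

lemma Y_0: "AE \<omega> in P. Y 0 \<omega> = x"
proof -
  have "AE \<omega> in P. B 0 \<omega> = 0" using brownian by (simp add: standard_brownian_motion_def)
  moreover have "AE \<omega> in P. \<forall>t\<ge>0. Y t \<omega> = x + (LINT s:{0..t}|lborel. \<theta> * (\<mu> - Y s \<omega>)) + \<sigma> * B t \<omega>"
    using ou by (simp add: ou_strong_solution_def)
  ultimately show ?thesis
  proof eventually_elim
    case (elim \<omega>)
    have "AE s in lborel. s \<notin> {0::real}" by (intro AE_not_in) auto
    hence "AE s in lborel. indicator {0..0} s *\<^sub>R (\<theta> * (\<mu> - Y s \<omega>)) = 0"
      by eventually_elim auto
    hence "(LINT s:{0..0}|lborel. \<theta> * (\<mu> - Y s \<omega>)) = 0"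
      unfolding set_lebesgue_integral_def by (rule integral_eq_zero_AE)
    thus ?case using elim by simp
  qed
qed

definition vol :: real where "vol = \<sigma>^2 / (4 * \<theta>)"

lemma vol_pos: "vol > 0" using \<theta> \<sigma> by (simp add: vol_def)

text \<open>For the approximating sums \<open>S u n\<close> the identity holds with
  \<open>v u n\<close> in the exponent, and both sides converge. The second moments are bounded
  because squaring \<open>exp (S u n)\<close> gives \<open>exp (S (2 * u) n)\<close>, while
  \<open>f\<close> is bounded by \<open>K\<close>.\<close>

lemma increment_indep_bounded:
  assumes st: "0 \<le> s" "s < t" and f: "f \<in> borel_measurable (F (ennreal s))"
    and K: "\<And>\<omega>. 0 \<le> f \<omega>" "\<And>\<omega>. f \<omega> \<le> (K::real)"
  shows "(\<integral>\<^sup>+\<omega>. ennreal (exp (- u * (exp (\<theta> * t) * (Y t \<omega> - \<mu>) - exp (\<theta> * s) * (Y s \<omega> - \<mu>))) * f \<omega>) \<partial>P)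
    = ennreal (exp (u^2 * vol * (exp (2 * \<theta> * t) - exp (2 * \<theta> * s)))) * (\<integral>\<^sup>+\<omega>. ennreal (f \<omega>) \<partial>P)"
proof -
  define r where "r n i = s + real i * ((t - s) / real (Suc n))" for n i
  have r0: "r n 0 = s" for n by (simp add: r_def)
  have r_mono: "r n i \<le> r n (Suc i)" for n i
  proof -
    have "real i * ((t - s) / real (Suc n)) \<le> real (Suc i) * ((t - s) / real (Suc n))"
      using st by (intro mult_right_mono) auto
    thus ?thesis by (simp add: r_def)
  qed
  have r_nn: "0 \<le> r n i" for n i using st by (simp add: r_def)
  define S where "S u n \<omega> = (\<Sum>i<Suc n. (- u * \<sigma> * exp (\<theta> * r n i)) * (B (r n (Suc i)) \<omega> - B (r n i) \<omega>))" for u n \<omega>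
  define v where "v u n = (\<Sum>i<Suc n. (- u * \<sigma> * exp (\<theta> * r n i))^2 * (r n (Suc i) - r n i) / 2)" for u n
  have fP [measurable]: "f \<in> borel_measurable P" using measurable_from_subalg[OF subalgebra_filtration f] .
  have "0 \<le> t" using st by simp
  note [measurable] = Y_measurable[OF this] Y_measurable[OF \<open>0 \<le> s\<close>]
  have v_lim: "(\<lambda>n. v u n) \<longlonglongrightarrow> u^2 * vol * (exp (2 * \<theta> * t) - exp (2 * \<theta> * s))" for u
  proof -
    \<comment> \<open>Squaring the weights \<open>exp (\<theta> * r)\<close> doubles the rate, so
      the variances are Riemann sums of \<open>exp (2 * \<theta> * r)\<close>.\<close>
    have v: "v u = (\<lambda>n. u^2 * \<sigma>^2 / 2 * (\<Sum>i<Suc n. exp (2 * \<theta> * r n i) * (r n (Suc i) - r n i)))"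
      unfolding v_def sum_distrib_left fun_eq_iff
      by (intro allI sum.cong refl) (simp add: power_mult_distrib exp_double[symmetric] mult.assoc)
    have "(\<lambda>n. u^2 * \<sigma>^2 / 2 * (\<Sum>i<Suc n. exp (2 * \<theta> * r n i) * (r n (Suc i) - r n i)))
        \<longlonglongrightarrow> u^2 * \<sigma>^2 / 2 * ((exp (2 * \<theta> * t) - exp (2 * \<theta> * s)) / (2 * \<theta>))"
      unfolding r_def by (intro tendsto_mult_left exp_Riemann_sums st) (use \<theta> in simp)
    also have "u^2 * \<sigma>^2 / 2 * ((exp (2 * \<theta> * t) - exp (2 * \<theta> * s)) / (2 * \<theta>))
        = u^2 * vol * (exp (2 * \<theta> * t) - exp (2 * \<theta> * s))" by (simp add: vol_def)
    finally show ?thesis unfolding v .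
  qed
  have E: "(\<integral>\<^sup>+\<omega>. ennreal (exp (S u n \<omega>)) * g \<omega> \<partial>P) = ennreal (exp (v u n)) * (\<integral>\<^sup>+\<omega>. g \<omega> \<partial>P)"
    if "g \<in> borel_measurable (F (ennreal s))" for u n g
    unfolding S_def v_def by (rule weighted_increments_indep) (use st r0 r_mono that in auto)
  obtain C where C: "\<And>n. v (2 * u) n \<le> C"
    using convergent_imp_Bseq[OF convergentI[OF v_lim[of "2 * u"]]] unfolding Bseq_def
    by (metis abs_le_D1 real_norm_def)
  have S_meas [measurable]: "S u n \<in> borel_measurable P" for n u
    unfolding S_def by (intro borel_measurable_sum borel_measurable_times borel_measurable_diff B_measurable r_nn) auto
  have "K \<ge> 0" using K[of undefined] by linarith
  show ?thesis
  proof (rule nn_integral_limit_L2_bounded[where f = "\<lambda>n \<omega>. exp (S u n \<omega>) * f \<omega>" and C = "K^2 * exp C"])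
    show "(\<lambda>\<omega>. exp (S u n \<omega>) * f \<omega>) \<in> borel_measurable P" for n by measurable
    show "(\<lambda>\<omega>. exp (- u * (exp (\<theta> * t) * (Y t \<omega> - \<mu>) - exp (\<theta> * s) * (Y s \<omega> - \<mu>))) * f \<omega>) \<in> borel_measurable P"
      by measurable
    show "0 \<le> exp (S u n \<omega>) * f \<omega>" for n \<omega> using K by simp
    have "AE \<omega> in P. continuous_on {0..} (\<lambda>t. Y t \<omega>)"
      "AE \<omega> in P. \<forall>t\<ge>0. Y t \<omega> = x + (LINT s:{0..t}|lborel. \<theta> * (\<mu> - Y s \<omega>)) + \<sigma> * B t \<omega>"
      using ou by (auto simp: ou_strong_solution_def)
    thus "AE \<omega> in P. (\<lambda>n. exp (S u n \<omega>) * f \<omega>) \<longlonglongrightarrow>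
        exp (- u * (exp (\<theta> * t) * (Y t \<omega> - \<mu>) - exp (\<theta> * s) * (Y s \<omega> - \<mu>))) * f \<omega>"
    proof eventually_elim
      case (elim \<omega>)
      have S: "(\<lambda>n. S u n \<omega>) = (\<lambda>n. - u * (\<Sum>i<Suc n. \<sigma> * exp (\<theta> * r n i) * (B (r n (Suc i)) \<omega> - B (r n i) \<omega>)))"
        unfolding S_def sum_distrib_left fun_eq_iff by (intro allI sum.cong) (auto simp: algebra_simps)
      have "(\<lambda>n. \<Sum>i<Suc n. \<sigma> * exp (\<theta> * r n i) * (B (r n (Suc i)) \<omega> - B (r n i) \<omega>))
          \<longlonglongrightarrow> exp (\<theta> * t) * (Y t \<omega> - \<mu>) - exp (\<theta> * s) * (Y s \<omega> - \<mu>)"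
        unfolding r_def by (rule linear_sde_increment_sums[OF _ _ st]) (use elim in auto)
      hence "(\<lambda>n. S u n \<omega>) \<longlonglongrightarrow> - u * (exp (\<theta> * t) * (Y t \<omega> - \<mu>) - exp (\<theta> * s) * (Y s \<omega> - \<mu>))"
        unfolding S by (rule tendsto_mult_left)
      thus ?case by (intro tendsto_mult_right tendsto_exp)
    qed
    show "(\<integral>\<^sup>+\<omega>. ennreal ((exp (S u n \<omega>) * f \<omega>)\<^sup>2) \<partial>P) \<le> ennreal (K\<^sup>2 * exp C)" for n
    proof -
      have "(exp (S u n \<omega>) * f \<omega>)\<^sup>2 \<le> K\<^sup>2 * exp (S (2 * u) n \<omega>)" for \<omega>
      proof -
        have "(exp (S u n \<omega>))^2 = exp (S (2 * u) n \<omega>)"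
          unfolding exp_double[symmetric] S_def sum_distrib_left by (simp add: mult.assoc)
        moreover have "(f \<omega>)^2 \<le> K^2" using K by (intro power_mono) auto
        ultimately show ?thesis by (simp add: power_mult_distrib mult.commute[of "K\<^sup>2"] mult_left_mono)
      qed
      hence "(\<integral>\<^sup>+\<omega>. ennreal ((exp (S u n \<omega>) * f \<omega>)\<^sup>2) \<partial>P) \<le> (\<integral>\<^sup>+\<omega>. ennreal (exp (S (2 * u) n \<omega>)) * ennreal (K\<^sup>2) \<partial>P)"
        by (intro nn_integral_mono) (simp add: ennreal_mult'[symmetric] ennreal_leI mult.commute)
      also have "\<dots> = ennreal (exp (v (2 * u) n)) * ennreal (K\<^sup>2)"
        by (subst E) (auto simp: emeasure_space_1)
      also have "\<dots> \<le> ennreal (K\<^sup>2 * exp C)"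
        using mult_left_mono[of "exp (v (2 * u) n)" "exp C" "K\<^sup>2"] C[of n]
        by (simp add: ennreal_mult'[symmetric] ennreal_leI mult.commute[of _ "K\<^sup>2"])
      finally show ?thesis .
    qed
    have "(\<lambda>n. ennreal (exp (v u n)) * (\<integral>\<^sup>+\<omega>. ennreal (f \<omega>) \<partial>P)) \<longlonglongrightarrow>
        ennreal (exp (u^2 * vol * (exp (2 * \<theta> * t) - exp (2 * \<theta> * s)))) * (\<integral>\<^sup>+\<omega>. ennreal (f \<omega>) \<partial>P)"
      by (intro tendsto_mult_ennreal tendsto_const tendsto_ennrealI tendsto_exp v_lim) auto
    moreover have "(\<integral>\<^sup>+\<omega>. ennreal (exp (S u n \<omega>) * f \<omega>) \<partial>P) = ennreal (exp (v u n)) * (\<integral>\<^sup>+\<omega>. ennreal (f \<omega>) \<partial>P)" for n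
      using E[of "\<lambda>\<omega>. ennreal (f \<omega>)" u n] f by (simp add: ennreal_mult')
    ultimately show "(\<lambda>n. \<integral>\<^sup>+\<omega>. ennreal (exp (S u n \<omega>) * f \<omega>) \<partial>P) \<longlonglongrightarrow>
        ennreal (exp (u^2 * vol * (exp (2 * \<theta> * t) - exp (2 * \<theta> * s)))) * (\<integral>\<^sup>+\<omega>. ennreal (f \<omega>) \<partial>P)"
      by simp
  qed
qed

text \<open>Monotone convergence along \<open>min (f \<omega>) (real k)\<close> removes the bound;
  the martingale property applies this to the unbounded \<open>expmart u s\<close>, restricted to an
  event.\<close>

lemma increment_indep:
  assumes st: "0 \<le> s" "s < t" and f: "f \<in> borel_measurable (F (ennreal s))"
    and nonneg: "\<And>\<omega>. 0 \<le> f \<omega>"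
  shows "(\<integral>\<^sup>+\<omega>. ennreal (exp (- u * (exp (\<theta> * t) * (Y t \<omega> - \<mu>) - exp (\<theta> * s) * (Y s \<omega> - \<mu>))) * f \<omega>) \<partial>P)
    = ennreal (exp (u^2 * vol * (exp (2 * \<theta> * t) - exp (2 * \<theta> * s)))) * (\<integral>\<^sup>+\<omega>. ennreal (f \<omega>) \<partial>P)"
proof -
  define e where "e \<omega> = exp (- u * (exp (\<theta> * t) * (Y t \<omega> - \<mu>) - exp (\<theta> * s) * (Y s \<omega> - \<mu>)))" for \<omega>
  define c where "c = exp (u^2 * vol * (exp (2 * \<theta> * t) - exp (2 * \<theta> * s)))"
  have fP [measurable]: "f \<in> borel_measurable P" using measurable_from_subalg[OF subalgebra_filtration f] .
  have "0 \<le> t" using st by simp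
  note [measurable] = Y_measurable[OF this] Y_measurable[OF \<open>0 \<le> s\<close>]
  have [measurable]: "e \<in> borel_measurable P" unfolding e_def by measurable
  have lim: "(SUP k. ennreal (h * min (f \<omega>) (real k))) = ennreal (h * f \<omega>)" if "h \<ge> 0" for h \<omega>
  proof (rule antisym)
    show "(SUP k. ennreal (h * min (f \<omega>) (real k))) \<le> ennreal (h * f \<omega>)"
      using that by (intro SUP_least ennreal_leI mult_left_mono) auto
    obtain k :: nat where "f \<omega> \<le> real k" using real_arch_simple by blast
    thus "ennreal (h * f \<omega>) \<le> (SUP k. ennreal (h * min (f \<omega>) (real k)))"
      by (intro SUP_upper2[of k]) auto
  qed
  have inc: "incseq (\<lambda>k \<omega>. ennreal (h \<omega> * min (f \<omega>) (real k)))" if "\<And>\<omega>. h \<omega> \<ge> 0" for h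
    using that by (auto simp: incseq_def le_fun_def intro!: ennreal_leI mult_left_mono)
  have e0: "e \<omega> \<ge> 0" for \<omega> by (simp add: e_def)
  have "(\<integral>\<^sup>+\<omega>. ennreal (e \<omega> * f \<omega>) \<partial>P) = (\<integral>\<^sup>+\<omega>. (SUP k. ennreal (e \<omega> * min (f \<omega>) (real k))) \<partial>P)"
    by (simp add: lim[OF e0])
  also have "\<dots> = (SUP k. \<integral>\<^sup>+\<omega>. ennreal (e \<omega> * min (f \<omega>) (real k)) \<partial>P)"
    by (intro nn_integral_monotone_convergence_SUP inc e0) auto
  also have "\<dots> = (SUP k. ennreal c * (\<integral>\<^sup>+\<omega>. ennreal (min (f \<omega>) (real k)) \<partial>P))"
    unfolding e_def c_def
    by (intro SUP_cong refl increment_indep_bounded[OF st, where f="\<lambda>\<omega>. min (f \<omega>) (real k)" and K = "real k" for k])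
       (use f nonneg in auto)
  also have "\<dots> = ennreal c * (SUP k. \<integral>\<^sup>+\<omega>. ennreal (min (f \<omega>) (real k)) \<partial>P)"
    by (rule SUP_mult_left_ennreal[symmetric])
  also have "(SUP k. \<integral>\<^sup>+\<omega>. ennreal (min (f \<omega>) (real k)) \<partial>P) = (\<integral>\<^sup>+\<omega>. (SUP k. ennreal (min (f \<omega>) (real k))) \<partial>P)"
    using inc[of "\<lambda>_. 1"] by (intro nn_integral_monotone_convergence_SUP[symmetric]) auto
  also have "\<dots> = (\<integral>\<^sup>+\<omega>. ennreal (f \<omega>) \<partial>P)" using lim[of 1] by simp
  finally show ?thesis unfolding e_def c_def .
qed

definition expmart :: "real \<Rightarrow> real \<Rightarrow> 'a \<Rightarrow> real" where
  "expmart u t \<omega> = exp (- u * (exp (\<theta> * t) * (Y t \<omega> - \<mu>)) - u^2 * vol * exp (2 * \<theta> * t))"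

lemma expmart_pos: "expmart u t \<omega> > 0" by (simp add: expmart_def)

lemma expmart_adapted: "t \<ge> 0 \<Longrightarrow> expmart u t \<in> borel_measurable (F (ennreal t))"
  unfolding expmart_def using Y_adapted[of t] by measurable

lemma expmart_measurable [measurable]: "t \<ge> 0 \<Longrightarrow> expmart u t \<in> borel_measurable P"
  using measurable_from_subalg[OF subalgebra_filtration expmart_adapted] .

text \<open>Passing from \<open>s\<close> to \<open>t\<close> multiplies by the exponential of an
  increment independent of the past and by \<open>exp (- d)\<close>, the reciprocal of its mean. The
  formulation over events \<open>A\<close> fits optional stopping, where \<open>A\<close> is the
  event of not having stopped by time \<open>s\<close>.\<close>

lemma expmart_martingale:
  assumes st: "0 \<le> s" "s \<le> t" and A: "A \<in> sets (F (ennreal s))"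
  shows "(\<integral>\<^sup>+\<omega>. ennreal (expmart u t \<omega>) * indicator A \<omega> \<partial>P) = (\<integral>\<^sup>+\<omega>. ennreal (expmart u s \<omega>) * indicator A \<omega> \<partial>P)"
proof (cases "s = t")
  case False
  hence st': "s < t" using st by simp
  define d where "d = u^2 * vol * (exp (2 * \<theta> * t) - exp (2 * \<theta> * s))"
  define f where "f \<omega> = expmart u s \<omega> * indicator A \<omega>" for \<omega>
  have f: "f \<in> borel_measurable (F (ennreal s))"
    unfolding f_def using A expmart_adapted[OF st(1)] by (intro borel_measurable_times borel_measurable_indicator)
  have f0: "f \<omega> \<ge> 0" for \<omega> unfolding f_def using expmart_pos[of u s \<omega>] by (simp add: less_imp_le)
  have "A \<in> sets P" using A subalgebra_filtration by (auto simp: subalgebra_def)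
  note [measurable] = this
  have fP [measurable]: "f \<in> borel_measurable P" using measurable_from_subalg[OF subalgebra_filtration f] .
  have "0 \<le> t" using st by simp
  note [measurable] = Y_measurable[OF this] Y_measurable[OF \<open>0 \<le> s\<close>]
  define e where "e \<omega> = exp (- u * (exp (\<theta> * t) * (Y t \<omega> - \<mu>) - exp (\<theta> * s) * (Y s \<omega> - \<mu>)))" for \<omega>
  have [measurable]: "e \<in> borel_measurable P" unfolding e_def by measurable
  have eq: "expmart u t \<omega> = exp (- d) * (e \<omega> * expmart u s \<omega>)" for \<omega>
    unfolding expmart_def d_def e_def exp_add[symmetric] by (simp add: algebra_simps)
  have "(\<integral>\<^sup>+\<omega>. ennreal (expmart u t \<omega>) * indicator A \<omega> \<partial>P) = (\<integral>\<^sup>+\<omega>. ennreal (exp (- d)) * ennreal (e \<omega> * f \<omega>) \<partial>P)"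
    by (intro nn_integral_cong) (simp add: eq f_def ennreal_mult'[symmetric] indicator_def)
  also have "\<dots> = ennreal (exp (- d)) * (\<integral>\<^sup>+\<omega>. ennreal (e \<omega> * f \<omega>) \<partial>P)"
    by (rule nn_integral_cmult) auto
  also have "\<dots> = ennreal (exp (- d)) * (ennreal (exp d) * (\<integral>\<^sup>+\<omega>. ennreal (f \<omega>) \<partial>P))"
    unfolding e_def d_def by (subst increment_indep[OF st(1) st' f f0]) simp
  also have "\<dots> = (\<integral>\<^sup>+\<omega>. ennreal (f \<omega>) \<partial>P)"
    by (simp add: mult.assoc[symmetric] ennreal_mult'[symmetric] exp_add[symmetric])
  also have "\<dots> = (\<integral>\<^sup>+\<omega>. ennreal (expmart u s \<omega>) * indicator A \<omega> \<partial>P)"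
    by (intro nn_integral_cong) (simp add: f_def indicator_def)
  finally show ?thesis .
qed simp

end

subsection \<open>Optional stopping\<close>

context brownian_motion
begin

lemma borel_measurable_AE_limit:
  fixes f :: "nat \<Rightarrow> 'a \<Rightarrow> real"
  assumes "\<And>n. f n \<in> borel_measurable P" "AE \<omega> in P. (\<lambda>n. f n \<omega>) \<longlonglongrightarrow> g \<omega>"
  shows "g \<in> borel_measurable P"
proof (rule measurable_AE)
  show "(\<lambda>\<omega>. lim (\<lambda>n. f n \<omega>)) \<in> borel_measurable P"
    by (rule borel_measurable_lim_metric) (rule assms)
  show "AE \<omega> in P. lim (\<lambda>n. f n \<omega>) = g \<omega>"
    using assms(2) by eventually_elim (rule limI)
qed simp

end

context ornstein_uhlenbeck
begin

section \<open>Optional stopping at bounded times\<close>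

definition bounded_stopping :: "real \<Rightarrow> ('a \<Rightarrow> real) \<Rightarrow> bool" where
  "bounded_stopping N T \<longleftrightarrow> (\<forall>\<omega>. 0 \<le> T \<omega> \<and> T \<omega> \<le> N) \<and>
     (\<forall>t\<ge>0. {\<omega> \<in> space P. T \<omega> \<le> t} \<in> sets (F (ennreal t)))"

lemma bounded_stopping_measurable:
  assumes "bounded_stopping N T"
  shows "T \<in> borel_measurable P"
proof (rule borel_measurable_iff_le[THEN iffD2], rule allI)
  fix t
  show "{\<omega> \<in> space P. T \<omega> \<le> t} \<in> sets P"
  proof (cases "t \<ge> 0")
    case True
    thus ?thesis using assms subalgebra_filtration unfolding bounded_stopping_def subalgebra_def by blast
  next
    case False
    have "\<not> T \<omega> \<le> t" for \<omega>
      using assms False order_trans[of 0 "T \<omega>" t] unfolding bounded_stopping_def by blast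
    thus ?thesis by simp
  qed
qed

text \<open>The time is rounded up, so that whether the rounded time exceeds a grid point is known
  at that grid point.\<close>

lemma grid_approximation:
  fixes T :: real
  assumes "T \<ge> 0"
  shows "(\<lambda>n. real (nat \<lceil>real (Suc n) * T\<rceil>) / real (Suc n)) \<longlonglongrightarrow> T"
proof (rule real_tendsto_sandwich)
  have c: "real (nat \<lceil>real (Suc n) * T\<rceil>) = of_int \<lceil>real (Suc n) * T\<rceil>" for n
    using assms by (intro of_nat_nat) (simp add: order_less_le_trans[OF _ mult_nonneg_nonneg])
  show "\<forall>\<^sub>F n in sequentially. T \<le> real (nat \<lceil>real (Suc n) * T\<rceil>) / real (Suc n)"
  proof (intro always_eventually allI)
    fix n
    have "T * real (Suc n) \<le> real (nat \<lceil>real (Suc n) * T\<rceil>)"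
      unfolding c by (metis le_of_int_ceiling mult.commute)
    thus "T \<le> real (nat \<lceil>real (Suc n) * T\<rceil>) / real (Suc n)" by (subst pos_le_divide_eq) auto
  qed
  show "\<forall>\<^sub>F n in sequentially. real (nat \<lceil>real (Suc n) * T\<rceil>) / real (Suc n) \<le> T + inverse (real (Suc n))"
  proof (intro always_eventually allI)
    fix n
    have "real (nat \<lceil>real (Suc n) * T\<rceil>) \<le> real (Suc n) * T + 1"
      unfolding c by linarith
    hence "real (nat \<lceil>real (Suc n) * T\<rceil>) / real (Suc n) \<le> (real (Suc n) * T + 1) / real (Suc n)"
      by (intro divide_right_mono) auto
    also have "\<dots> = T + inverse (real (Suc n))" by (simp add: add_divide_distrib inverse_eq_divide del: of_nat_Suc)
    finally show "real (nat \<lceil>real (Suc n) * T\<rceil>) / real (Suc n) \<le> T + inverse (real (Suc n))" .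
  qed
  show "(\<lambda>n. T + inverse (real (Suc n))) \<longlonglongrightarrow> T"
    using tendsto_add[OF tendsto_const LIMSEQ_inverse_real_of_nat] by simp
qed simp

lemma stopped_grid_measurable:
  assumes T: "bounded_stopping N T" and G: "\<And>t. t \<ge> 0 \<Longrightarrow> G t \<in> measurable P M"
  shows "(\<lambda>\<omega>. G (real (min K (nat \<lceil>real (Suc n) * T \<omega>\<rceil>)) / real (Suc n)) \<omega>) \<in> measurable P M"
proof (rule measurable_compose_countable[where f="\<lambda>i. G (real i / real (Suc n))"
      and g="\<lambda>\<omega>. min K (nat \<lceil>real (Suc n) * T \<omega>\<rceil>)"])
  note [measurable] = bounded_stopping_measurable[OF T]
  show "(\<lambda>\<omega>. min K (nat \<lceil>real (Suc n) * T \<omega>\<rceil>)) \<in> measurable P (count_space UNIV)" by measurable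
qed (intro G, simp)

text \<open>Induction on the cap \<open>K\<close>. Raising it by one changes the stopped value only
  on \<open>A\<close>, where \<open>T\<close> exceeds \<open>s\<close>; this event belongs to the
  past at time \<open>s\<close>, so the martingale property applies on it.\<close>

lemma optional_stopping_grid:
  assumes T: "bounded_stopping N T"
  shows "(\<integral>\<^sup>+\<omega>. ennreal (expmart u (real (min K (nat \<lceil>real (Suc n) * T \<omega>\<rceil>)) / real (Suc n)) \<omega>) \<partial>P)
     = (\<integral>\<^sup>+\<omega>. ennreal (expmart u 0 \<omega>) \<partial>P)"
proof (induction K)
  case (Suc K)
  define \<kappa> where "\<kappa> \<omega> = nat \<lceil>real (Suc n) * T \<omega>\<rceil>" for \<omega>
  define s where "s = real K / real (Suc n)"
  define t where "t = real (Suc K) / real (Suc n)"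
  have st: "0 \<le> s" "s \<le> t" by (auto simp: s_def t_def divide_right_mono)
  define A where "A = space P - {\<omega> \<in> space P. T \<omega> \<le> s}"
  have A: "A \<in> sets (F (ennreal s))"
    using T st(1) unfolding A_def bounded_stopping_def
    by (metis sets.compl_sets space_brownian_filtration)
  have AP: "A \<in> sets P" using A subalgebra_filtration by (auto simp: subalgebra_def)
  have \<kappa>: "\<kappa> \<omega> \<le> K \<longleftrightarrow> T \<omega> \<le> s" for \<omega>
  proof -
    have "\<kappa> \<omega> \<le> K \<longleftrightarrow> real (Suc n) * T \<omega> \<le> real K"
      by (simp add: \<kappa>_def nat_le_iff ceiling_le_iff)
    also have "\<dots> \<longleftrightarrow> T \<omega> \<le> s" unfolding s_def by (subst pos_le_divide_eq) (auto simp: mult.commute)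
    finally show ?thesis .
  qed
  let ?R = "\<lambda>K \<omega>. expmart u (real (min K (\<kappa> \<omega>)) / real (Suc n)) \<omega>"
  have m: "?R K \<in> borel_measurable P" for K
    unfolding \<kappa>_def by (rule stopped_grid_measurable[OF T]) simp
  have split: "(\<integral>\<^sup>+\<omega>. ennreal (?R L \<omega>) \<partial>P) = (\<integral>\<^sup>+\<omega>. ennreal (?R L \<omega>) * indicator A \<omega> \<partial>P)
      + (\<integral>\<^sup>+\<omega>. ennreal (?R L \<omega>) * indicator (space P - A) \<omega> \<partial>P)" for L
    using m[of L] AP by (subst nn_integral_add[symmetric]) (auto intro!: nn_integral_cong simp: indicator_def)
  have inA: "min K (\<kappa> \<omega>) = K" "min (Suc K) (\<kappa> \<omega>) = Suc K" if "\<omega> \<in> A" for \<omega>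
    using \<kappa>[of \<omega>] that by (auto simp: A_def)
  have "(\<integral>\<^sup>+\<omega>. ennreal (?R (Suc K) \<omega>) * indicator A \<omega> \<partial>P) = (\<integral>\<^sup>+\<omega>. ennreal (expmart u t \<omega>) * indicator A \<omega> \<partial>P)"
    by (intro nn_integral_cong) (simp add: inA indicator_def t_def del: of_nat_Suc)
  also have "\<dots> = (\<integral>\<^sup>+\<omega>. ennreal (expmart u s \<omega>) * indicator A \<omega> \<partial>P)"
    by (rule expmart_martingale[OF st A])
  also have "\<dots> = (\<integral>\<^sup>+\<omega>. ennreal (?R K \<omega>) * indicator A \<omega> \<partial>P)"
    by (intro nn_integral_cong) (simp add: inA indicator_def s_def del: of_nat_Suc)
  finally have 1: "(\<integral>\<^sup>+\<omega>. ennreal (?R (Suc K) \<omega>) * indicator A \<omega> \<partial>P) = (\<integral>\<^sup>+\<omega>. ennreal (?R K \<omega>) * indicator A \<omega> \<partial>P)" .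
  have notA: "min K (\<kappa> \<omega>) = \<kappa> \<omega>" "min (Suc K) (\<kappa> \<omega>) = \<kappa> \<omega>" if "\<omega> \<in> space P - A" for \<omega>
    using \<kappa>[of \<omega>] that by (auto simp: A_def)
  have 2: "(\<integral>\<^sup>+\<omega>. ennreal (?R (Suc K) \<omega>) * indicator (space P - A) \<omega> \<partial>P) = (\<integral>\<^sup>+\<omega>. ennreal (?R K \<omega>) * indicator (space P - A) \<omega> \<partial>P)"
    by (intro nn_integral_cong) (simp add: notA indicator_def del: of_nat_Suc)
  have "(\<integral>\<^sup>+\<omega>. ennreal (?R (Suc K) \<omega>) \<partial>P) = (\<integral>\<^sup>+\<omega>. ennreal (?R K \<omega>) \<partial>P)"
    unfolding split[of "Suc K"] split[of K] 1 2 ..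
  thus ?case using Suc.IH by (simp add: \<kappa>_def)
qed simp

lemma expmart_0: "(\<integral>\<^sup>+\<omega>. ennreal (expmart u 0 \<omega>) \<partial>P) = ennreal (exp (- u * (x - \<mu>) - u^2 * vol))"
proof -
  have "(\<integral>\<^sup>+\<omega>. ennreal (expmart u 0 \<omega>) \<partial>P) = (\<integral>\<^sup>+\<omega>. ennreal (exp (- u * (x - \<mu>) - u^2 * vol)) \<partial>P)"
    using Y_0 by (intro nn_integral_cong_AE, eventually_elim) (simp add: expmart_def)
  thus ?thesis by (simp add: emeasure_space_1)
qed

text \<open>With this cap the \<open>min\<close> in the grid version of optional stopping is never
  active.\<close>

lemma grid_bound:
  assumes T: "bounded_stopping (real N) T"
  shows "nat \<lceil>real (Suc n) * T \<omega>\<rceil> \<le> Suc n * N"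
proof -
  have "real (Suc n) * T \<omega> \<le> real (Suc n) * real N"
    using T unfolding bounded_stopping_def by (intro mult_left_mono) auto
  also have "\<dots> = of_int (int (Suc n * N))" by (metis of_nat_mult of_int_of_nat_eq)
  finally show ?thesis unfolding nat_le_iff ceiling_le_iff .
qed

lemma stopped_grid_limit:
  assumes T: "bounded_stopping (real N) T" and c: "continuous_on {0..} (\<lambda>t. Y t \<omega>)"
  shows "(\<lambda>n. Y (real (nat \<lceil>real (Suc n) * T \<omega>\<rceil>) / real (Suc n)) \<omega>) \<longlonglongrightarrow> Y (T \<omega>) \<omega>"
    "(\<lambda>n. expmart u (real (nat \<lceil>real (Suc n) * T \<omega>\<rceil>) / real (Suc n)) \<omega>) \<longlonglongrightarrow> expmart u (T \<omega>) \<omega>"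
proof -
  have T0: "T \<omega> \<ge> 0" using T by (simp add: bounded_stopping_def)
  note lim = grid_approximation[OF T0]
  show Y: "(\<lambda>n. Y (real (nat \<lceil>real (Suc n) * T \<omega>\<rceil>) / real (Suc n)) \<omega>) \<longlonglongrightarrow> Y (T \<omega>) \<omega>"
  proof (rule continuous_on_tendsto_compose[OF c lim])
    show "\<forall>\<^sub>F n in sequentially. real (nat \<lceil>real (Suc n) * T \<omega>\<rceil>) / real (Suc n) \<in> {0..}"
      unfolding atLeast_iff by (intro always_eventually allI divide_nonneg_nonneg of_nat_0_le_iff)
  qed (use T0 in simp)
  show "(\<lambda>n. expmart u (real (nat \<lceil>real (Suc n) * T \<omega>\<rceil>) / real (Suc n)) \<omega>) \<longlonglongrightarrow> expmart u (T \<omega>) \<omega>"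
    unfolding expmart_def by (intro tendsto_intros lim Y)
qed

lemma stopped_grid_measurable':
  assumes T: "bounded_stopping (real N) T" and G: "\<And>t. t \<ge> 0 \<Longrightarrow> G t \<in> measurable P M"
  shows "(\<lambda>\<omega>. G (real (nat \<lceil>real (Suc n) * T \<omega>\<rceil>) / real (Suc n)) \<omega>) \<in> measurable P M"
  using stopped_grid_measurable[OF T G, where n = n and K = "Suc n * N"]
  unfolding min_absorb2[OF grid_bound[OF T]] .

lemma Y_bounded_stopping_measurable:
  assumes T: "bounded_stopping (real N) T"
  shows "(\<lambda>\<omega>. Y (T \<omega>) \<omega>) \<in> borel_measurable P"
proof (rule borel_measurable_AE_limit)
  show "AE \<omega> in P. (\<lambda>n. Y (real (nat \<lceil>real (Suc n) * T \<omega>\<rceil>) / real (Suc n)) \<omega>) \<longlonglongrightarrow> Y (T \<omega>) \<omega>"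
    using Y_continuous by eventually_elim (rule stopped_grid_limit[OF T])
qed (rule stopped_grid_measurable'[OF T], simp)

lemma expmart_bounded_stopping_measurable:
  assumes T: "bounded_stopping (real N) T"
  shows "(\<lambda>\<omega>. expmart u (T \<omega>) \<omega>) \<in> borel_measurable P"
proof -
  note [measurable] = Y_bounded_stopping_measurable[OF T] bounded_stopping_measurable[OF T]
  show ?thesis unfolding expmart_def by measurable
qed

lemma optional_stopping_bounded:
  assumes T: "bounded_stopping (real N) T"
  shows "(\<integral>\<^sup>+\<omega>. ennreal (expmart u (T \<omega>) \<omega>) \<partial>P) = ennreal (exp (- u * (x - \<mu>) - u^2 * vol))"
proof -
  define t where "t n \<omega> = real (nat \<lceil>real (Suc n) * T \<omega>\<rceil>) / real (Suc n)" for n \<omega>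
  have os: "(\<integral>\<^sup>+\<omega>. ennreal (expmart u (t n \<omega>) \<omega>) \<partial>P) = ennreal (exp (- u * (x - \<mu>) - u^2 * vol))" for n u
    using optional_stopping_grid[OF T, where n = n and u = u and K = "Suc n * N"]
    unfolding min_absorb2[OF grid_bound[OF T]] expmart_0 t_def .
  have tN: "t n \<omega> \<le> real N" for n \<omega>
  proof -
    have "real (nat \<lceil>real (Suc n) * T \<omega>\<rceil>) \<le> real (Suc n * N)"
      using grid_bound[OF T, of n \<omega>] by (rule of_nat_mono)
    also have "\<dots> = real N * real (Suc n)" by (simp only: of_nat_mult mult.commute)
    finally show ?thesis unfolding t_def by (subst pos_divide_le_eq) auto
  qed
  \<comment> \<open>The square of \<open>expmart u\<close> is \<open>expmart (2 * u)\<close> times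
    \<open>exp (2 * u^2 * vol * exp (2 * \<theta> * t))\<close>. Up to time \<open>N\<close> the
    last factor is at most \<open>D\<close>, and \<open>expmart (2 * u)\<close> has constant mean on
    the grid: this is the second-moment bound.\<close>
  define D where "D = exp (2 * u^2 * vol * exp (2 * \<theta> * real N))"
  have m: "(\<lambda>\<omega>. expmart u (t n \<omega>) \<omega>) \<in> borel_measurable P" for u n
    unfolding t_def by (rule stopped_grid_measurable'[OF T]) simp
  show ?thesis
  proof (rule nn_integral_limit_L2_bounded[where f = "\<lambda>n \<omega>. expmart u (t n \<omega>) \<omega>"
        and C = "exp (- (2 * u) * (x - \<mu>) - (2 * u)^2 * vol) * D"])
    show "AE \<omega> in P. (\<lambda>n. expmart u (t n \<omega>) \<omega>) \<longlonglongrightarrow> expmart u (T \<omega>) \<omega>"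
      using Y_continuous unfolding t_def by eventually_elim (rule stopped_grid_limit[OF T])
    fix n
    have "(expmart u (t n \<omega>) \<omega>)^2 \<le> expmart (2 * u) (t n \<omega>) \<omega> * D" for \<omega>
    proof -
      have "2 * u^2 * vol * exp (2 * \<theta> * t n \<omega>) \<le> 2 * u^2 * vol * exp (2 * \<theta> * real N)"
        using tN[of n \<omega>] \<theta> vol_pos by (intro mult_left_mono) auto
      moreover have "(expmart u (t n \<omega>) \<omega>)^2 = expmart (2 * u) (t n \<omega>) \<omega> * exp (2 * u^2 * vol * exp (2 * \<theta> * t n \<omega>))"
        unfolding expmart_def exp_double[symmetric] exp_add[symmetric] by (simp add: algebra_simps power2_eq_square)
      ultimately show ?thesis unfolding D_def using expmart_pos[of "2 * u" "t n \<omega>" \<omega>]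
        by (simp add: mult_left_mono)
    qed
    hence "(\<integral>\<^sup>+\<omega>. ennreal ((expmart u (t n \<omega>) \<omega>)\<^sup>2) \<partial>P) \<le> (\<integral>\<^sup>+\<omega>. ennreal (expmart (2 * u) (t n \<omega>) \<omega>) * ennreal D \<partial>P)"
      by (intro nn_integral_mono) (auto simp: D_def ennreal_mult''[symmetric] intro!: ennreal_leI)
    also have "\<dots> = (\<integral>\<^sup>+\<omega>. ennreal (expmart (2 * u) (t n \<omega>) \<omega>) \<partial>P) * ennreal D"
      using m by (intro nn_integral_multc) auto
    also have "\<dots> = ennreal (exp (- (2 * u) * (x - \<mu>) - (2 * u)^2 * vol) * D)"
      unfolding os by (simp add: D_def ennreal_mult'')
    finally show "(\<integral>\<^sup>+\<omega>. ennreal ((expmart u (t n \<omega>) \<omega>)\<^sup>2) \<partial>P) \<le> ennreal (exp (- (2 * u) * (x - \<mu>) - (2 * u)^2 * vol) * D)" .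
    show "(\<lambda>n. \<integral>\<^sup>+\<omega>. ennreal (expmart u (t n \<omega>) \<omega>) \<partial>P) \<longlonglongrightarrow> ennreal (exp (- u * (x - \<mu>) - u^2 * vol))"
      unfolding os by simp
  qed (use m expmart_bounded_stopping_measurable[OF T] expmart_pos in \<open>auto simp: less_imp_le\<close>)
qed

text \<open>The minimum of \<tau> and \<open>N\<close> as a real number. The case distinction is
  necessary because \<open>enn2real\<close> sends infinity to 0.\<close>

definition truncate :: "('a \<Rightarrow> ennreal) \<Rightarrow> nat \<Rightarrow> 'a \<Rightarrow> real" where
  "truncate \<tau> N \<omega> = (if \<tau> \<omega> = \<infinity> then real N else min (enn2real (\<tau> \<omega>)) (real N))"

lemma truncate_bounded_stopping:
  assumes "stopping_time F \<tau>"
  shows "bounded_stopping (real N) (truncate \<tau> N)"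
  unfolding bounded_stopping_def
proof (intro conjI allI impI)
  fix t :: real assume t: "t \<ge> 0"
  have S: "{\<omega> \<in> space P. \<tau> \<omega> \<le> ennreal t} \<in> sets (F (ennreal t))"
    using assms unfolding stopping_time_def by (auto simp: pred_def)
  show "{\<omega> \<in> space P. truncate \<tau> N \<omega> \<le> t} \<in> sets (F (ennreal t))"
  proof (cases "real N \<le> t")
    case True
    hence "{\<omega> \<in> space P. truncate \<tau> N \<omega> \<le> t} = space (F (ennreal t))" by (auto simp: truncate_def)
    thus ?thesis by (metis sets.top)
  next
    case False
    hence "truncate \<tau> N \<omega> \<le> t \<longleftrightarrow> \<tau> \<omega> \<le> ennreal t" for \<omega>
      using t by (cases "\<tau> \<omega>") (auto simp: truncate_def top_unique)
    thus ?thesis using S by simp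
  qed
qed (auto simp: truncate_def)

lemma truncate_eventually:
  assumes "\<tau> \<omega> \<noteq> \<infinity>"
  shows "\<forall>\<^sub>F N in sequentially. truncate \<tau> N \<omega> = enn2real (\<tau> \<omega>)"
proof -
  obtain M :: nat where "enn2real (\<tau> \<omega>) \<le> real M" using real_arch_simple by blast
  hence "truncate \<tau> N \<omega> = enn2real (\<tau> \<omega>)" if "N \<ge> M" for N using assms that by (auto simp: truncate_def)
  thus ?thesis by (auto simp: eventually_sequentially)
qed

lemma stopping_time_measurable:
  assumes "stopping_time F \<tau>"
  shows "\<tau> \<in> borel_measurable P"
proof (rule borel_measurableI_le)
  fix t
  show "{\<omega> \<in> space P. \<tau> \<omega> \<le> t} \<in> sets P"
    using assms subalgebra_filtration[of t] unfolding stopping_time_def subalgebra_def by (auto simp: pred_def)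
qed

lemma stopped_Y_measurable:
  assumes \<tau>: "stopping_time F \<tau>"
  shows "(\<lambda>\<omega>. if \<tau> \<omega> = \<infinity> then 0 else Y (enn2real (\<tau> \<omega>)) \<omega>) \<in> borel_measurable P"
proof (rule borel_measurable_AE_limit[where f = "\<lambda>N \<omega>. if \<tau> \<omega> = \<infinity> then 0 else Y (truncate \<tau> N \<omega>) \<omega>"])
  fix N
  note [measurable] = stopping_time_measurable[OF \<tau>] Y_bounded_stopping_measurable[OF truncate_bounded_stopping[OF \<tau>]]
  show "(\<lambda>\<omega>. if \<tau> \<omega> = \<infinity> then 0 else Y (truncate \<tau> N \<omega>) \<omega>) \<in> borel_measurable P" by measurable
next
  have "(\<lambda>N. if \<tau> \<omega> = \<infinity> then 0 else Y (truncate \<tau> N \<omega>) \<omega>) \<longlonglongrightarrow> (if \<tau> \<omega> = \<infinity> then 0 else Y (enn2real (\<tau> \<omega>)) \<omega>)" for \<omega>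
  proof (cases "\<tau> \<omega> = \<infinity>")
    case False
    have "\<forall>\<^sub>F N in sequentially. Y (truncate \<tau> N \<omega>) \<omega> = Y (enn2real (\<tau> \<omega>)) \<omega>"
      using truncate_eventually[of \<tau> \<omega>, OF False] by eventually_elim simp
    thus ?thesis using False by (simp add: tendsto_eventually)
  qed simp
  thus "AE \<omega> in P. (\<lambda>N. if \<tau> \<omega> = \<infinity> then 0 else Y (truncate \<tau> N \<omega>) \<omega>) \<longlonglongrightarrow> (if \<tau> \<omega> = \<infinity> then 0 else Y (enn2real (\<tau> \<omega>)) \<omega>)"
    by simp
qed

definition stopped_expmart :: "('a \<Rightarrow> ennreal) \<Rightarrow> real \<Rightarrow> 'a \<Rightarrow> real" where
  "stopped_expmart \<tau> u \<omega> = (if \<tau> \<omega> = \<infinity> then 0 else expmart u (enn2real (\<tau> \<omega>)) \<omega>)"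

text \<open>Fatou along the truncations. For a general \<tau> mass may be lost at infinity, hence
  only an inequality.\<close>

lemma stopped_expmart_le:
  assumes \<tau>: "stopping_time F \<tau>"
  shows "(\<integral>\<^sup>+\<omega>. ennreal (stopped_expmart \<tau> u \<omega>) \<partial>P) \<le> ennreal (exp (- u * (x - \<mu>) - u^2 * vol))"
proof -
  note [measurable] = expmart_bounded_stopping_measurable[OF truncate_bounded_stopping[OF \<tau>]]
  have "ennreal (stopped_expmart \<tau> u \<omega>) \<le> liminf (\<lambda>N. ennreal (expmart u (truncate \<tau> N \<omega>) \<omega>))" for \<omega>
  proof (cases "\<tau> \<omega> = \<infinity>")
    case False
    have "\<forall>\<^sub>F N in sequentially. ennreal (expmart u (truncate \<tau> N \<omega>) \<omega>) = ennreal (stopped_expmart \<tau> u \<omega>)"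
      using truncate_eventually[of \<tau> \<omega>, OF False] by eventually_elim (use False in \<open>simp add: stopped_expmart_def\<close>)
    hence "liminf (\<lambda>N. ennreal (expmart u (truncate \<tau> N \<omega>) \<omega>)) = ennreal (stopped_expmart \<tau> u \<omega>)"
      by (intro lim_imp_Liminf tendsto_eventually) auto
    thus ?thesis by simp
  qed (simp add: stopped_expmart_def)
  hence "(\<integral>\<^sup>+\<omega>. ennreal (stopped_expmart \<tau> u \<omega>) \<partial>P) \<le> (\<integral>\<^sup>+\<omega>. liminf (\<lambda>N. ennreal (expmart u (truncate \<tau> N \<omega>) \<omega>)) \<partial>P)"
    by (intro nn_integral_mono)
  also have "\<dots> \<le> liminf (\<lambda>N. \<integral>\<^sup>+\<omega>. ennreal (expmart u (truncate \<tau> N \<omega>) \<omega>) \<partial>P)"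
    by (rule nn_integral_liminf) measurable
  also have "\<dots> = ennreal (exp (- u * (x - \<mu>) - u^2 * vol))"
    by (simp add: optional_stopping_bounded[OF truncate_bounded_stopping[OF \<tau>]] Liminf_const)
  finally show ?thesis .
qed

text \<open>If \<open>Y\<close> stays above a level up to time \<open>\<tau>\<close>, the stopped martingale is bounded and nothing
  is lost at infinity.\<close>

lemma stopped_expmart_eq:
  assumes \<tau>: "stopping_time F \<tau>" and u: "u > 0"
    and above: "AE \<omega> in P. \<forall>t\<ge>0. ennreal t \<le> \<tau> \<omega> \<longrightarrow> l \<le> Y t \<omega>"
  shows "(\<integral>\<^sup>+\<omega>. ennreal (stopped_expmart \<tau> u \<omega>) \<partial>P) = ennreal (exp (- u * (x - \<mu>) - u^2 * vol))"
proof -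
  define m where "m = \<bar>l - \<mu>\<bar>"
  \<comment> \<open>With \<open>w = u * exp (\<theta> * t)\<close>, this bounds the martingale at
    time \<open>t\<close> as long as \<open>Y\<close> is at least \<open>l\<close>. It never exceeds
    \<open>C\<close>, which gives domination, and tends to 0 as \<open>w\<close> grows, which
    matches the value 0 assigned to the event of never stopping.\<close>
  define q where "q w = exp (m * w - vol * w^2)" for w
  define C where "C = exp (m^2 / (4 * vol))"
  have qC: "q w \<le> C" for w
  proof -
    have "m^2 / (4 * vol) - (m * w - vol * w^2) = vol * (w - m / (2 * vol))^2"
      using vol_pos by (simp add: field_simps power2_eq_square)
    also have "\<dots> \<ge> 0" using vol_pos by simp
    finally show ?thesis by (simp add: q_def C_def)
  qed
  have bound: "expmart u t \<omega> \<le> q (u * exp (\<theta> * t))" if "l \<le> Y t \<omega>" for t \<omega>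
  proof -
    have "- (u * exp (\<theta> * t)) * (Y t \<omega> - \<mu>) \<le> - (u * exp (\<theta> * t)) * (l - \<mu>)"
      using that u by (intro mult_left_mono_neg) auto
    also have "\<dots> = (u * exp (\<theta> * t)) * (- (l - \<mu>))" by (rule minus_mult_commute)
    also have "\<dots> \<le> (u * exp (\<theta> * t)) * m"
      using u by (intro mult_left_mono) (auto simp: m_def)
    finally show ?thesis unfolding expmart_def q_def
      by (simp add: power_mult_distrib exp_double[symmetric] algebra_simps)
  qed
  have q0: "(\<lambda>N. q (u * exp (\<theta> * real N))) \<longlonglongrightarrow> 0"
    unfolding q_def using u \<theta> vol_pos by real_asymp
  have above': "AE \<omega> in P. \<forall>N. l \<le> Y (truncate \<tau> N \<omega>) \<omega>"
    using above
  proof eventually_elim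
    case (elim \<omega>)
    have "ennreal (truncate \<tau> N \<omega>) \<le> \<tau> \<omega>" "truncate \<tau> N \<omega> \<ge> 0" for N
      by (cases "\<tau> \<omega>"; auto simp: truncate_def min_def)+
    thus ?case using elim by blast
  qed
  note [measurable] = expmart_bounded_stopping_measurable[OF truncate_bounded_stopping[OF \<tau>]]
     stopped_Y_measurable[OF \<tau>] stopping_time_measurable[OF \<tau>]
  have meas: "stopped_expmart \<tau> u \<in> borel_measurable P"
  proof -
    have "stopped_expmart \<tau> u = (\<lambda>\<omega>. if \<tau> \<omega> = \<infinity> then 0 else
       exp (- u * (exp (\<theta> * enn2real (\<tau> \<omega>)) * ((if \<tau> \<omega> = \<infinity> then 0 else Y (enn2real (\<tau> \<omega>)) \<omega>) - \<mu>))
         - u^2 * vol * exp (2 * \<theta> * enn2real (\<tau> \<omega>))))"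
      by (auto simp: stopped_expmart_def expmart_def)
    also have "\<dots> \<in> borel_measurable P" by measurable
    finally show ?thesis .
  qed
  have "(\<lambda>N. \<integral>\<^sup>+\<omega>. ennreal (expmart u (truncate \<tau> N \<omega>) \<omega>) \<partial>P) \<longlonglongrightarrow> (\<integral>\<^sup>+\<omega>. ennreal (stopped_expmart \<tau> u \<omega>) \<partial>P)"
  proof (rule nn_integral_dominated_convergence[where w = "\<lambda>_. ennreal C"])
    show "AE \<omega> in P. ennreal (expmart u (truncate \<tau> N \<omega>) \<omega>) \<le> ennreal C" for N
      using above' by eventually_elim (intro ennreal_leI order_trans[OF bound qC], simp)
    show "AE \<omega> in P. (\<lambda>N. ennreal (expmart u (truncate \<tau> N \<omega>) \<omega>)) \<longlonglongrightarrow> ennreal (stopped_expmart \<tau> u \<omega>)"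
      using above'
    proof eventually_elim
      case (elim \<omega>)
      show ?case
      proof (cases "\<tau> \<omega> = \<infinity>")
        case True
        have "(\<lambda>N. expmart u (real N) \<omega>) \<longlonglongrightarrow> 0"
        proof (rule real_tendsto_sandwich[OF _ _ tendsto_const q0])
          show "\<forall>\<^sub>F N in sequentially. expmart u (real N) \<omega> \<le> q (u * exp (\<theta> * real N))"
            using elim True by (intro always_eventually allI bound) (simp add: truncate_def)
        qed (simp add: expmart_def)
        thus ?thesis using True by (simp add: truncate_def stopped_expmart_def ennreal_tendsto_0_iff expmart_pos less_imp_le)
      next
        case False
        have "\<forall>\<^sub>F N in sequentially. ennreal (expmart u (truncate \<tau> N \<omega>) \<omega>) = ennreal (stopped_expmart \<tau> u \<omega>)"
          using truncate_eventually[of \<tau> \<omega>, OF False] by eventually_elim (use False in \<open>simp add: stopped_expmart_def\<close>)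
        thus ?thesis by (rule tendsto_eventually)
      qed
    qed
  qed (use meas in \<open>auto simp: emeasure_space_1\<close>)
  thus ?thesis
    by (simp add: optional_stopping_bounded[OF truncate_bounded_stopping[OF \<tau>]] LIMSEQ_const_iff)
qed

end

subsection \<open>Hitting times and the cost of threshold rules\<close>

lemma nn_integral_gauss_moment:
  assumes "b > 0" "p > -1"
  shows "(\<integral>\<^sup>+v. ennreal (indicator {0<..} v * (v powr p * exp (- y * v - b * v^2))) \<partial>lborel)
     = ennreal (gauss_moment b p y)"
proof -
  have "integrable lborel (\<lambda>v. indicator {0<..} v * (v powr p * exp (- y * v - b * v^2)))"
    using gauss_moment_integrable[OF assms, of y] unfolding set_integrable_def real_scaleR_def .
  hence "(\<integral>\<^sup>+v. ennreal (indicator {0<..} v * (v powr p * exp (- y * v - b * v^2))) \<partial>lborel)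
     = ennreal (LINT v|lborel. indicator {0<..} v * (v powr p * exp (- y * v - b * v^2)))"
    by (rule nn_integral_eq_integral) simp
  thus ?thesis unfolding gauss_moment_def set_lebesgue_integral_def real_scaleR_def .
qed

text \<open>Substitution of \<open>v = k * u\<close>. For \<open>k = exp (\<theta> * t)\<close> and
  \<open>a = \<rho> / \<theta>\<close> the factor \<open>k powr (- a)\<close> is the discount
  \<open>exp (- \<rho> * t)\<close>.\<close>

lemma nn_integral_gauss_moment_scaled:
  assumes b: "b > 0" and a: "a > 0" and k: "k > 0"
  shows "(\<integral>\<^sup>+u. ennreal (indicator {0<..} u * (u powr (a - 1) * exp (- y * (k * u) - b * (k * u)^2))) \<partial>lborel)
     = ennreal (k powr (- a) * gauss_moment b (a - 1) y)"
proof -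
  let ?f = "\<lambda>v. indicator {0<..} v * (v powr (a - 1) * exp (- y * v - b * v^2)) :: real"
  let ?g = "\<lambda>u. indicator {0<..} u * (u powr (a - 1) * exp (- y * (k * u) - b * (k * u)^2)) :: real"
  have g: "?f (0 + k * u) = k powr (a - 1) * ?g u" for u
    using k by (cases "u > 0") (auto simp: powr_mult zero_less_mult_iff)
  have "ennreal (gauss_moment b (a - 1) y) = (\<integral>\<^sup>+v. ennreal (?f v) \<partial>lborel)"
    using nn_integral_gauss_moment[OF b, of "a - 1" y] a by simp
  also have "\<dots> = ennreal \<bar>k\<bar> * (\<integral>\<^sup>+u. ennreal (?f (0 + k * u)) \<partial>lborel)"
    by (rule nn_integral_real_affine) (use k in auto)
  also have "\<dots> = ennreal k * (ennreal (k powr (a - 1)) * (\<integral>\<^sup>+u. ennreal (?g u) \<partial>lborel))"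
    unfolding g using k by (subst nn_integral_cmult[symmetric]) (auto simp: ennreal_mult' indicator_def)
  also have "\<dots> = ennreal (k powr a) * (\<integral>\<^sup>+u. ennreal (?g u) \<partial>lborel)"
    using k by (simp add: mult.assoc[symmetric] ennreal_mult'[symmetric] powr_diff)
  finally have "ennreal (k powr (- a)) * ennreal (gauss_moment b (a - 1) y)
      = ennreal (k powr (- a)) * (ennreal (k powr a) * (\<integral>\<^sup>+u. ennreal (?g u) \<partial>lborel))" by simp
  also have "\<dots> = (\<integral>\<^sup>+u. ennreal (?g u) \<partial>lborel)"
  proof -
    have "ennreal (k powr (- a)) * ennreal (k powr a) = 1"
      using k by (simp add: ennreal_mult'[symmetric] powr_add[symmetric])
    thus ?thesis by (simp only: mult.assoc[symmetric] mult_1)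
  qed
  finally have "(\<integral>\<^sup>+u. ennreal (?g u) \<partial>lborel) = ennreal (k powr (- a)) * ennreal (gauss_moment b (a - 1) y)" ..
  also have "\<dots> = ennreal (k powr (- a) * gauss_moment b (a - 1) y)" by (rule ennreal_mult'[symmetric]) simp
  finally show ?thesis .
qed

lemma ou_phi_measurable:
  assumes "\<theta> > 0" "\<sigma> > 0" "\<rho> > 0"
  shows "ou_phi \<theta> \<mu> \<sigma> \<rho> \<in> borel_measurable borel"
proof (rule borel_measurable_continuous_onI)
  have "C2 (ou_phi \<theta> \<mu> \<sigma> \<rho>)"
    using ou_phi_fundamental[OF assms] by (simp add: decreasing_fundamental_solution_def)
  from C2_deriv(1)[OF this] show "continuous_on UNIV (ou_phi \<theta> \<mu> \<sigma> \<rho>)"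
    by (intro DERIV_continuous_on) (auto simp: has_field_derivative_at_within)
qed

lemma ou_phi_pos: "\<theta> > 0 \<Longrightarrow> \<sigma> > 0 \<Longrightarrow> \<rho> > 0 \<Longrightarrow> ou_phi \<theta> \<mu> \<sigma> \<rho> y > 0"
  using ou_phi_fundamental by (simp add: decreasing_fundamental_solution_def)

lemma first_time_below_le: "0 \<le> t \<Longrightarrow> Y t \<omega> \<le> l \<Longrightarrow> first_time_below Y l \<omega> \<le> ennreal t"
  unfolding first_time_below_def by (rule Inf_lower) blast

lemma first_time_below_attained:
  assumes c: "continuous_on {0..} (\<lambda>t. Y t \<omega>)" and fin: "first_time_below Y l \<omega> \<noteq> \<infinity>"
  obtains a where "a \<ge> 0" "first_time_below Y l \<omega> = ennreal a" "Y a \<omega> \<le> l"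
    "\<And>t. 0 \<le> t \<Longrightarrow> t < a \<Longrightarrow> l < Y t \<omega>"
proof -
  define S where "S = {t \<in> {0..}. Y t \<omega> \<le> l}"
  have "S \<noteq> {}"
  proof
    assume "S = {}"
    hence e: "{ennreal t |t. 0 \<le> t \<and> Y t \<omega> \<le> l} = {}" by (auto simp: S_def)
    show False using fin unfolding first_time_below_def e by simp
  qed
  moreover have "closed S" unfolding S_def
    by (rule continuous_on_closed_Collect_le[OF c]) auto
  moreover have bdd: "bdd_below S" by (auto simp: S_def bdd_below_def)
  ultimately have aS: "Inf S \<in> S" by (intro closed_contains_Inf)
  have a: "Inf S \<ge> 0" "Y (Inf S) \<omega> \<le> l" using aS by (auto simp: S_def)
  have low: "Inf S \<le> t" if "0 \<le> t" "Y t \<omega> \<le> l" for t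
    using that by (intro cInf_lower bdd) (auto simp: S_def)
  have "first_time_below Y l \<omega> = ennreal (Inf S)"
    unfolding first_time_below_def
  proof (rule Inf_eqI)
    show "ennreal (Inf S) \<le> y" if "y \<in> {ennreal t |t. 0 \<le> t \<and> Y t \<omega> \<le> l}" for y
      using that low by (auto intro: ennreal_leI)
    show "y \<le> ennreal (Inf S)" if "\<And>u. u \<in> {ennreal t |t. 0 \<le> t \<and> Y t \<omega> \<le> l} \<Longrightarrow> y \<le> u" for y
      using that a by blast
  qed
  moreover have "l < Y t \<omega>" if "0 \<le> t" "t < Inf S" for t
    using low[OF that(1)] that(2) by linarith
  ultimately show ?thesis using that a by blast
qed

text \<open>Continuity excludes an undershoot: a path starting above \<open>l\<close> takes the
  value \<open>l\<close> no later than it goes below.\<close>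

lemma first_time_below_level:
  assumes c: "continuous_on {0..} (\<lambda>t. Y t \<omega>)" and fin: "first_time_below Y l \<omega> \<noteq> \<infinity>" and 0: "l < Y 0 \<omega>"
  shows "Y (enn2real (first_time_below Y l \<omega>)) \<omega> = l"
proof -
  obtain a where a: "a \<ge> 0" "first_time_below Y l \<omega> = ennreal a" "Y a \<omega> \<le> l"
    "\<And>t. 0 \<le> t \<Longrightarrow> t < a \<Longrightarrow> l < Y t \<omega>" by (rule first_time_below_attained[of Y \<omega> l, OF c fin]) blast
  have "continuous_on {0..a} (\<lambda>t. Y t \<omega>)" by (rule continuous_on_subset[OF c]) auto
  then obtain t where "0 \<le> t" "t \<le> a" "Y t \<omega> = l"
    using IVT2'[of "\<lambda>t. Y t \<omega>" a l 0] a 0 by auto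
  thus ?thesis using a by (metis enn2real_ennreal less_irrefl order_le_less)
qed

text \<open>By completeness \<open>f\<close> inherits measurability from \<open>g\<close>. Thus
  costs with an arbitrary payoff can be evaluated once the stopped position is almost surely
  known.\<close>

lemma (in brownian_motion) integral_cong_AE_right:
  fixes f g :: "'a \<Rightarrow> real"
  assumes g: "g \<in> borel_measurable P" and eq: "AE \<omega> in P. f \<omega> = g \<omega>"
  shows "integral\<^sup>L P f = integral\<^sup>L P g"
proof (rule integral_cong_AE)
  have "AE \<omega> in P. g \<omega> = f \<omega>" using eq by eventually_elim simp
  thus "f \<in> borel_measurable P" by (rule measurable_AE[OF g]) simp
qed (use assms in auto)

context ornstein_uhlenbeck
begin

text \<open>On a continuous path, reaching the level by time \<open>r\<close> means coming within
  \<open>1 / (n + 1)\<close> above it, or below it, at one of countably many times for every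
  \<open>n\<close>. The remaining paths contribute null sets, which the augmented filtration
  contains.\<close>

lemma stopping_time_first_time_below: "stopping_time F (first_time_below Y l)"
  unfolding stopping_time_def
proof
  fix t :: ennreal
  show "Measurable.pred (F t) (\<lambda>\<omega>. first_time_below Y l \<omega> \<le> t)"
  proof (cases t)
    case (real r)
    \<comment> \<open>Rational times are sought to the right of the hitting time \<open>a\<close>,
      which leaves no room if \<open>a = r\<close>; hence the extra point \<open>r\<close>.\<close>
    define D where "D = (\<rat> \<inter> {0..r}) \<union> {r}"
    have cD: "countable D" unfolding D_def by (intro countable_Un countable_Int1 countable_rat) auto
    have D0: "0 \<le> q" "q \<le> r" if "q \<in> D" for q using that real by (auto simp: D_def)
    define E where "E = {\<omega> \<in> space P. \<forall>n::nat. \<exists>q\<in>D. Y q \<omega> < l + inverse (real (Suc n))}"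
    have E: "E \<in> sets (F t)"
    proof -
      have [measurable]: "Y q \<in> borel_measurable (F t)" if "q \<in> D" for q
        using filtration_measurable_mono[OF Y_adapted[OF D0(1)[OF that]], of t] D0(2)[OF that] real
        by (auto intro: ennreal_leI)
      have "E = {\<omega> \<in> space (F t). \<forall>n::nat. \<exists>q\<in>D. Y q \<omega> < l + inverse (real (Suc n))}"
        by (simp add: E_def)
      also have "\<dots> \<in> sets (F t)"
        by (intro sets.sets_Collect_countable_All sets.sets_Collect_countable_Ex' cD) measurable
      finally show ?thesis .
    qed
    define A where "A = {\<omega> \<in> space P. first_time_below Y l \<omega> \<le> t}"
    have AE: "AE \<omega> in P. \<omega> \<in> A \<longleftrightarrow> \<omega> \<in> E"
    proof (rule AE_mp[OF Y_continuous], intro AE_I2 impI)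
      fix \<omega> assume \<omega>: "\<omega> \<in> space P" and c: "continuous_on {0..} (\<lambda>t. Y t \<omega>)"
      have "first_time_below Y l \<omega> \<le> t \<longleftrightarrow> (\<forall>n::nat. \<exists>q\<in>D. Y q \<omega> < l + inverse (real (Suc n)))"
      proof
        assume le: "first_time_below Y l \<omega> \<le> t"
        hence "first_time_below Y l \<omega> \<noteq> \<infinity>" using real by (auto simp: top_unique)
        then obtain a where a: "a \<ge> 0" "first_time_below Y l \<omega> = ennreal a" "Y a \<omega> \<le> l"
          by (rule first_time_below_attained[of Y \<omega> l, OF c])
        have ar: "a \<le> r" using le real a by simp
        show "\<forall>n::nat. \<exists>q\<in>D. Y q \<omega> < l + inverse (real (Suc n))"
        proof
          fix n :: nat
          show "\<exists>q\<in>D. Y q \<omega> < l + inverse (real (Suc n))"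
          proof (cases "a = r")
            case True
            have "l < l + inverse (real (Suc n))" by simp
            thus ?thesis using a(3) True by (intro bexI[of _ r] le_less_trans[OF a(3)[unfolded True]]) (auto simp: D_def)
          next
            case False
            obtain d where d: "d > 0" "\<And>q. q \<in> {0..} \<Longrightarrow> dist q a < d \<Longrightarrow> dist (Y q \<omega>) (Y a \<omega>) < inverse (real (Suc n))"
              using c[unfolded continuous_on_iff, rule_format, of a "inverse (real (Suc n))"] a(1) by auto
            obtain q where q: "q \<in> \<rat>" "a < q" "q < min (a + d) r"
              using Rats_dense_in_real[of a "min (a + d) r"] d(1) ar False by auto
            have "dist (Y q \<omega>) (Y a \<omega>) < inverse (real (Suc n))"
              using q a(1) by (intro d(2)) (auto simp: dist_real_def)
            hence "Y q \<omega> < l + inverse (real (Suc n))" using a(3) by (simp add: dist_real_def)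
            moreover have "q \<in> D" using q a(1) by (auto simp: D_def)
            ultimately show ?thesis by blast
          qed
        qed
      next
        assume ex: "\<forall>n::nat. \<exists>q\<in>D. Y q \<omega> < l + inverse (real (Suc n))"
        have "continuous_on {0..r} (\<lambda>t. Y t \<omega>)" by (rule continuous_on_subset[OF c]) auto
        then obtain m where m: "m \<in> {0..r}" "\<And>s. s \<in> {0..r} \<Longrightarrow> Y m \<omega> \<le> Y s \<omega>"
          using continuous_attains_inf[of "{0..r}" "\<lambda>t. Y t \<omega>"] real by auto
        have "Y m \<omega> \<le> l + inverse (real (Suc n))" for n
        proof -
          obtain q where "q \<in> D" "Y q \<omega> < l + inverse (real (Suc n))" using ex by blast
          thus ?thesis using m(2)[of q] D0[of q] by auto
        qed
        moreover have "(\<lambda>n. l + inverse (real (Suc n))) \<longlonglongrightarrow> l"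
          using tendsto_add[OF tendsto_const LIMSEQ_inverse_real_of_nat] by simp
        ultimately have "Y m \<omega> \<le> l" by (intro LIMSEQ_le_const) auto
        hence "first_time_below Y l \<omega> \<le> ennreal m" using m(1) by (intro first_time_below_le) auto
        also have "\<dots> \<le> t" using m(1) real by (auto intro: ennreal_leI)
        finally show "first_time_below Y l \<omega> \<le> t" .
      qed
      thus "\<omega> \<in> A \<longleftrightarrow> \<omega> \<in> E" using \<omega> by (simp add: A_def E_def)
    qed
    have sub: "A \<subseteq> space P" "E \<subseteq> space P" by (auto simp: A_def E_def)
    have "AE \<omega> in P. \<omega> \<notin> A - E" "AE \<omega> in P. \<omega> \<notin> E - A"
      using AE by (eventually_elim, blast)+
    hence "A - E \<in> null_sets P" "E - A \<in> null_sets P"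
      using sub by (auto intro: null_subset)
    hence "A - E \<in> sets (F t)" "E - A \<in> sets (F t)" by (auto intro: null_sets_filtration)
    moreover have "A = (E - (E - A)) \<union> (A - E)" by auto
    ultimately have "A \<in> sets (F t)" using E by (metis sets.Diff sets.Un)
    thus ?thesis by (simp add: A_def pred_def)
  qed (simp add: top_unique)
qed

section \<open>Mixing the exponential martingales over \<open>u\<close>, and the resulting
  costs\<close>

context
  fixes \<rho> :: real
  assumes \<rho>: "\<rho> > 0"
begin

abbreviation "\<phi> \<equiv> ou_phi \<theta> \<mu> \<sigma> \<rho>"

definition weight :: "real \<Rightarrow> real" where "weight u = indicator {0<..} u * u powr (\<rho> / \<theta> - 1)"

lemma weight_nonneg: "weight u \<ge> 0" by (simp add: weight_def)

lemma weight_measurable [measurable]: "weight \<in> borel_measurable borel"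
  unfolding weight_def by measurable

lemma weighted_initial: "(\<integral>\<^sup>+u. ennreal (weight u * exp (- u * (x - \<mu>) - u^2 * vol)) \<partial>lborel) = ennreal (\<phi> x)"
proof -
  have e: "weight u * exp (- u * (x - \<mu>) - u^2 * vol)
      = indicator {0<..} u * (u powr (\<rho> / \<theta> - 1) * exp (- (x - \<mu>) * (1 * u) - vol * (1 * u)^2))" for u
    by (simp add: weight_def algebra_simps)
  have "\<rho> / \<theta> > 0" using \<rho> \<theta> by simp
  from nn_integral_gauss_moment_scaled[OF vol_pos this zero_less_one, of "x - \<mu>"]
  show ?thesis unfolding e by (simp only: powr_one_eq_one mult_1 ou_phi_def vol_def)
qed

lemma weighted_expmart:
  "(\<integral>\<^sup>+u. ennreal (weight u * expmart u t \<omega>) \<partial>lborel) = ennreal (exp (- \<rho> * t) * \<phi> (Y t \<omega>))"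
proof -
  have e: "exp (- u * (exp (\<theta> * t) * (Y t \<omega> - \<mu>)) - u^2 * vol * exp (2 * \<theta> * t))
      = exp (- (Y t \<omega> - \<mu>) * (exp (\<theta> * t) * u) - vol * (exp (\<theta> * t) * u)^2)" for u
  proof -
    have "exp (2 * \<theta> * t) = exp (\<theta> * t) ^ 2" by (simp add: exp_double[symmetric] mult.assoc)
    thus ?thesis by (simp add: power_mult_distrib algebra_simps)
  qed
  have "exp (\<theta> * t) powr - (\<rho> / \<theta>) = exp (- \<rho> * t)" using \<theta> by (simp add: powr_def)
  thus ?thesis
    using nn_integral_gauss_moment_scaled[OF vol_pos, of "\<rho> / \<theta>" "exp (\<theta> * t)" "Y t \<omega> - \<mu>"] \<rho> \<theta>
    unfolding expmart_def e by (simp add: weight_def ou_phi_def vol_def mult.assoc)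
qed

lemma nn_integral_discounted_phi:
  assumes \<tau>: "stopping_time F \<tau>"
  shows "(\<integral>\<^sup>+\<omega>. ennreal (if \<tau> \<omega> = \<infinity> then 0 else exp (- \<rho> * enn2real (\<tau> \<omega>)) * \<phi> (Y (enn2real (\<tau> \<omega>)) \<omega>)) \<partial>P)
    = (\<integral>\<^sup>+u. ennreal (weight u) * (\<integral>\<^sup>+\<omega>. ennreal (stopped_expmart \<tau> u \<omega>) \<partial>P) \<partial>lborel)"
proof -
  interpret pair_sigma_finite P lborel ..
  note [measurable] = stopped_Y_measurable[OF \<tau>] stopping_time_measurable[OF \<tau>]
  \<comment> \<open>The stopped position, not the process \<open>Z t\<close> of the overview. It
    does not depend on \<open>u\<close>, so the stopped martingale becomes an explicit function of
    \<open>u\<close>, \<tau> and \<open>Z\<close>, and joint measurability for Tonelli is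
    evident.\<close>
  define Z where "Z \<omega> = (if \<tau> \<omega> = \<infinity> then 0 else Y (enn2real (\<tau> \<omega>)) \<omega>)" for \<omega>
  have [measurable]: "Z \<in> borel_measurable P" unfolding Z_def by measurable
  have S: "stopped_expmart \<tau> u \<omega> = (if \<tau> \<omega> = \<infinity> then 0 else
       exp (- u * (exp (\<theta> * enn2real (\<tau> \<omega>)) * (Z \<omega> - \<mu>)) - u^2 * vol * exp (2 * \<theta> * enn2real (\<tau> \<omega>))))" for u \<omega>
    by (auto simp: stopped_expmart_def expmart_def Z_def)
  have m2: "(\<lambda>(\<omega>, u). ennreal (weight u * stopped_expmart \<tau> u \<omega>)) \<in> borel_measurable (P \<Otimes>\<^sub>M lborel)"
    unfolding S by measurable
  have m1: "stopped_expmart \<tau> u \<in> borel_measurable P" for u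
    unfolding S by measurable
  have "(\<integral>\<^sup>+\<omega>. ennreal (if \<tau> \<omega> = \<infinity> then 0 else exp (- \<rho> * enn2real (\<tau> \<omega>)) * \<phi> (Y (enn2real (\<tau> \<omega>)) \<omega>)) \<partial>P)
     = (\<integral>\<^sup>+\<omega>. \<integral>\<^sup>+u. ennreal (weight u * stopped_expmart \<tau> u \<omega>) \<partial>lborel \<partial>P)"
    by (intro nn_integral_cong) (simp add: stopped_expmart_def weighted_expmart)
  also have "\<dots> = (\<integral>\<^sup>+u. \<integral>\<^sup>+\<omega>. ennreal (weight u * stopped_expmart \<tau> u \<omega>) \<partial>P \<partial>lborel)"
    by (rule Fubini'[symmetric, OF m2])
  also have "\<dots> = (\<integral>\<^sup>+u. ennreal (weight u) * (\<integral>\<^sup>+\<omega>. ennreal (stopped_expmart \<tau> u \<omega>) \<partial>P) \<partial>lborel)"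
    using m1 by (simp add: ennreal_mult' weight_nonneg nn_integral_cmult)
  finally show ?thesis .
qed

lemma discounted_phi_le:
  assumes \<tau>: "stopping_time F \<tau>"
  shows "(\<integral>\<^sup>+\<omega>. ennreal (if \<tau> \<omega> = \<infinity> then 0 else exp (- \<rho> * enn2real (\<tau> \<omega>)) * \<phi> (Y (enn2real (\<tau> \<omega>)) \<omega>)) \<partial>P)
    \<le> ennreal (\<phi> x)"
proof -
  have "(\<integral>\<^sup>+u. ennreal (weight u) * (\<integral>\<^sup>+\<omega>. ennreal (stopped_expmart \<tau> u \<omega>) \<partial>P) \<partial>lborel)
     \<le> (\<integral>\<^sup>+u. ennreal (weight u) * ennreal (exp (- u * (x - \<mu>) - u^2 * vol)) \<partial>lborel)"
    by (intro nn_integral_mono mult_left_mono stopped_expmart_le \<tau>) auto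
  also have "\<dots> = ennreal (\<phi> x)"
    unfolding weighted_initial[symmetric] by (intro nn_integral_cong) (simp add: ennreal_mult' weight_nonneg)
  finally show ?thesis unfolding nn_integral_discounted_phi[OF \<tau>] .
qed

text \<open>Only the positive part of \<open>- f\<close> is estimated, which covers stopping costs
  that fail to be integrable: their Bochner integral is 0, still above the nonpositive
  bound.\<close>

lemma stopping_cost_lower_bound:
  assumes \<tau>: "stopping_time F \<tau>" and K: "K \<ge> 0" and G: "\<And>y. - K * (1 + \<phi> y) \<le> G y"
  shows "- K * (1 + \<phi> x) \<le> stopping_cost P \<rho> Y G \<tau>"
proof -
  note [measurable] = stopped_Y_measurable[OF \<tau>] stopping_time_measurable[OF \<tau>] ou_phi_measurable[OF \<theta> \<sigma> \<rho>]
  define f where "f \<omega> = (if \<tau> \<omega> = \<infinity> then 0 else exp (- \<rho> * enn2real (\<tau> \<omega>)) * G (Y (enn2real (\<tau> \<omega>)) \<omega>))" for \<omega>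
  define h where "h \<omega> = (if \<tau> \<omega> = \<infinity> then 0 else exp (- \<rho> * enn2real (\<tau> \<omega>)) * \<phi> (Y (enn2real (\<tau> \<omega>)) \<omega>))" for \<omega>
  have "h = (\<lambda>\<omega>. if \<tau> \<omega> = \<infinity> then 0 else exp (- \<rho> * enn2real (\<tau> \<omega>)) *
       \<phi> (if \<tau> \<omega> = \<infinity> then 0 else Y (enn2real (\<tau> \<omega>)) \<omega>))" by (auto simp: h_def)
  also have "\<dots> \<in> borel_measurable P" by measurable
  finally have hm: "h \<in> borel_measurable P" .
  have h0: "h \<omega> \<ge> 0" for \<omega> using ou_phi_pos[OF \<theta> \<sigma> \<rho>] by (auto simp: h_def less_imp_le)
  have "- f \<omega> \<le> K * (1 + h \<omega>)" for \<omega>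
  proof (cases "\<tau> \<omega> = \<infinity>")
    case False
    let ?e = "exp (- \<rho> * enn2real (\<tau> \<omega>))" and ?y = "Y (enn2real (\<tau> \<omega>)) \<omega>"
    have "?e \<le> 1" using \<rho> by simp
    have "- G ?y \<le> K * (1 + \<phi> ?y)" using G[of ?y] by simp
    hence "?e * - G ?y \<le> ?e * (K * (1 + \<phi> ?y))" by (intro mult_left_mono) auto
    also have "\<dots> = K * (?e + h \<omega>)" using False by (simp add: h_def algebra_simps)
    also have "\<dots> \<le> K * (1 + h \<omega>)" using K \<open>?e \<le> 1\<close> by (intro mult_left_mono) auto
    finally show ?thesis using False by (simp add: f_def)
  qed (use K in \<open>simp add: f_def h_def\<close>)
  hence "(\<integral>\<^sup>+\<omega>. ennreal (- f \<omega>) \<partial>P) \<le> (\<integral>\<^sup>+\<omega>. ennreal K * (1 + ennreal (h \<omega>)) \<partial>P)"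
    using K h0 by (intro nn_integral_mono)
      (simp add: ennreal_1[symmetric] ennreal_plus[symmetric] ennreal_mult'[symmetric] ennreal_leI del: ennreal_1 ennreal_plus)
  also have "\<dots> = ennreal K * (1 + (\<integral>\<^sup>+\<omega>. ennreal (h \<omega>) \<partial>P))"
    using hm by (simp add: nn_integral_cmult nn_integral_add emeasure_space_1)
  also have "\<dots> \<le> ennreal K * (1 + ennreal (\<phi> x))"
    unfolding h_def by (intro mult_left_mono add_left_mono discounted_phi_le \<tau>) auto
  also have "\<dots> = ennreal (K * (1 + \<phi> x))"
    using K ou_phi_pos[OF \<theta> \<sigma> \<rho>, of \<mu> x] by (simp add: ennreal_mult' ennreal_plus)
  finally have "(LINT \<omega>|P. - f \<omega>) \<le> K * (1 + \<phi> x)"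
    using K ou_phi_pos[OF \<theta> \<sigma> \<rho>, of \<mu> x] by (intro integral_real_bounded) auto
  thus ?thesis unfolding stopping_cost_def f_def[symmetric] by simp
qed

text \<open>Where stopping occurs the position is \<open>l\<close>, so the discounted \<phi> equals
  \<open>\<phi> l\<close> times the discount factor; its mean is \<open>\<phi> x\<close> because
  nothing is lost at infinity. So the hitting time has Laplace transform
  \<open>\<phi> x / \<phi> l\<close>. A start at or below \<open>l\<close> means stopping at
  once.\<close>

lemma stopping_cost_first_time_below:
  "stopping_cost P \<rho> Y G (first_time_below Y l) = (if x > l then G l * (\<phi> x / \<phi> l) else G x)"
proof (cases "x > l")
  case True
  let ?\<tau> = "first_time_below Y l"
  note \<tau> = stopping_time_first_time_below[of l]
  note [measurable] = stopping_time_measurable[OF \<tau>]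
  define d where "d \<omega> = (if ?\<tau> \<omega> = \<infinity> then 0 else exp (- \<rho> * enn2real (?\<tau> \<omega>)))" for \<omega>
  have [measurable]: "d \<in> borel_measurable P" unfolding d_def by measurable
  have pos: "\<phi> l > 0" "\<phi> x > 0" using ou_phi_pos[OF \<theta> \<sigma> \<rho>] by auto
  have level: "AE \<omega> in P. ?\<tau> \<omega> \<noteq> \<infinity> \<longrightarrow> Y (enn2real (?\<tau> \<omega>)) \<omega> = l"
    using Y_continuous Y_0 by eventually_elim (use True first_time_below_level in auto)
  \<comment> \<open>Including the hitting time itself: a value below \<open>l\<close> at a time up
    to \<tau> would force that time to equal \<tau>, where the path is at \<open>l\<close>.\<close>
  have above: "AE \<omega> in P. \<forall>t\<ge>0. ennreal t \<le> ?\<tau> \<omega> \<longrightarrow> l \<le> Y t \<omega>"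
    using level
  proof eventually_elim
    case (elim \<omega>)
    show ?case
    proof (intro allI impI)
      fix t :: real assume t: "0 \<le> t" "ennreal t \<le> ?\<tau> \<omega>"
      show "l \<le> Y t \<omega>"
      proof (rule ccontr)
        assume n: "\<not> l \<le> Y t \<omega>"
        hence "?\<tau> \<omega> \<le> ennreal t" using t by (intro first_time_below_le) auto
        hence "?\<tau> \<omega> = ennreal t" using t by simp
        thus False using elim t n by simp
      qed
    qed
  qed
  have "ennreal (\<phi> l) * (\<integral>\<^sup>+\<omega>. ennreal (d \<omega>) \<partial>P) = (\<integral>\<^sup>+\<omega>. ennreal (\<phi> l) * ennreal (d \<omega>) \<partial>P)"
    by (rule nn_integral_cmult[symmetric]) measurable
  also have "\<dots> = (\<integral>\<^sup>+\<omega>. ennreal (if ?\<tau> \<omega> = \<infinity> then 0 else exp (- \<rho> * enn2real (?\<tau> \<omega>)) * \<phi> (Y (enn2real (?\<tau> \<omega>)) \<omega>)) \<partial>P)"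
    using level by (intro nn_integral_cong_AE, eventually_elim)
      (use pos in \<open>auto simp: d_def ennreal_mult''[symmetric] mult.commute\<close>)
  also have "\<dots> = (\<integral>\<^sup>+u. ennreal (weight u) * (\<integral>\<^sup>+\<omega>. ennreal (stopped_expmart ?\<tau> u \<omega>) \<partial>P) \<partial>lborel)"
    by (rule nn_integral_discounted_phi[OF \<tau>])
  also have "\<dots> = (\<integral>\<^sup>+u. ennreal (weight u * exp (- u * (x - \<mu>) - u^2 * vol)) \<partial>lborel)"
  proof (intro nn_integral_cong)
    fix u :: real
    show "ennreal (weight u) * (\<integral>\<^sup>+\<omega>. ennreal (stopped_expmart ?\<tau> u \<omega>) \<partial>P) = ennreal (weight u * exp (- u * (x - \<mu>) - u^2 * vol))"
      using stopped_expmart_eq[OF \<tau> _ above, of u]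
      by (cases "u > 0") (simp_all add: weight_def ennreal_mult'[symmetric] ennreal_mult''[symmetric])
  qed
  also have "\<dots> = ennreal (\<phi> x)" by (rule weighted_initial)
  finally have eq: "ennreal (\<phi> l) * (\<integral>\<^sup>+\<omega>. ennreal (d \<omega>) \<partial>P) = ennreal (\<phi> x)" .
  have "(\<integral>\<^sup>+\<omega>. ennreal (d \<omega>) \<partial>P) = ennreal (1 / \<phi> l) * (ennreal (\<phi> l) * (\<integral>\<^sup>+\<omega>. ennreal (d \<omega>) \<partial>P))"
    using pos by (simp add: mult.assoc[symmetric] ennreal_mult''[symmetric])
  also have "\<dots> = ennreal (\<phi> x / \<phi> l)" unfolding eq using pos by (simp add: ennreal_mult''[symmetric])
  finally have "integral\<^sup>L P d = \<phi> x / \<phi> l"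
    using pos by (subst integral_eq_nn_integral) (auto simp: d_def)
  moreover have "stopping_cost P \<rho> Y G ?\<tau> = (LINT \<omega>|P. G l * d \<omega>)"
    unfolding stopping_cost_def using level
    by (intro integral_cong_AE_right, measurable, eventually_elim) (auto simp: d_def)
  ultimately show ?thesis using True by simp
next
  case False
  have "AE \<omega> in P. (if first_time_below Y l \<omega> = \<infinity> then 0
      else exp (- \<rho> * enn2real (first_time_below Y l \<omega>)) * G (Y (enn2real (first_time_below Y l \<omega>)) \<omega>)) = G x"
    using Y_0
  proof eventually_elim
    case (elim \<omega>)
    have "first_time_below Y l \<omega> \<le> ennreal 0" using elim False by (intro first_time_below_le) auto
    thus ?case using elim by simp
  qed
  hence "stopping_cost P \<rho> Y G (first_time_below Y l) = (LINT \<omega>|P. G x)"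
    unfolding stopping_cost_def by (intro integral_cong_AE_right) auto
  thus ?thesis using False by (simp add: prob_space)
qed

end

end

subsection \<open>Smooth fit and uniqueness\<close>

text \<open>For \<open>y > l\<close>, start at \<open>y\<close>: stopping at once costs
  \<open>G y\<close>, no less than the optimal \<open>G l * (\<phi> y / \<phi> l)\<close>. For
  \<open>y < l\<close>, start at \<open>l\<close>: stopping at once is optimal, and waiting for
  \<open>y\<close> costs \<open>G y * (\<phi> l / \<phi> y)\<close>.\<close>

lemma threshold_minimizes_ratio:
  assumes P: "prob_space P" "complete_measure P" "standard_brownian_motion P B"
    and \<theta>: "\<theta> > 0" and \<sigma>: "\<sigma> > 0" and \<rho>: "\<rho> > 0"
    and X: "\<And>x. ou_strong_solution P B \<theta> \<mu> \<sigma> x (X x)"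
    and \<phi>: "decreasing_fundamental_solution \<theta> \<mu> \<sigma> \<rho> \<phi>"
    and K: "K \<ge> 0" and G: "\<And>y. - K * (1 + ou_phi \<theta> \<mu> \<sigma> \<rho> y) \<le> G y"
    and opt: "\<And>x. stopping_value P B \<rho> (X x) G = stopping_cost P \<rho> (X x) G (first_time_below (X x) l)"
  shows "stopping_value P B \<rho> (X x) G = (if x > l then G l * (\<phi> x / \<phi> l) else G x)"
    and "G l / \<phi> l \<le> G y / \<phi> y"
proof -
  have ou: "ornstein_uhlenbeck P B \<theta> \<mu> \<sigma> x (X x)" for x
    unfolding ornstein_uhlenbeck_def ornstein_uhlenbeck_axioms_def brownian_motion_def brownian_motion_axioms_def
    using P X \<theta> \<sigma> by blast
  have cost: "stopping_cost P \<rho> (X x) G (first_time_below (X x) l) = (if x > l then G l * (\<phi> x / \<phi> l) else G x)" for x l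
    using ornstein_uhlenbeck.stopping_cost_first_time_below[OF ou \<rho>, of x G l]
      decreasing_fundamental_solution_unique[OF \<phi> ou_phi_fundamental[OF \<theta> \<sigma> \<rho>] \<theta> \<sigma>, of x l] by simp
  have val: "stopping_value P B \<rho> (X x) G = (if x > l then G l * (\<phi> x / \<phi> l) else G x)" for x
    unfolding opt cost ..
  have le: "stopping_value P B \<rho> (X x) G \<le> (if x > l' then G l' * (\<phi> x / \<phi> l') else G x)" for x l'
    unfolding cost[symmetric] unfolding stopping_value_def
  proof (rule cINF_lower)
    show "bdd_below (stopping_cost P \<rho> (X x) G ` {\<tau>. stopping_time (brownian_filtration P B) \<tau>})"
      using ornstein_uhlenbeck.stopping_cost_lower_bound[OF ou \<rho> _ K G] by (intro bdd_belowI2) auto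
    show "first_time_below (X x) l' \<in> {\<tau>. stopping_time (brownian_filtration P B) \<tau>}"
      using ornstein_uhlenbeck.stopping_time_first_time_below[OF ou] by simp
  qed
  show "stopping_value P B \<rho> (X x) G = (if x > l then G l * (\<phi> x / \<phi> l) else G x)" by (rule val)
  have pos: "\<phi> y > 0" for y using \<phi> by (simp add: decreasing_fundamental_solution_def)
  consider "y > l" | "y = l" | "y < l" by linarith
  thus "G l / \<phi> l \<le> G y / \<phi> y"
  proof cases
    case 1
    thus ?thesis using le[of y y] val[of y] pos[of y] pos[of l] by (simp add: field_simps)
  next
    case 3
    thus ?thesis using le[of l y] val[of l] pos[of y] pos[of l] by (simp add: field_simps)
  qed simp
qed

text \<open>The exponential weight cancels the first-order terms, and the equation for \<phi> leaves
  only the defect of \<open>G\<close>. The formulation is pointwise because \<open>g\<close> may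
  fail to be differentiable at one point.\<close>

lemma weighted_wronskian_deriv:
  assumes \<phi>: "decreasing_fundamental_solution \<theta> \<mu> \<sigma> \<rho> \<phi>" and \<sigma>: "\<sigma> > 0"
    and G: "(G has_real_derivative g y) (at y)" and g: "(g has_real_derivative g') (at y)"
  shows "((\<lambda>y. (g y * \<phi> y - G y * deriv \<phi> y) * exp (- \<theta> * (y - \<mu>)^2 / \<sigma>^2)) has_real_derivative
     2 / \<sigma>^2 * exp (- \<theta> * (y - \<mu>)^2 / \<sigma>^2) * \<phi> y * (1/2 * \<sigma>^2 * g' + \<theta> * (\<mu> - y) * g y - \<rho> * G y)) (at y)"
proof -
  have C: "C2 \<phi>" using \<phi> by (simp add: decreasing_fundamental_solution_def)
  let ?p = "exp (- \<theta> * (y - \<mu>)^2 / \<sigma>^2)"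
  have p: "((\<lambda>y. exp (- \<theta> * (y - \<mu>)^2 / \<sigma>^2)) has_real_derivative ?p * (- \<theta> * (2 * (y - \<mu>)) / \<sigma>^2)) (at y)"
    using \<sigma> by (auto intro!: derivative_eq_intros simp: power2_eq_square)
  have "1/2 * \<sigma>^2 * deriv (deriv \<phi>) y = \<rho> * \<phi> y - \<theta> * (\<mu> - y) * deriv \<phi> y"
    using \<phi> by (auto simp: decreasing_fundamental_solution_def ou_generator_def algebra_simps)
  hence e: "deriv (deriv \<phi>) y = 2 / \<sigma>^2 * (\<rho> * \<phi> y - \<theta> * (\<mu> - y) * deriv \<phi> y)"
    using \<sigma> by (auto simp: field_simps)
  have s: "g' = 2 / \<sigma>^2 * (1/2 * \<sigma>^2 * g')" using \<sigma> by simp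
  have "(g' * \<phi> y + deriv \<phi> y * g y - (g y * deriv \<phi> y + deriv (deriv \<phi>) y * G y)) * ?p
      + ?p * (- \<theta> * (2 * (y - \<mu>)) / \<sigma>^2) * (g y * \<phi> y - G y * deriv \<phi> y)
     = 2 / \<sigma>^2 * ?p * \<phi> y * (1/2 * \<sigma>^2 * g' + \<theta> * (\<mu> - y) * g y - \<rho> * G y)"
  proof -
    have "(g' * \<phi> y + deriv \<phi> y * g y - (g y * deriv \<phi> y + deriv (deriv \<phi>) y * G y)) * ?p
      + ?p * (- \<theta> * (2 * (y - \<mu>)) / \<sigma>^2) * (g y * \<phi> y - G y * deriv \<phi> y)
     = ?p * (g' * \<phi> y - deriv (deriv \<phi>) y * G y + 2 / \<sigma>^2 * (\<theta> * (\<mu> - y) * (g y * \<phi> y - G y * deriv \<phi> y)))"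
      by (simp add: field_simps)
    also have "g' * \<phi> y - deriv (deriv \<phi>) y * G y + 2 / \<sigma>^2 * (\<theta> * (\<mu> - y) * (g y * \<phi> y - G y * deriv \<phi> y))
      = 2 / \<sigma>^2 * (1/2 * \<sigma>^2 * g') * \<phi> y - 2 / \<sigma>^2 * (\<rho> * \<phi> y - \<theta> * (\<mu> - y) * deriv \<phi> y) * G y
         + 2 / \<sigma>^2 * (\<theta> * (\<mu> - y) * (g y * \<phi> y - G y * deriv \<phi> y))"
      unfolding e using s by simp
    also have "\<dots> = 2 / \<sigma>^2 * (\<phi> y * (1/2 * \<sigma>^2 * g' + \<theta> * (\<mu> - y) * g y - \<rho> * G y))"
    proof -
      have "k * (1/2 * \<sigma>^2 * g') * \<phi> y - k * (\<rho> * \<phi> y - \<theta> * (\<mu> - y) * deriv \<phi> y) * G y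
         + k * (\<theta> * (\<mu> - y) * (g y * \<phi> y - G y * deriv \<phi> y))
         = k * (\<phi> y * (1/2 * \<sigma>^2 * g' + \<theta> * (\<mu> - y) * g y - \<rho> * G y))" for k
        by (simp add: algebra_simps)
      thus ?thesis .
    qed
    finally show ?thesis by (simp add: mult.assoc mult.left_commute)
  qed
  thus ?thesis
    using DERIV_mult[OF DERIV_diff[OF DERIV_mult[OF g C2_deriv(1)[OF C]] DERIV_mult[OF G C2_deriv(2)[OF C]]] p]
    by (simp add: mult.commute mult.left_commute add.commute)
qed

text \<open>Continuity bridges the point \<open>p\<close>, where the derivative may not exist; it is
  applied with \<open>p = \<gamma> c\<close>.\<close>

lemma strictly_increasing_across_point:
  fixes H :: "real \<Rightarrow> real"
  assumes c: "continuous_on UNIV H"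
    and d: "\<And>y. y < m \<Longrightarrow> y \<noteq> p \<Longrightarrow> \<exists>D. (H has_real_derivative D) (at y) \<and> D > 0"
    and xy: "x < y" "y < m"
  shows "H x < H y"
proof -
  have inc: "H a < H b" if "a < b" "b < m" "p \<notin> {a<..<b}" for a b
    by (rule DERIV_pos_imp_increasing_open[OF that(1)])
       (use that d in \<open>auto intro: continuous_on_subset[OF c]\<close>)
  show ?thesis
  proof (cases "p \<in> {x<..<y}")
    case True
    thus ?thesis using inc[of x p] inc[of p y] xy by auto
  qed (use inc xy in blast)
qed

theorem theorem5p5:
  fixes P :: "'a measure" and B :: "real \<Rightarrow> 'a \<Rightarrow> real"
    and X :: "real \<Rightarrow> real \<Rightarrow> 'a \<Rightarrow> real"
    and \<theta> \<mu> \<sigma> \<rho> P\<^sub>0 c x\<^sub>1 x\<^sub>2 :: real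
    and \<phi> \<psi> \<Phi> \<gamma> \<zeta> :: "real \<Rightarrow> real"
    and U Uc V :: "real \<Rightarrow> real \<Rightarrow> real"
    and W :: "real \<Rightarrow> real \<Rightarrow> real \<Rightarrow> real"
    and solves :: "real \<Rightarrow> bool"
  assumes "prob_space P" and "complete_measure P"
    and "standard_brownian_motion P B"
    and "\<theta> > 0" and "\<mu> > 0" and "\<sigma> > 0" and "\<rho> > 0" and "P\<^sub>0 > 0"
    and X: "\<And>x. ou_strong_solution P B \<theta> \<mu> \<sigma> x (X x)"
    and \<phi>: "decreasing_fundamental_solution \<theta> \<mu> \<sigma> \<rho> \<phi>"
    and \<psi>: "increasing_fundamental_solution \<theta> \<mu> \<sigma> \<rho> \<psi>"
    and \<Phi>: "C2 \<Phi>" "antimono_on {0..1} \<Phi>" "strictly_convex_on {0..1} \<Phi>" "\<Phi> 1 = 0"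
    and k_neg: "\<And>c. c \<in> {0..1} \<Longrightarrow> \<rho> + \<theta> + \<rho> * deriv \<Phi> c < 0"
    and U_def: "U = control_value P B \<rho> \<Phi> X"
    \<comment> \<open>the known description of \<open>U\<close> through the boundary \<open>\<gamma>\<close>; \<open>Uc\<close> is \<open>U\<^sub>c\<close>, one-sided at \<open>c = 0, 1\<close>\<close>
    and Uc: "\<And>x c. c \<in> {0..1} \<Longrightarrow> ((\<lambda>c. U x c) has_real_derivative Uc x c) (at c within {0..1})"
    and \<gamma>_C1: "C1_on_interval 0 1 \<gamma>" and \<gamma>_decreasing: "antimono_on {0..1} \<gamma>"
    and \<gamma>: "{(x, c). c \<in> {0..1} \<and> Uc x c > - x} = {(x, c). c \<in> {0..1} \<and> x < \<gamma> c}"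
    and \<zeta>_def: "\<zeta> = (\<lambda>c. (\<rho> + \<theta>) * (1 - c) - \<rho> * \<Phi> c)"
    and \<gamma>_lower: "\<And>c. c \<in> {0..<1} \<Longrightarrow>
          \<gamma> c \<ge> max (\<theta> * \<mu> * (1 - c) / \<zeta> c) (\<theta> * \<mu> * \<Phi> c / \<zeta> c)"
    and U_C1: "\<And>c. c \<in> {0..1} \<Longrightarrow> (\<lambda>x. U x c) C1_differentiable_on UNIV"
    and U_formula: "\<And>x c. c \<in> {0..1} \<Longrightarrow> U x c =
          (if x < \<gamma> c
           then \<psi> x / \<psi> (\<gamma> c) *
                  (\<gamma> c * (1 - c) - \<rho> * \<Phi> c * ((\<gamma> c - \<mu>) / (\<rho> + \<theta>) + \<mu> / \<rho>))
                + \<rho> * \<Phi> c * ((x - \<mu>) / (\<rho> + \<theta>) + \<mu> / \<rho>)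
           else x * (1 - c))"
    and c: "c \<in> {0..<1}"
    and x\<^sub>1_def: "x\<^sub>1 = P\<^sub>0 / \<Phi> c"
    and x\<^sub>2_def: "x\<^sub>2 = (\<theta> * \<mu> * (1 - c) + \<rho> * P\<^sub>0) / ((\<rho> + \<theta>) * (1 - c))"
    and V_def: "V = (\<lambda>x c. stopping_value P B \<rho> (X x) (\<lambda>y. U y c - P\<^sub>0))"
    and W_def: "W = (\<lambda>l x c. if x > l then (U l c - P\<^sub>0) * (\<phi> x / \<phi> l) else U x c - P\<^sub>0)"
    and solves_def: "solves = (\<lambda>x. (U x c - P\<^sub>0) * (deriv \<phi> x / \<phi> x) = deriv (\<lambda>x. U x c) x)"
  shows
    \<comment> \<open>in each case, the last premise is the known optimality of the first entry time below \<open>l\<close>\<close>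
    "(\<gamma> c \<ge> x\<^sub>2 \<longrightarrow>
        (\<forall>l. l \<in> {..<x\<^sub>1} \<longrightarrow> {x. V x c = U x c - P\<^sub>0} = {..l} \<longrightarrow>
          (\<forall>x. V x c = stopping_cost P \<rho> (X x) (\<lambda>y. U y c - P\<^sub>0) (first_time_below (X x) l)) \<longrightarrow>
          (\<forall>x. V x c = W l x c) \<and> (\<forall>x. x \<in> {..<x\<^sub>1} \<and> solves x \<longleftrightarrow> x = l)))
     \<and> (\<gamma> c \<le> x\<^sub>1 \<longrightarrow>
        (\<forall>l. l \<in> {..<x\<^sub>2} \<longrightarrow> {x. V x c = U x c - P\<^sub>0} = {..l} \<longrightarrow>
          (\<forall>x. V x c = stopping_cost P \<rho> (X x) (\<lambda>y. U y c - P\<^sub>0) (first_time_below (X x) l)) \<longrightarrow>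
          (\<forall>x. V x c = W l x c) \<and> (\<forall>x. x \<in> {..<x\<^sub>2} \<and> solves x \<longleftrightarrow> x = l)))"
proof -

  \<comment> \<open>Constants, and the order of the two bounds\<close>
  define A where "A = 1 - c"
  define G where "G y = U y c - P\<^sub>0" for y
  have G_fun: "G = (\<lambda>y. U y c - P\<^sub>0)" by (simp add: fun_eq_iff G_def)
  have A: "A > 0" using c by (simp add: A_def)
  note pos = \<open>\<theta> > 0\<close> \<open>\<mu> > 0\<close> \<open>\<sigma> > 0\<close> \<open>\<rho> > 0\<close> \<open>P\<^sub>0 > 0\<close>
  \<comment> \<open>The mean value theorem on \<open>[c, 1]\<close>, where
    \<open>\<Phi> 1 = 0\<close> and \<open>\<rho> * deriv \<Phi>\<close> is below
    \<open>- (\<rho> + \<theta>)\<close>. The claim is \<open>\<zeta> c < 0\<close>, and it is the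
    reason for \<open>x\<^sub>1 < x\<^sub>2\<close>.\<close>
  have \<Phi>A: "\<rho> * \<Phi> c > (\<rho> + \<theta>) * A"
  proof -
    obtain \<xi> where \<xi>: "c < \<xi>" "\<xi> < 1" "\<Phi> 1 - \<Phi> c = (1 - c) * deriv \<Phi> \<xi>"
      using MVT2[of c 1 \<Phi> "deriv \<Phi>"] C2_deriv(1)[OF \<Phi>(1)] c by auto
    have "\<rho> * deriv \<Phi> \<xi> < - (\<rho> + \<theta>)" using k_neg[of \<xi>] \<xi> c by simp
    hence 1: "A * (\<rho> * deriv \<Phi> \<xi>) < A * - (\<rho> + \<theta>)" using A by (intro mult_strict_left_mono) auto
    have "\<Phi> c = - (A * deriv \<Phi> \<xi>)" using \<xi>(3) \<Phi>(4) by (simp add: A_def)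
    hence "\<rho> * \<Phi> c = - (A * (\<rho> * deriv \<Phi> \<xi>))" by simp
    thus ?thesis using 1 by (simp add: algebra_simps)
  qed
  have \<rho>\<theta>A: "(\<rho> + \<theta>) * A > 0" using A pos by simp
  hence \<rho>\<Phi>: "\<rho> * \<Phi> c > 0" using \<Phi>A by linarith
  hence \<Phi>c: "\<Phi> c > 0" using pos by (simp add: zero_less_mult_iff)
  have x1: "\<Phi> c * x\<^sub>1 = P\<^sub>0" using \<Phi>c by (simp add: x\<^sub>1_def)
  have x2: "(\<rho> + \<theta>) * A * x\<^sub>2 = \<theta> * \<mu> * A + \<rho> * P\<^sub>0" 
    using less_imp_neq[OF \<rho>\<theta>A] unfolding x\<^sub>2_def A_def[symmetric] by simp
  have x12: "x\<^sub>1 < x\<^sub>2"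
  proof -
    have "x\<^sub>1 > 0" using \<Phi>c pos by (simp add: x\<^sub>1_def)
    hence "(\<rho> + \<theta>) * A * x\<^sub>1 < \<rho> * \<Phi> c * x\<^sub>1" using \<Phi>A by (intro mult_strict_right_mono)
    also have "\<dots> = \<rho> * P\<^sub>0" using x1 by simp
    also have "\<dots> < (\<rho> + \<theta>) * A * x\<^sub>2" unfolding x2 using pos A by simp
    finally show ?thesis unfolding mult_less_cancel_left_pos[OF \<rho>\<theta>A] .
  qed
  \<comment> \<open>Left of \<open>\<gamma> c\<close> the value function is
    \<open>\<alpha> * \<psi> y\<close> plus the affine function \<open>s * y + k\<close>.\<close>
  define \<alpha> where "\<alpha> = (\<gamma> c * A - \<rho> * \<Phi> c * ((\<gamma> c - \<mu>) / (\<rho> + \<theta>) + \<mu> / \<rho>)) / \<psi> (\<gamma> c)"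
  define s where "s = \<rho> * \<Phi> c / (\<rho> + \<theta>)"
  define k where "k = \<rho> * \<Phi> c * (\<mu> / \<rho> - \<mu> / (\<rho> + \<theta>))"
  have s: "s > 0" "s * (\<rho> + \<theta>) = \<rho> * \<Phi> c" using \<rho>\<Phi> pos by (auto simp: s_def)
  \<comment> \<open>This makes the constants cancel: applying generator minus \<rho> to
    \<open>s * y + k\<close> leaves \<open>- \<rho> * \<Phi> c * y\<close>.\<close>
  have k: "\<rho> * k = \<theta> * \<mu> * s"
  proof -
    have "\<mu> / \<rho> - \<mu> / (\<rho> + \<theta>) = \<mu> * \<theta> / (\<rho> * (\<rho> + \<theta>))" using pos by (simp add: field_simps)
    thus ?thesis using pos by (simp add: k_def s_def)
  qed
  have c01: "c \<in> {0..1}" using c by auto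
  have G_left: "G y = \<alpha> * \<psi> y + s * y + k - P\<^sub>0" if "y < \<gamma> c" for y
  proof -
    have "\<rho> * \<Phi> c * ((y - \<mu>) / (\<rho> + \<theta>) + \<mu> / \<rho>) = s * y + k"
      by (simp add: s_def k_def diff_divide_distrib algebra_simps)
    thus ?thesis using that unfolding G_def U_formula[OF c01] by (simp add: \<alpha>_def A_def)
  qed
  have G_right: "G y = A * y - P\<^sub>0" if "y \<ge> \<gamma> c" for y
    using that unfolding G_def U_formula[OF c01] by (simp add: A_def)
  \<comment> \<open>The C1 property gives a derivative that is continuous across
    \<open>\<gamma> c\<close>, where the formula changes; the Wronskian inherits this
    continuity.\<close>
  obtain g where g: "\<And>y. ((\<lambda>x. U x c) has_vector_derivative g y) (at y)" "continuous_on UNIV g"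
    using U_C1[OF c01] unfolding C1_differentiable_on_def by auto
  have Ug: "((\<lambda>x. U x c) has_real_derivative g y) (at y)" for y
    using g(1)[of y] by (simp add: has_real_derivative_iff_has_vector_derivative)
  hence dU: "deriv (\<lambda>x. U x c) y = g y" for y by (rule DERIV_imp_deriv)
  have Gg: "(G has_real_derivative g y) (at y)" for y
    unfolding G_def using DERIV_diff[OF Ug DERIV_const] by simp
  have C\<psi>: "C2 \<psi>" and C\<phi>: "C2 \<phi>" using \<psi> \<phi> by (auto simp: increasing_fundamental_solution_def decreasing_fundamental_solution_def)
  have \<phi>pos: "\<phi> y > 0" for y using \<phi> by (simp add: decreasing_fundamental_solution_def)
  have g_left: "g y = \<alpha> * deriv \<psi> y + s" if "y < \<gamma> c" for y
  proof (rule DERIV_unique[OF Gg])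
    have "((\<lambda>y. \<alpha> * \<psi> y + s * y + k - P\<^sub>0) has_real_derivative \<alpha> * deriv \<psi> y + s) (at y)"
      by (auto intro!: derivative_eq_intros C2_deriv(1)[OF C\<psi>])
    thus "(G has_real_derivative \<alpha> * deriv \<psi> y + s) (at y)"
      by (rule has_field_derivative_transform_within_open[of _ _ _ "{..<\<gamma> c}"]) (use that G_left in auto)
  qed
  have g_right: "g y = A" if "y > \<gamma> c" for y
  proof (rule DERIV_unique[OF Gg])
    have "((\<lambda>y. A * y - P\<^sub>0) has_real_derivative A) (at y)"
      by (auto intro!: derivative_eq_intros)
    thus "(G has_real_derivative A) (at y)"
      by (rule has_field_derivative_transform_within_open[of _ _ _ "{\<gamma> c<..}"]) (use that G_right in auto)
  qed

  \<comment> \<open>The weighted Wronskian and the sign of its derivative\<close>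
  define H where "H y = (g y * \<phi> y - G y * deriv \<phi> y) * exp (- \<theta> * (y - \<mu>)^2 / \<sigma>^2)" for y
  have H_deriv: "(H has_real_derivative 2 / \<sigma>^2 * exp (- \<theta> * (y - \<mu>)^2 / \<sigma>^2) * \<phi> y *
      (1/2 * \<sigma>^2 * g' + \<theta> * (\<mu> - y) * g y - \<rho> * G y)) (at y)"
    if "(g has_real_derivative g') (at y)" for y g'
    unfolding H_def by (rule weighted_wronskian_deriv[OF \<phi> _ Gg that]) (use pos in simp)
  have H_left: "\<exists>D. (H has_real_derivative D) (at y) \<and> D > 0" if y: "y < \<gamma> c" "y < x\<^sub>1" for y
  proof -
    have "((\<lambda>y. \<alpha> * deriv \<psi> y + s) has_real_derivative \<alpha> * deriv (deriv \<psi>) y) (at y)"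
      by (auto intro!: derivative_eq_intros C2_deriv(2)[OF C\<psi>])
    hence "(g has_real_derivative \<alpha> * deriv (deriv \<psi>) y) (at y)"
      by (rule has_field_derivative_transform_within_open[of _ _ _ "{..<\<gamma> c}"]) (use y g_left in auto)
    note D = H_deriv[OF this]
    \<comment> \<open>The multiple of \<psi> is annihilated by generator minus \<rho>, so the defect
      comes from the affine part and \<open>P\<^sub>0\<close> alone.\<close>
    have "1/2 * \<sigma>^2 * deriv (deriv \<psi>) y + \<theta> * (\<mu> - y) * deriv \<psi> y = \<rho> * \<psi> y"
      using \<psi> by (auto simp: increasing_fundamental_solution_def ou_generator_def)
    hence "\<alpha> * (1/2 * \<sigma>^2 * deriv (deriv \<psi>) y + \<theta> * (\<mu> - y) * deriv \<psi> y) = \<alpha> * (\<rho> * \<psi> y)" by simp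
    hence "1/2 * \<sigma>^2 * (\<alpha> * deriv (deriv \<psi>) y) + \<theta> * (\<mu> - y) * g y - \<rho> * G y
        = \<theta> * \<mu> * s - \<rho> * k - s * (\<rho> + \<theta>) * y + \<rho> * P\<^sub>0"
      unfolding g_left[OF y(1)] G_left[OF y(1)] by (simp add: algebra_simps)
    also have "\<dots> = \<rho> * \<Phi> c * (x\<^sub>1 - y)"
      unfolding k s(2) using x1 by (simp add: algebra_simps)
    also have "\<dots> > 0" using \<rho>\<Phi> y by simp
    finally have "1/2 * \<sigma>^2 * (\<alpha> * deriv (deriv \<psi>) y) + \<theta> * (\<mu> - y) * g y - \<rho> * G y > 0" .
    thus ?thesis using D pos \<phi>pos[of y] by (intro exI conjI[OF D] mult_pos_pos) auto
  qed
  have H_right: "\<exists>D. (H has_real_derivative D) (at y) \<and> D > 0" if y: "y > \<gamma> c" "y < x\<^sub>2" for y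
  proof -
    have "((\<lambda>y. A) has_real_derivative 0) (at y)" by simp
    hence "(g has_real_derivative 0) (at y)"
      by (rule has_field_derivative_transform_within_open[of _ _ _ "{\<gamma> c<..}"]) (use y g_right in auto)
    note D = H_deriv[OF this]
    have "1/2 * \<sigma>^2 * 0 + \<theta> * (\<mu> - y) * g y - \<rho> * G y = \<theta> * \<mu> * A + \<rho> * P\<^sub>0 - (\<rho> + \<theta>) * A * y"
      using y unfolding g_right[OF y(1)] by (subst G_right) (auto simp: algebra_simps)
    also have "\<dots> = (\<rho> + \<theta>) * A * (x\<^sub>2 - y)"
      unfolding x2[symmetric] by (simp add: algebra_simps)
    also have "\<dots> > 0" using \<rho>\<theta>A y by simp
    finally have "1/2 * \<sigma>^2 * 0 + \<theta> * (\<mu> - y) * g y - \<rho> * G y > 0" .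
    thus ?thesis using D pos \<phi>pos[of y] by (intro exI conjI[OF D] mult_pos_pos) auto
  qed
  have H_cont: "continuous_on UNIV H"
  proof -
    have "continuous_on UNIV G" "continuous_on UNIV \<phi>" "continuous_on UNIV (deriv \<phi>)"
      using DERIV_isCont[OF Gg] DERIV_isCont[OF C2_deriv(1)[OF C\<phi>]] DERIV_isCont[OF C2_deriv(2)[OF C\<phi>]]
      by (blast intro: continuous_at_imp_continuous_on)+
    thus ?thesis unfolding H_def using g(2) pos by (intro continuous_intros) auto
  qed
  have solves: "solves y \<longleftrightarrow> H y = 0" for y
  proof -
    have "G y * (deriv \<phi> y / \<phi> y) = g y \<longleftrightarrow> G y * deriv \<phi> y = g y * \<phi> y"
      using \<phi>pos[of y] by (simp add: divide_eq_eq)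
    thus ?thesis unfolding solves_def dU H_def G_def[symmetric] by auto
  qed

  \<comment> \<open>A lower bound for the payoff by a multiple of \<open>1 + ou_phi\<close>\<close>
  obtain K0 where K0: "K0 > 0" "\<And>y. - y \<le> K0 * (1 + ou_phi \<theta> \<mu> \<sigma> \<rho> y)"
    using ou_phi_linear_lower_bound[of \<theta> \<sigma> \<rho> \<mu>] pos by metis
  \<comment> \<open>Left of \<open>\<gamma> c\<close> the \<psi> term is at most its size at
    \<open>\<gamma> c\<close>, since \<psi> increases. The linear parts have the positive slopes
    \<open>s\<close> on the left and \<open>A\<close> on the right, and their sum serves both
    sides.\<close>
  define K where "K = \<bar>\<alpha>\<bar> * \<psi> (\<gamma> c) + \<bar>k\<bar> + P\<^sub>0 + (s + A) * K0"
  have \<psi>pos: "\<psi> y > 0" for y using \<psi> by (simp add: increasing_fundamental_solution_def)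
  have K: "K \<ge> 0" using pos s A K0 \<psi>pos[of "\<gamma> c"] by (simp add: K_def add_nonneg_nonneg)
  have G_low: "- K * (1 + ou_phi \<theta> \<mu> \<sigma> \<rho> y) \<le> G y" for y
  proof -
    let ?f = "1 + ou_phi \<theta> \<mu> \<sigma> \<rho> y"
    have f: "?f \<ge> 1" using ou_phi_pos[of \<theta> \<sigma> \<rho> \<mu> y] pos by simp
    have lin: "- (a * y) \<le> a * K0 * ?f" if "a > 0" for a
      using mult_left_mono[OF K0(2)[of y], of a] that by (simp add: mult.assoc)
    define R where "R = \<bar>\<alpha>\<bar> * \<psi> (\<gamma> c) + \<bar>k\<bar> + P\<^sub>0"
    have R: "R \<ge> 0" using \<psi>pos[of "\<gamma> c"] pos by (simp add: R_def)
    have Rf: "R \<le> R * ?f" using mult_left_mono[OF f R] by simp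
    have Kf: "K * ?f = R * ?f + s * K0 * ?f + A * K0 * ?f" by (simp add: K_def R_def algebra_simps)
    have nn: "s * K0 * ?f \<ge> 0" "A * K0 * ?f \<ge> 0" using s A K0 f by auto
    have "- G y \<le> K * ?f"
    proof (cases "y < \<gamma> c")
      case True
      have "\<psi> y \<le> \<psi> (\<gamma> c)" using \<psi> True
        by (auto simp: increasing_fundamental_solution_def strict_mono_def less_imp_le)
      hence "\<bar>\<alpha>\<bar> * \<psi> y \<le> \<bar>\<alpha>\<bar> * \<psi> (\<gamma> c)" by (intro mult_left_mono) auto
      moreover have "- (\<alpha> * \<psi> y) \<le> \<bar>\<alpha>\<bar> * \<psi> y"
        using \<psi>pos[of y] mult_right_mono[of "- \<alpha>" "\<bar>\<alpha>\<bar>" "\<psi> y"] by simp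
      moreover have "- k \<le> \<bar>k\<bar>" by simp
      ultimately have "- G y \<le> R - s * y" unfolding G_left[OF True] R_def by linarith
      thus ?thesis using lin[OF s(1)] Rf nn unfolding Kf by linarith
    next
      case False
      have "\<bar>\<alpha>\<bar> * \<psi> (\<gamma> c) \<ge> 0" "\<bar>k\<bar> \<ge> 0" using \<psi>pos[of "\<gamma> c"] by auto
      hence "- G y \<le> R - A * y" using G_right[of y] False unfolding R_def by linarith
      thus ?thesis using lin[OF A] Rf nn unfolding Kf by linarith
    qed
    thus ?thesis by simp
  qed
  \<comment> \<open>The common part of both cases: \<open>m\<close> stands for
    \<open>x\<^sub>1\<close> or \<open>x\<^sub>2\<close>, and the cases differ only in why the
    derivative of \<open>H\<close> is positive below \<open>m\<close>.\<close>
  have main: "(\<forall>x. V x c = W l x c) \<and> (\<forall>x. x \<in> {..<m} \<and> solves x \<longleftrightarrow> x = l)"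
    if l: "l < m" and opt: "\<forall>x. V x c = stopping_cost P \<rho> (X x) (\<lambda>y. U y c - P\<^sub>0) (first_time_below (X x) l)"
      and inc: "\<And>y. y < m \<Longrightarrow> y \<noteq> \<gamma> c \<Longrightarrow> \<exists>D. (H has_real_derivative D) (at y) \<and> D > 0" for l m
  proof -
    have VG: "V x c = stopping_value P B \<rho> (X x) G" for x
      by (simp add: V_def G_fun)
    have opt': "stopping_value P B \<rho> (X x) G = stopping_cost P \<rho> (X x) G (first_time_below (X x) l)" for x
      using opt[rule_format, of x] unfolding VG G_fun[symmetric] .
    note thr = threshold_minimizes_ratio[OF assms(1-3) pos(1) pos(3) pos(4) X \<phi> K G_low opt']
    have VW: "V x c = W l x c" for x
      unfolding VG thr(1) W_def G_def by simp
    \<comment> \<open>The threshold \<open>l\<close> is a two-sided minimum of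
      \<open>G / \<phi>\<close>, so the derivative of this quotient vanishes there; its numerator is
      the Wronskian.\<close>
    have Hl: "H l = 0"
    proof -
      have "((\<lambda>y. G y / \<phi> y) has_real_derivative (g l * \<phi> l - G l * deriv \<phi> l) / (\<phi> l * \<phi> l)) (at l)"
        using \<phi>pos[of l] by (intro DERIV_divide Gg C2_deriv(1)[OF C\<phi>]) auto
      hence "(g l * \<phi> l - G l * deriv \<phi> l) / (\<phi> l * \<phi> l) = 0"
        by (rule DERIV_local_min[where d = 1]) (use thr(2) in auto)
      thus ?thesis using \<phi>pos[of l] by (simp add: H_def)
    qed
    have uniq: "x = l" if "x < m" "H x = 0" for x
      using strictly_increasing_across_point[OF H_cont inc, where m = m and x = x and y = l]
        strictly_increasing_across_point[OF H_cont inc, where m = m and x = l and y = x]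
        that l Hl by (cases x l rule: linorder_cases) auto
    show ?thesis
    proof (intro conjI allI iffI VW)
      show "x = l" if "x \<in> {..<m} \<and> solves x" for x
        using that uniq[of x] unfolding solves lessThan_iff by blast
      show "x \<in> {..<m}" if "x = l" for x using that l by simp
      show "solves x" if "x = l" for x using that Hl unfolding solves by simp
    qed
  qed
  \<comment> \<open>Here \<open>x\<^sub>1 < x\<^sub>2 \<le> \<gamma> c\<close>, so the half-line
    below \<open>x\<^sub>1\<close> lies entirely in the region of the first formula.\<close>
  have i: "(\<forall>x. V x c = W l x c) \<and> (\<forall>x. x \<in> {..<x\<^sub>1} \<and> solves x \<longleftrightarrow> x = l)"
    if "\<gamma> c \<ge> x\<^sub>2" "l \<in> {..<x\<^sub>1}"
      "\<forall>x. V x c = stopping_cost P \<rho> (X x) (\<lambda>y. U y c - P\<^sub>0) (first_time_below (X x) l)" for l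
  proof (rule main[OF _ that(3)])
    show "l < x\<^sub>1" using that(2) by simp
    show "\<exists>D. (H has_real_derivative D) (at y) \<and> D > 0" if "y < x\<^sub>1" "y \<noteq> \<gamma> c" for y
      by (rule H_left) (use that \<open>\<gamma> c \<ge> x\<^sub>2\<close> x12 in linarith)+
  qed
  \<comment> \<open>Here \<open>\<gamma> c \<le> x\<^sub>1 < x\<^sub>2\<close>: points left of
    \<open>\<gamma> c\<close> are also left of \<open>x\<^sub>1\<close>, and the others are left of
    \<open>x\<^sub>2\<close>, so both sign conditions hold and \<open>\<gamma> c\<close> is the only
    exceptional point.\<close>
  have ii: "(\<forall>x. V x c = W l x c) \<and> (\<forall>x. x \<in> {..<x\<^sub>2} \<and> solves x \<longleftrightarrow> x = l)"
    if "\<gamma> c \<le> x\<^sub>1" "l \<in> {..<x\<^sub>2}"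
      "\<forall>x. V x c = stopping_cost P \<rho> (X x) (\<lambda>y. U y c - P\<^sub>0) (first_time_below (X x) l)" for l
  proof (rule main[OF _ that(3)])
    show "l < x\<^sub>2" using that(2) by simp
    show "\<exists>D. (H has_real_derivative D) (at y) \<and> D > 0" if "y < x\<^sub>2" "y \<noteq> \<gamma> c" for y
    proof (cases "y < \<gamma> c")
      case True
      thus ?thesis by (rule H_left) (use True \<open>\<gamma> c \<le> x\<^sub>1\<close> in linarith)
    next
      case False
      thus ?thesis by (intro H_right) (use that in linarith)+
    qed
  qed
  show ?thesis
    using i ii by blast
qed

end
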